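(* Let $q\in[1,2)$ and $\delta\in(0,1)$, and let $$\mathcal F_{q,\delta}:=\Big\{f\in\mathcal W_q[0,1]:\|f\|_{[q]}\le1,\ \int_0^1f^2(x)\,dx>\delta\Big\}.$$ Let $\widehat\beta_n(f)$ be the least squares estimator of $\beta\in\mathbb R$ in the regression model $Y_j=\beta f(j/n)+X_j$, $j=1,\dots,n$, where $X_1,X_2,\dots$ is a short-memory linear process $X_i=\sum_{j=0}^\infty\psi_j\eta_{i-j}$, and let $$Q_n(f):=\Big[\sum_{j=1}^nf^2\Big(\frac jn\Big)\Big]^{1/2}\big[\widehat\beta_n(f)-\beta\big].$$ Then there exists a version of a Gaussian process $\nu_2$ indexed by $\mathcal F_{q,\delta}$ with values in a separable subset of $\ell^\infty(\mathcal F_{q,\delta})$, which is measurable for the Borel sets on its range, and $$Q_n\xrightarrow{\mathscr D^*}\sigma_\eta A_\psi\,\nu_2\qquad\text{in }\ell^\infty(\mathcal F_{q,\delta})\text{ as }n\to\infty .$$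
   Context: Short-memory linear process: $(\eta_j)_{j\in\mathbb Z}$ are i.i.d. real random variables on a probability space $(\Omega,\mathcal A,\mathsf P)$ with mean zero and finite variance $\sigma_\eta^2=\mathsf E\eta_1^2\neq0$ ($\sigma_\eta>0$); $(\psi_j)_{j\ge0}$ are real numbers with $\sum_{j\ge0}|\psi_j|<\infty$ and $A_\psi:=\sum_{j\ge0}\psi_j\ne0$; and $X_i=\sum_{j=0}^\infty\psi_j\eta_{i-j}$ for $i\in\mathbb Z$. Least squares estimator: for $f:[0,1]\to\mathbb R$ and $Y_j=\beta f(j/n)+X_j$, $\widehat\beta_n(f)=\big(\sum_{j=1}^nf^2(j/n)\big)^{-1}\sum_{j=1}^nY_jf(j/n)$, so that $\sum_{j=1}^nf^2(j/n)\,[\widehat\beta_n(f)-\beta]=\sum_{j=1}^nX_jf(j/n)$. The process $Q_n$ is indexed by $f\in\mathcal F_{q,\delta}$; the statement is asymptotic and concerns $n$ large enough that $\inf_{f\in\mathcal F_{q,\delta}}\frac1n\sum_{j=1}^nf^2(j/n)>0$. $q$-variation: $v_q(g)=\sup\{\sum_{i=1}^m|g(t_i)-g(t_{i-1})|^q:0=t_0<\dots<t_m=1,\ m\ge1\}$; $\mathcal W_q[0,1]$ is the set of $g:[0,1]\to\mathbb R$ with $v_q(g)<\infty$, with norm $\|g\|_{[q]}=\sup_{t\in[0,1]}|g(t)|+v_q(g)^{1/q}$. $\ell^\infty(\mathcal F)$: the Banach space of bounded functions $\mu:\mathcal F\to\mathbb R$ with norm $\|\mu\|_{\mathcal F}=\sup_{f\in\mathcal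 F}|\mu(f)|$. Convergence in outer distribution: let $\mathbb E$ be a metric space, let $Z_n$ be (arbitrary) functions from probability spaces $(\Omega_n,\mathcal A_n,P_n)$ into $\mathbb E$, $n\ge0$, where $Z_0$ takes values in a separable subset of $\mathbb E$ and is measurable for the Borel sets on its range. Then $Z_n\xrightarrow{\mathscr D^*}Z_0$ means $\lim_{n\to\infty}E^*h(Z_n)=Eh(Z_0)$ for every bounded continuous $h:\mathbb E\to\mathbb R$, where $E^*T=\inf\{EU:U\text{ measurable},\ EU\text{ exists},\ U\ge T\}$ is the outer integral. *)

theory Defs
  imports "HOL-Probability.Probability"
begin

section \<open>Functions of bounded \<open>q\<close>-variation on \<open>[0,1]\<close>\<close>

definition partitions01 :: "(nat \<times> (nat \<Rightarrow> real)) set" where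
  "partitions01 = {(m, t). 1 \<le> m \<and> t 0 = 0 \<and> t m = 1 \<and> (\<forall>i<m. t i < t (Suc i))}"

definition q_variation :: "real \<Rightarrow> (real \<Rightarrow> real) \<Rightarrow> ennreal" where
  "q_variation q g =
     (SUP (m, t)\<in>partitions01. ennreal (\<Sum>i = 1..m. \<bar>g (t i) - g (t (i - 1))\<bar> powr q))"

text \<open>Functions \<open>[0,1] \<rightarrow> \<real>\<close> are represented as functions on \<open>\<real>\<close> that are \<open>extensional\<close> on
  \<open>[0,1]\<close>, so that equality is equality on \<open>[0,1]\<close>.\<close>

definition W_space :: "real \<Rightarrow> (real \<Rightarrow> real) set" where
  "W_space q = {g \<in> extensional {0..1}. q_variation q g < \<infinity>}"

definition W_norm :: "real \<Rightarrow> (real \<Rightarrow> real) \<Rightarrow> real" where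
  "W_norm q g = (SUP t\<in>{0..1}. \<bar>g t\<bar>) + enn2real (q_variation q g) powr (1 / q)"

definition F_class :: "real \<Rightarrow> real \<Rightarrow> (real \<Rightarrow> real) set" where
  "F_class q \<delta> = {f \<in> W_space q. W_norm q f \<le> 1 \<and> integral {0..1} (\<lambda>x. (f x)\<^sup>2) > \<delta>}"

section \<open>Convergence in outer distribution\<close>

abbreviation linfty :: "'i set \<Rightarrow> ('i \<Rightarrow> real) metric" where
  "linfty I \<equiv> funspace I euclidean_metric"

definition borel_on :: "'e topology \<Rightarrow> 'e measure" where
  "borel_on X = sigma (topspace X) {U. openin X U}"

definition separably_valued :: "'b measure \<Rightarrow> 'e metric \<Rightarrow> ('b \<Rightarrow> 'e) \<Rightarrow> bool" where
  "separably_valued M E Z \<longleftrightarrow>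
     (\<exists>S \<subseteq> mspace E. separable_space (subtopology (mtopology_of E) S) \<and> Z \<in> space M \<rightarrow> S)"

definition borel_measurable_on_range :: "'b measure \<Rightarrow> 'e metric \<Rightarrow> ('b \<Rightarrow> 'e) \<Rightarrow> bool" where
  "borel_measurable_on_range M E Z \<longleftrightarrow>
     Z \<in> M \<rightarrow>\<^sub>M borel_on (subtopology (mtopology_of E) (Z ` space M))"

text \<open>The expectation of an extended real random variable exists if its positive part or its
  negative part has finite integral; \<open>e2ennreal\<close> maps negative arguments to \<open>0\<close>.\<close>

definition expectation_exists :: "'a measure \<Rightarrow> ('a \<Rightarrow> ereal) \<Rightarrow> bool" where
  "expectation_exists M U \<longleftrightarrow>
     (\<integral>\<^sup>+ x. e2ennreal (U x) \<partial>M) < \<infinity> \<or> (\<integral>\<^sup>+ x. e2ennreal (- U x) \<partial>M) < \<infinity>"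

definition extended_expectation :: "'a measure \<Rightarrow> ('a \<Rightarrow> ereal) \<Rightarrow> ereal" where
  "extended_expectation M U =
     enn2ereal (\<integral>\<^sup>+ x. e2ennreal (U x) \<partial>M) - enn2ereal (\<integral>\<^sup>+ x. e2ennreal (- U x) \<partial>M)"

definition outer_expectation :: "'a measure \<Rightarrow> ('a \<Rightarrow> real) \<Rightarrow> ereal" where
  "outer_expectation M T =
     Inf {extended_expectation M U | U.
       U \<in> borel_measurable M \<and> expectation_exists M U \<and> (\<forall>x\<in>space M. ereal (T x) \<le> U x)}"

text \<open>The \<open>Z n\<close> need not be measurable. They are required to take values in \<open>E\<close> only for all
  sufficiently large \<open>n\<close>.\<close>

definition converges_outer_distribution ::
  "'e metric \<Rightarrow> (nat \<Rightarrow> 'a measure) \<Rightarrow> (nat \<Rightarrow> 'a \<Rightarrow> 'e) \<Rightarrow> 'b measure \<Rightarrow> ('b \<Rightarrow> 'e) \<Rightarrow> bool" where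
  "converges_outer_distribution E M Z M0 Z0 \<longleftrightarrow>
     (\<forall>\<^sub>F n in sequentially. Z n \<in> space (M n) \<rightarrow> mspace E) \<and>
     separably_valued M0 E Z0 \<and> borel_measurable_on_range M0 E Z0 \<and>
     (\<forall>h. continuous_map (mtopology_of E) euclideanreal h \<and> bounded (h ` mspace E) \<longrightarrow>
        (\<lambda>n. outer_expectation (M n) (\<lambda>\<omega>. h (Z n \<omega>)))
          \<longlonglongrightarrow> ereal (\<integral>\<omega>. h (Z0 \<omega>) \<partial>M0))"

section \<open>Gaussian processes\<close>

text \<open>Degenerate (almost surely constant) variables count as Gaussian.\<close>

definition gaussian_rv :: "'b measure \<Rightarrow> ('b \<Rightarrow> real) \<Rightarrow> bool" where
  "gaussian_rv M X \<longleftrightarrow> X \<in> borel_measurable M \<and>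
     (\<exists>\<mu>. (AE \<omega> in M. X \<omega> = \<mu>) \<or> (\<exists>\<sigma>>0. distributed M lborel X (normal_density \<mu> \<sigma>)))"

definition gaussian_process :: "'b measure \<Rightarrow> 'i set \<Rightarrow> ('b \<Rightarrow> 'i \<Rightarrow> real) \<Rightarrow> bool" where
  "gaussian_process M I G \<longleftrightarrow>
     (\<forall>J c. finite J \<and> J \<subseteq> I \<longrightarrow> gaussian_rv M (\<lambda>\<omega>. \<Sum>i\<in>J. c i * G \<omega> i))"

section \<open>Linear processes and the least squares estimator\<close>

text \<open>For absolutely summable \<open>\<psi>\<close> and square integrable i.i.d. \<open>\<eta>\<close> the series converges almost
  surely.\<close>

definition linear_process :: "(nat \<Rightarrow> real) \<Rightarrow> (int \<Rightarrow> 'a \<Rightarrow> real) \<Rightarrow> int \<Rightarrow> 'a \<Rightarrow> real" where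
  "linear_process \<psi> \<eta> i \<omega> = (\<Sum>j. \<psi> j * \<eta> (i - int j) \<omega>)"

definition lse :: "nat \<Rightarrow> (real \<Rightarrow> real) \<Rightarrow> (nat \<Rightarrow> real) \<Rightarrow> real" where
  "lse n f Y = inverse (\<Sum>j = 1..n. (f (real j / real n))\<^sup>2) * (\<Sum>j = 1..n. Y j * f (real j / real n))"

text \<open>If \<open>f\<close> vanishes at all \<open>j/n\<close>, the value below is \<open>0\<close>.\<close>

definition Q_process ::
  "(real \<Rightarrow> real) set \<Rightarrow> real \<Rightarrow> (int \<Rightarrow> 'a \<Rightarrow> real) \<Rightarrow> nat \<Rightarrow> 'a \<Rightarrow> (real \<Rightarrow> real) \<Rightarrow> real" where
  "Q_process F \<beta> X n \<omega> =
     (\<lambda>f\<in>F. sqrt (\<Sum>j = 1..n. (f (real j / real n))\<^sup>2) *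
              (lse n f (\<lambda>j. \<beta> * f (real j / real n) + X (int j) \<omega>) - \<beta>))"

end

theory Submission
  imports Defs "HOL-Real_Asymp.Real_Asymp"
begin

text \<open>
  The estimate behind everything is pathwise. Record a walk only when it has moved by at least
  \<open>\<epsilon>\<close> since the last record. If the steps are independent and centred with total
  variance \<open>v\<close>, the expected number of records is at most \<open>v /
  \<epsilon>\<^sup>2\<close>; only second moments are needed. The difference of the records at scales
  \<open>2 powr (- l)\<close> and \<open>2 powr (- l - 1)\<close> is bounded by \<open>2 powr (1 -
  l)\<close> and has of the order of \<open>4 ^ l\<close> jumps, so summation by parts and Hoelder's
  inequality bound its integral against any \<open>f\<close> of \<open>q\<close>-variation at most
  \<open>1\<close> by a multiple of \<open>2 powr (- l) * 4 powr (l * (1 - 1 / q)) = 2 powr (l * (1 - 2 /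
  q))\<close> in the mean. This is summable exactly because \<open>q < 2\<close>. Hence two walks that are
  uniformly close have close integrals, uniformly in \<open>f\<close>.

  Applied to a walk and its block sums, with a maximal inequality and the central limit theorem for the
  oscillation inside the blocks, this reduces the weighted sums to finitely many block sums. Applied to two
  consecutive dyadic levels of a Brownian motion, it constructs the limit process as a uniform limit. A
  linear process is the superposition of shifted copies of the innovations: a shift by a fixed
  \<open>s\<close> does not change the block sums in the limit, and the tail of the series is controlled by
  the uniform first moment bound. Outer convergence follows from these approximations by squeezing a bounded
  continuous functional between its Lipschitz envelopes.
\<close>

section \<open>Functions of bounded variation along finite chains\<close>

text \<open>The limit is \<nu>(f) = (integral of f dW) / (L2 norm of f) for a Brownian motion W:
  \<open>Q_process\<close> is the sum of f(i/n) X_i / sqrt n over the root of the Riemann sum of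
  f^2, and this Riemann sum converges uniformly over the class at rate 1 / sqrt n. Both obstacles
  come from the supremum over the class. First, with two moments there are no exponential
  inequalities to chain through the class of functions; bounding the integral path by path, for all
  f at once, by quantities of the walk alone replaces this by chaining in the resolution of the
  walk. Second, such suprema need not be measurable. Uniform estimates are therefore given by
  integrable random variables and measurable exceptional events that do not involve f; outer
  expectations can be compared with these. The number of records is controlled in the mean because
  the sum of the squared recorded moves is at most the quadratic variation of the walk plus a
  martingale term; this is how independence and centring enter the pathwise bound.\<close>

fun chain_var :: "real \<Rightarrow> ('i \<Rightarrow> real) \<Rightarrow> 'i list \<Rightarrow> real" where
  "chain_var q g (x # y # xs) = \<bar>g y - g x\<bar> powr q + chain_var q g (y # xs)"
| "chain_var q g _ = 0"

lemma chain_var_map: "chain_var q f (map \<tau> xs) = chain_var q (\<lambda>i. f (\<tau> i)) xs"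
  by (induction q "\<lambda>i. f (\<tau> i)" xs rule: chain_var.induct) auto

lemma chain_var_nonneg: "0 \<le> chain_var q g xs"
  by (induction q g xs rule: chain_var.induct) auto

lemma chain_var_eq_sum: "chain_var q g xs = (\<Sum>i = 1..length xs - 1. \<bar>g (xs ! i) - g (xs ! (i - 1))\<bar> powr q)"
proof (induction q g xs rule: chain_var.induct)
  case (1 q g x y xs)
  have "(\<Sum>i = 1..length (x # y # xs) - 1. \<bar>g ((x # y # xs) ! i) - g ((x # y # xs) ! (i - 1))\<bar> powr q)
      = \<bar>g y - g x\<bar> powr q + (\<Sum>i = 2..length xs + 1. \<bar>g ((x # y # xs) ! i) - g ((x # y # xs) ! (i - 1))\<bar> powr q)"
    by (subst sum.atLeast_Suc_atMost) (auto simp: numeral_2_eq_2)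
  also have "(\<Sum>i = 2..length xs + 1. \<bar>g ((x # y # xs) ! i) - g ((x # y # xs) ! (i - 1))\<bar> powr q)
      = (\<Sum>i = 1..length xs. \<bar>g ((y # xs) ! i) - g ((y # xs) ! (i - 1))\<bar> powr q)"
    by (rule sum.reindex_bij_witness[of _ Suc "\<lambda>i. i - 1"]) (auto simp: nth_Cons split: nat.splits)
  finally show ?case using 1 by simp
qed auto

lemma chain_var_remdups_adj: "chain_var q g (remdups_adj xs) = chain_var q g xs"
proof (induction xs rule: remdups_adj.induct)
  case (3 x y xs)
  show ?case
  proof (cases "x = y")
    case True with 3 show ?thesis by simp
  next
    case False
    then have "remdups_adj (x # y # xs) = x # remdups_adj (y # xs)" by simp
    moreover obtain zs where "remdups_adj (y # xs) = y # zs"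
      by (metis list.collapse hd_remdups_adj list.sel(1) remdups_adj_Nil_iff list.discI)
    ultimately show ?thesis using 3 False by simp
  qed
qed auto

lemma chain_var_Cons_ge: "chain_var q g xs \<le> chain_var q g (x # xs)"
  by (cases xs) auto

lemma chain_var_snoc_ge: "chain_var q g xs \<le> chain_var q g (xs @ [x])"
proof (induction q g xs rule: chain_var.induct)
  case (1 q g x y xs) then show ?case by simp
qed (auto simp: chain_var_nonneg)

lemma strict_sorted_if_distinct_adj:
  fixes xs :: "'i::linorder list"
  shows "sorted xs \<Longrightarrow> distinct_adj xs \<Longrightarrow> sorted_wrt (<) xs"
proof (induction xs)
  case (Cons x xs)
  then show ?case by (cases xs) (auto simp: less_le dual_order.strict_trans1)
qed simp

text \<open>Lists, unlike the partitions of \<open>q_variation\<close>, may omit the end points and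
  repeat entries, which makes them easy to filter and join. Adding 0 and 1 and deleting repetitions
  gives a genuine partition, and neither change lowers the sum.\<close>

lemma chain_var_le_q_variation:
  assumes "sorted xs" "set xs \<subseteq> {0..1}"
  shows "ennreal (chain_var q f xs) \<le> q_variation q f"
proof -
  define ys where "ys = remdups_adj ((0::real) # xs @ [1])"
  have "sorted (0 # xs @ [1])"
    using assms by (auto simp: sorted_append)
  then have ss: "sorted_wrt (<) ys"
    unfolding ys_def by (intro strict_sorted_if_distinct_adj) (simp_all del: remdups_adj.simps append_Cons)
  have hl: "hd ys = 0" "last ys = 1" "ys \<noteq> []"
    unfolding ys_def by (simp_all del: remdups_adj.simps append_Cons add: last_remdups_adj)
  have len: "length ys \<noteq> 1"
  proof
    assume "length ys = 1"
    then obtain a where "ys = [a]" by (metis One_nat_def length_0_conv length_Suc_conv)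
    then show False using hl by simp
  qed
  with hl have len: "length ys \<ge> 2"
    by (cases ys; cases "tl ys") auto
  have "(length ys - 1, \<lambda>i. ys ! i) \<in> partitions01"
    unfolding partitions01_def using len hl ss
    by (auto simp: hd_conv_nth last_conv_nth sorted_wrt_iff_nth_less)
  then have "ennreal (chain_var q f ys) \<le> q_variation q f"
    unfolding q_variation_def chain_var_eq_sum
    by (intro SUP_upper2) auto
  moreover have "chain_var q f ys \<ge> chain_var q f xs"
    unfolding ys_def chain_var_remdups_adj
    using chain_var_Cons_ge[of q f "xs @ [1]" 0] chain_var_snoc_ge[of q f xs 1] by simp
  ultimately show ?thesis
    by (meson ennreal_leI order_trans)
qed

lemma chain_var_append_ge: "chain_var q g xs + chain_var q g ys \<le> chain_var q g (xs @ ys)"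
proof (induction q g xs rule: chain_var.induct)
  case (1 q g x y xs) then show ?case by simp
next
  case ("2_2" q g x) then show ?case using chain_var_Cons_ge[of q g ys x] by simp
qed auto

text \<open>A linearised Hoelder inequality. Above \<theta> it holds because the exponent 1 - q is
  not positive. Summed over N terms with \<open>q\<close>-variation V it gives N \<theta> + V
  \<theta> powr (1 - q), which at \<theta> = (V / N) powr (1 / q) is twice N powr (1 - 1 / q) * V
  powr (1 / q).\<close>

lemma le_add_powr:
  fixes x \<theta> q :: real
  assumes "0 \<le> x" "0 < \<theta>" "1 \<le> q"
  shows "x \<le> \<theta> + \<theta> powr (1 - q) * x powr q"
proof (cases "x \<le> \<theta>")
  case True
  have "0 \<le> \<theta> powr (1 - q) * x powr q" by simp
  with True show ?thesis by linarith
next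
  case False
  have "x = x powr (1 - q) * x powr q"
    using False assms by (simp flip: powr_add)
  also have "\<dots> \<le> \<theta> powr (1 - q) * x powr q"
    using False assms by (intro mult_right_mono powr_mono2') auto
  finally show ?thesis using assms by linarith
qed

lemma sum_le_add_powr:
  fixes a :: "'i \<Rightarrow> real"
  assumes "\<And>i. i \<in> I \<Longrightarrow> 0 \<le> a i" "0 < \<theta>" "1 \<le> q" 
  shows "sum a I \<le> real (card I) * \<theta> + \<theta> powr (1 - q) * (\<Sum>i\<in>I. a i powr q)"
proof -
  have "sum a I \<le> (\<Sum>i\<in>I. \<theta> + \<theta> powr (1 - q) * a i powr q)"
    using assms by (intro sum_mono le_add_powr) auto
  then show ?thesis by (simp add: sum.distrib sum_distrib_left)
qed

lemma le_enn2real: "ennreal c \<le> Q \<Longrightarrow> Q < \<infinity> \<Longrightarrow> 0 \<le> c \<Longrightarrow> c \<le> enn2real Q"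
  using enn2real_mono[of "ennreal c" Q] by simp

section \<open>The class of regression functions\<close>

context
  fixes q \<delta> :: real and f :: "real \<Rightarrow> real"
  assumes q: "1 \<le> q" and f: "f \<in> F_class q \<delta>"
begin

text \<open>The real supremum in \<open>W_norm\<close> is meaningful only for a bounded set, so
  boundedness has to be obtained from finite \<open>q\<close>-variation, through the two-point chain
  \<open>[0, t]\<close>, before the norm bound can be exploited.\<close>

lemma F_class_bdd_above: "bdd_above ((\<lambda>t. \<bar>f t\<bar>) ` {0..1})"
proof -
  define V where "V = enn2real (q_variation q f)"
  have fin: "q_variation q f < \<infinity>" using f by (auto simp: F_class_def W_space_def)
  have "\<bar>f t\<bar> \<le> \<bar>f 0\<bar> + V powr (1 / q)" if "t \<in> {0..1}" for t
  proof -
    have "ennreal (\<bar>f t - f 0\<bar> powr q) \<le> q_variation q f"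
      using chain_var_le_q_variation[of "[0, t]" q f] that by simp
    then have "\<bar>f t - f 0\<bar> powr q \<le> V"
      unfolding V_def using fin by (intro le_enn2real) auto
    then have "(\<bar>f t - f 0\<bar> powr q) powr (1 / q) \<le> V powr (1 / q)"
      using q by (intro powr_mono2) auto
    then show ?thesis using q by (simp add: powr_powr)
  qed
  then show ?thesis by (intro bdd_aboveI[where M = "\<bar>f 0\<bar> + V powr (1 / q)"]) auto
qed

lemma F_class_abs_le_1:
  assumes "t \<in> {0..1}" shows "\<bar>f t\<bar> \<le> 1"
proof -
  have "\<bar>f t\<bar> \<le> (SUP t\<in>{0..1}. \<bar>f t\<bar>)"
    using assms by (intro cSUP_upper F_class_bdd_above)
  also have "\<dots> \<le> W_norm q f" unfolding W_norm_def by simp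
  also have "\<dots> \<le> 1" using f by (auto simp: F_class_def)
  finally show ?thesis .
qed

lemma F_class_chain_var_le_1:
  assumes "sorted xs" "set xs \<subseteq> {0..1}" shows "chain_var q f xs \<le> 1"
proof -
  define V where "V = enn2real (q_variation q f)"
  have fin: "q_variation q f < \<infinity>" using f by (auto simp: F_class_def W_space_def)
  have "0 \<le> \<bar>f 0\<bar>" by simp
  also have "\<bar>f 0\<bar> \<le> (SUP t\<in>{0..1}. \<bar>f t\<bar>)"
    by (intro cSUP_upper F_class_bdd_above) auto
  finally have "V powr (1 / q) \<le> 1"
    using f unfolding V_def by (simp add: F_class_def W_norm_def)
  then have "V \<le> 1" 
    using q powr_less_mono2[of "1 / q" 1 V] unfolding V_def by fastforce
  moreover have "chain_var q f xs \<le> V"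
    unfolding V_def using fin by (intro le_enn2real chain_var_le_q_variation assms chain_var_nonneg) auto
  ultimately show ?thesis by simp
qed

text \<open>After the substitution x = (i + u) / n in each cell, the integral is the mean over u in
  [0,1] of the sums with sample points shifted by u. For each fixed u the shifted and unshifted
  points interlace, so the variation bound compares the two sums directly.\<close>

lemma F_class_riemann_sum:
  assumes \<delta>: "0 < \<delta>" and q_le: "q \<le> 2" and n: "0 < n"
  shows "\<bar>integral {0..1} (\<lambda>x. (f x)\<^sup>2) - (\<Sum>i<n. (f (real (Suc i) / n))\<^sup>2) / n\<bar> \<le> 4 / sqrt n"
proof -
  define J where "J = integral {0..1} (\<lambda>x. (f x)\<^sup>2)"
  define R where "R = (\<Sum>i<n. (f (real (Suc i) / n))\<^sup>2) / n"
  \<comment> \<open>The integral of a non-integrable function is 0, so membership in the class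
    already forces f^2 to be integrable.\<close>
  have "J > 0" using f \<delta> by (auto simp: F_class_def J_def)
  then have int: "(\<lambda>x. (f x)\<^sup>2) integrable_on {0..1}"
    unfolding J_def using not_integrable_integral by force
  define Ji where "Ji i = integral {real i / n..real (Suc i) / n} (\<lambda>x. (f x)\<^sup>2)" for i
  have Ji: "((\<lambda>x. (f x)\<^sup>2) has_integral Ji i) {real i / n..real (Suc i) / n}" if "i < n" for i
    unfolding Ji_def using n that
    by (intro integrable_integral integrable_on_subinterval[OF int]) (auto simp: field_simps)
  have "((\<lambda>x. (f x)\<^sup>2) has_integral (\<Sum>i<m. Ji i)) {0..real m / n}" if "m \<le> n" for m
    using that
  proof (induction m)
    case (Suc m)
    then show ?case
      unfolding sum.lessThan_Suc
      by (intro has_integral_combine[of 0 "real m / n"] Ji) (auto simp: divide_right_mono)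
  qed auto
  from this[of n] have J: "J = (\<Sum>i<n. Ji i)" unfolding J_def using n by (simp add: integral_unique)
  have aff: "((\<lambda>u. (f ((i + u) / n))\<^sup>2) has_integral (Ji i * n)) {0..1}" if "i < n" for i
  proof -
    have "((\<lambda>x. (f ((1 / real n) *\<^sub>R x + real i / n))\<^sup>2) has_integral (Ji i /\<^sub>R (1 / real n) ^ DIM(real)))
       (cbox ((real i / n - real i / n) /\<^sub>R (1 / real n)) ((real (Suc i) / n - real i / n) /\<^sub>R (1 / real n)))"
      using Ji[OF that] n by (intro has_integral_affinity') auto
    moreover have "(1 / real n) *\<^sub>R x + real i / n = (i + x) / n" for x :: real
      by (simp add: add_divide_distrib)
    moreover have "(real (Suc i) / n - real i / n) /\<^sub>R (1 / real n) = 1" "Ji i /\<^sub>R (1 / real n) ^ DIM(real) = Ji i * n"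
      using n by (simp_all add: diff_divide_distrib[symmetric])
    ultimately show ?thesis by (simp only:) simp
  qed
  have "((\<lambda>u. \<Sum>i<n. (f ((i + u) / n))\<^sup>2 / n) has_integral (\<Sum>i<n. Ji i * n / n)) {0..1}"
    by (intro has_integral_sum has_integral_divide aff) auto
  then have "((\<lambda>u. (\<Sum>i<n. (f ((i + u) / n))\<^sup>2 / n) - R) has_integral J - R) (cbox 0 1)"
    using n has_integral_diff[OF _ has_integral_const_real[of R 0 1]] by (force simp: J)
  moreover have "norm ((\<Sum>i<n. (f ((i + u) / n))\<^sup>2 / n) - R) \<le> 4 / sqrt n" if "u \<in> cbox 0 1" for u :: real
  proof -
    have u: "0 \<le> u" "u \<le> 1" using that by auto
    define a where "a i = \<bar>f (real (Suc i) / n) - f ((i + u) / n)\<bar>" for i :: nat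
    \<comment> \<open>The shifted and unshifted sample points of the first m cells in increasing
      order; the \<open>a i\<close> are every second increment of this chain.\<close>
    define xs where "xs m = concat (map (\<lambda>i. [(i + u) / n, real (Suc i) / n]) [0..<m])" for m
    have "sorted (xs m) \<and> (\<forall>x\<in>set (xs m). 0 \<le> x \<and> x \<le> real m / n) \<and> (\<Sum>i<m. a i powr q) \<le> chain_var q f (xs m)" for m
    proof (induction m)
      case (Suc m)
      have xsS: "xs (Suc m) = xs m @ [(m + u) / n, real (Suc m) / n]" by (simp add: xs_def)
      have l1: "x \<le> (m + u) / n" "x \<le> (1 + real m) / n" if "x \<in> set (xs m)" for x
      proof -
        have "x \<le> real m / n" using Suc that by auto
        also have "real m / n \<le> (m + u) / n" using u by (simp add: divide_right_mono)
        finally show "x \<le> (m + u) / n" .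
        also have "\<dots> \<le> (1 + real m) / n" using u by (simp add: divide_right_mono)
        finally show "x \<le> (1 + real m) / n" .
      qed
      show ?case unfolding xsS
        using Suc u n l1 chain_var_append_ge[of q f "xs m" "[(m + u) / n, real (Suc m) / n]"]
        by (auto simp: sorted_append a_def divide_right_mono)
    qed (auto simp: xs_def)
    note xs = this[of n]
    have "chain_var q f (xs n) \<le> 1"
      using xs n by (intro F_class_chain_var_le_1) auto
    then have V: "(\<Sum>i<n. a i powr q) \<le> 1" using xs by simp
    \<comment> \<open>Balances the two terms of \<open>sum_le_add_powr\<close>: n \<theta> = sqrt n,
      and q \<le> 2 gives \<theta> powr (1 - q) \<le> 1 / \<theta> = sqrt n.\<close>
    define \<theta> where "\<theta> = 1 / sqrt n"
    have \<theta>: "0 < \<theta>" "\<theta> \<le> 1" using n by (auto simp: \<theta>_def)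
    have q2: "\<theta> powr (1 - q) * x \<le> sqrt n" if "x \<le> 1" "0 \<le> x" for x
    proof -
      have "\<theta> powr (1 - q) \<le> \<theta> powr (-1)" using \<theta> q_le by (intro powr_mono') auto
      also have "\<dots> = sqrt n" using \<theta> by (simp add: \<theta>_def powr_minus)
      finally show ?thesis using that mult_mono[of "\<theta> powr (1 - q)" "sqrt n" x 1] by simp
    qed
    have sq: "\<bar>(f ((i + u) / n))\<^sup>2 - (f (real (Suc i) / n))\<^sup>2\<bar> \<le> 2 * a i" if "i < n" for i
    proof -
      have "\<bar>f ((i + u) / n)\<bar> \<le> 1" "\<bar>f (real (Suc i) / n)\<bar> \<le> 1"
        using that u n by (auto intro!: F_class_abs_le_1 simp: field_simps)
      then have "\<bar>f ((i + u) / n) + f (real (Suc i) / n)\<bar> \<le> 2" by linarith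
      then have "\<bar>f ((i + u) / n) + f (real (Suc i) / n)\<bar> * a i \<le> 2 * a i"
        by (intro mult_right_mono) (auto simp: a_def)
      moreover have "(f ((i + u) / n))\<^sup>2 - (f (real (Suc i) / n))\<^sup>2
          = - ((f ((i + u) / n) + f (real (Suc i) / n)) * (f (real (Suc i) / n) - f ((i + u) / n)))"
        by (simp add: algebra_simps power2_eq_square)
      ultimately show ?thesis by (simp add: a_def abs_mult)
    qed
    have "\<bar>\<Sum>i<n. (f ((i + u) / n))\<^sup>2 - (f (real (Suc i) / n))\<^sup>2\<bar> \<le> (\<Sum>i<n. 2 * a i)"
      using sq by (intro order.trans[OF sum_abs] sum_mono) auto
    also have "\<dots> = 2 * (\<Sum>i<n. a i)" by (simp add: sum_distrib_left)
    also have "\<dots> \<le> 2 * (real (card {..<n}) * \<theta> + \<theta> powr (1 - q) * (\<Sum>i<n. a i powr q))"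
      using \<theta> q by (intro mult_left_mono sum_le_add_powr) (auto simp: a_def)
    also have "\<dots> \<le> 2 * (n * \<theta> + sqrt n)"
      using V q2 q_le by (intro mult_left_mono add_mono q2) (auto intro!: sum_nonneg)
    also have "n * \<theta> = sqrt n" unfolding \<theta>_def by (simp add: real_div_sqrt)
    finally have "\<bar>\<Sum>i<n. (f ((i + u) / n))\<^sup>2 - (f (real (Suc i) / n))\<^sup>2\<bar> / n \<le> 4 * sqrt n / n"
      using n by (intro divide_right_mono) auto
    also have "4 * sqrt n / n = 4 / sqrt n"
      using n by (simp add: field_simps)
    finally show ?thesis
      unfolding R_def by (simp add: sum_subtractf flip: diff_divide_distrib sum_divide_distrib)
  qed
  ultimately have "norm (J - R) \<le> 4 / sqrt n * measure lborel (cbox 0 (1::real))"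
    by (intro has_integral_bound) auto
  then show ?thesis by (simp add: J_def R_def)
qed

end

text \<open>What a function of the class leaves behind when sampled at \<open>n\<close> increasing
  times; the pathwise estimates below work with this only.\<close>

definition unit_var :: "real \<Rightarrow> nat \<Rightarrow> (nat \<Rightarrow> real) \<Rightarrow> bool" where
  "unit_var q n g \<longleftrightarrow> (\<forall>i<n. \<bar>g i\<bar> \<le> 1) \<and> (\<forall>xs. sorted xs \<and> set xs \<subseteq> {..<n} \<longrightarrow> chain_var q g xs \<le> 1)"

lemma F_class_unit_var:
  assumes "1 \<le> q" "f \<in> F_class q \<delta>" "mono_on {..<n} \<tau>" "\<tau> ` {..<n} \<subseteq> {0..1}"
  shows "unit_var q n (\<lambda>i. f (\<tau> i))"
proof -
  have "chain_var q (\<lambda>i. f (\<tau> i)) xs \<le> 1" if "sorted xs" "set xs \<subseteq> {..<n}" for xs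
  proof -
    have "sorted (map \<tau> xs)"
      using that assms(3) by (auto simp: sorted_map intro: sorted_wrt_mono_rel mono_onD)
    moreover have "set (map \<tau> xs) \<subseteq> {0..1}" using that assms(4) by auto
    ultimately have "chain_var q f (map \<tau> xs) \<le> 1" by (rule F_class_chain_var_le_1[OF assms(1,2)])
    then show ?thesis by (simp add: chain_var_map)
  qed
  then show ?thesis using assms F_class_abs_le_1[OF assms(1,2)] by (auto simp: unit_var_def)
qed

section \<open>Quantised walks\<close>

fun qwalk :: "real \<Rightarrow> (nat \<Rightarrow> real) \<Rightarrow> nat \<Rightarrow> real" where
  "qwalk e x 0 = 0"
| "qwalk e x (Suc n) = (if e \<le> \<bar>sum x {..<Suc n} - qwalk e x n\<bar> then sum x {..<Suc n} else qwalk e x n)"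

definition crossings :: "real \<Rightarrow> (nat \<Rightarrow> real) \<Rightarrow> nat \<Rightarrow> nat set" where
  "crossings e x n = {i. i < n \<and> e \<le> \<bar>sum x {..<Suc i} - qwalk e x i\<bar>}"

definition lag :: "real \<Rightarrow> (nat \<Rightarrow> real) \<Rightarrow> nat \<Rightarrow> real" where
  "lag e x n = sum x {..<n} - qwalk e x n"

text \<open>A quadratic variation plus twice a martingale transform, as \<open>lag\<close> is
  bounded and depends on earlier steps only. Hence for independent centred steps the mean is the
  total variance.\<close>

definition energy :: "real \<Rightarrow> (nat \<Rightarrow> real) \<Rightarrow> nat \<Rightarrow> real" where
  "energy e x n = (\<Sum>i<n. (x i)\<^sup>2) + 2 * (\<Sum>i<n. lag e x i * x i)"

lemma abs_lag_less: "0 < e \<Longrightarrow> \<bar>lag e x n\<bar> < e"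
  by (cases n) (auto simp: lag_def)

lemma finite_crossings [simp]: "finite (crossings e x n)"
  by (simp add: crossings_def)

lemma crossings_Suc:
  "crossings e x (Suc n) = (if e \<le> \<bar>sum x {..<Suc n} - qwalk e x n\<bar> then insert n (crossings e x n) else crossings e x n)"
  by (auto simp: crossings_def less_Suc_eq)

text \<open>Put s = \<open>lag e x n + x n\<close>. A crossing adds s^2 to the sum and resets the
  lag to 0; otherwise the lag becomes s. Either way the left side grows by s^2 - lag^2 = x^2 + 2 lag
  x.\<close>

lemma sum_crossings_eq_energy:
  "(\<Sum>i\<in>crossings e x n. (sum x {..<Suc i} - qwalk e x i)\<^sup>2) + (lag e x n)\<^sup>2 = energy e x n"
proof (induction n)
  case (Suc n)
  define s where "s = sum x {..<Suc n} - qwalk e x n"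
  have s: "s = lag e x n + x n" by (simp add: s_def lag_def)
  have "n \<notin> crossings e x n" by (simp add: crossings_def)
  then have "(\<Sum>i\<in>crossings e x (Suc n). (sum x {..<Suc i} - qwalk e x i)\<^sup>2) + (lag e x (Suc n))\<^sup>2
     = (\<Sum>i\<in>crossings e x n. (sum x {..<Suc i} - qwalk e x i)\<^sup>2) + s\<^sup>2"
    by (simp add: crossings_Suc s_def lag_def del: sum.lessThan_Suc)
  also have "\<dots> = energy e x (Suc n)"
    using Suc by (simp add: energy_def s power2_sum algebra_simps)
  finally show ?case .
qed (simp_all add: crossings_def lag_def energy_def)

lemma sum_crossings_le_energy:
  "(\<Sum>i\<in>crossings e x n. (sum x {..<Suc i} - qwalk e x i)\<^sup>2) \<le> energy e x n"
  unfolding sum_crossings_eq_energy[symmetric] by simp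

lemma energy_nonneg: "0 \<le> energy e x n"
  by (rule order.trans[OF sum_nonneg sum_crossings_le_energy]) simp

lemma card_crossings_le:
  assumes "0 < e" shows "real (card (crossings e x n)) \<le> energy e x n / e\<^sup>2"
proof -
  have "real (card (crossings e x n)) * e\<^sup>2 = (\<Sum>i\<in>crossings e x n. e\<^sup>2)" by simp
  also have "\<dots> \<le> (\<Sum>i\<in>crossings e x n. (sum x {..<Suc i} - qwalk e x i)\<^sup>2)"
    using assms by (intro sum_mono) (auto simp: crossings_def abs_le_square_iff[symmetric])
  also note sum_crossings_le_energy
  finally show ?thesis using assms by (simp add: field_simps)
qed

text \<open>A recorded move a has |a| \<ge> e, hence |a| \<le> a^2 / e. At \<open>e = 1\<close> this
  bounds the coarsest term of the chaining.\<close>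

lemma sum_abs_diff_qwalk_le:
  assumes "0 < e" shows "(\<Sum>i<n. \<bar>qwalk e x (Suc i) - qwalk e x i\<bar>) \<le> energy e x n / e"
proof -
  have "(\<Sum>i<n. \<bar>qwalk e x (Suc i) - qwalk e x i\<bar>) = (\<Sum>i\<in>crossings e x n. \<bar>sum x {..<Suc i} - qwalk e x i\<bar>)"
    by (rule sum.mono_neutral_cong_right) (auto simp: crossings_def)
  also have "\<dots> \<le> (\<Sum>i\<in>crossings e x n. (sum x {..<Suc i} - qwalk e x i)\<^sup>2 / e)"
  proof (intro sum_mono)
    fix i assume "i \<in> crossings e x n"
    then have "e * \<bar>sum x {..<Suc i} - qwalk e x i\<bar> \<le> \<bar>sum x {..<Suc i} - qwalk e x i\<bar> * \<bar>sum x {..<Suc i} - qwalk e x i\<bar>"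
      by (intro mult_right_mono) (auto simp: crossings_def)
    then show "\<bar>sum x {..<Suc i} - qwalk e x i\<bar> \<le> (sum x {..<Suc i} - qwalk e x i)\<^sup>2 / e"
      using assms by (simp add: pos_le_divide_eq mult.commute power2_eq_square del: sum.lessThan_Suc)
  qed
  also have "\<dots> \<le> energy e x n / e"
    unfolding sum_divide_distrib[symmetric] using assms by (intro divide_right_mono sum_crossings_le_energy) auto
  finally show ?thesis .
qed

lemma chain_var_1_le:
  assumes "0 < \<theta>" "1 \<le> q"
  shows "chain_var 1 g xs \<le> real (length xs) * \<theta> + \<theta> powr (1 - q) * chain_var q g xs"
  using assms(2)
proof (induction q g xs rule: chain_var.induct)
  case (1 q g x y xs)
  then show ?case using le_add_powr[of "\<bar>g y - g x\<bar>" \<theta> q] assms(1) by (simp add: algebra_simps)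
qed (use assms in auto)

text \<open>Summation by parts, run backwards so that the remaining jump times form the tail of a list.\<close>

lemma abs_sum_jumps_le:
  fixes g \<Delta> :: "nat \<Rightarrow> real"
  assumes d: "\<And>i. i \<le> n \<Longrightarrow> \<bar>\<Delta> i\<bar> \<le> d" and C: "\<And>i. i < n \<Longrightarrow> i \<notin> C \<Longrightarrow> \<Delta> (Suc i) = \<Delta> i"
    and g: "\<And>i. i < n \<Longrightarrow> \<bar>g i\<bar> \<le> 1" and "\<Delta> 0 = 0"
  shows "\<bar>\<Sum>i<n. g i * (\<Delta> (Suc i) - \<Delta> i)\<bar> \<le> d * (chain_var 1 g (filter (\<lambda>i. i \<in> C) [0..<n]) + 1)"
proof -
  define cs where "cs m = filter (\<lambda>i. i \<in> C) [m..<n]" for m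
  \<comment> \<open>\<open>h m\<close> is the value of g at the next jump time from m on, 0 if none
    is left. The induction carries the boundary term \<open>h m * \<Delta> m\<close>, which
    disappears at m = 0 because \<open>\<Delta> 0 = 0\<close>.\<close>
  define h where "h m = (if cs m = [] then 0 else g (hd (cs m)))" for m
  have "0 \<le> d" using d[of 0] by auto
  have "\<bar>(\<Sum>i=m..<n. g i * (\<Delta> (Suc i) - \<Delta> i)) + h m * \<Delta> m\<bar> \<le> d * (chain_var 1 g (cs m) + (if cs m = [] then 0 else 1))"
    if "m \<le> n" for m
    using that
  proof (induction rule: inc_induct)
    case base
    then show ?case by (simp add: cs_def h_def)
  next
    case (step m)
    have eq: "(\<Sum>i=m..<n. g i * (\<Delta> (Suc i) - \<Delta> i)) = g m * (\<Delta> (Suc m) - \<Delta> m) + (\<Sum>i=Suc m..<n. g i * (\<Delta> (Suc i) - \<Delta> i))"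
      using step by (simp add: sum.atLeast_Suc_lessThan)
    have csm: "cs m = (if m \<in> C then m # cs (Suc m) else cs (Suc m))"
      using step unfolding cs_def by (subst upt_conv_Cons) auto
    show ?case
    proof (cases "m \<in> C")
      case False
      then show ?thesis using step eq csm C[of m] by (cases "cs (Suc m) = []") (auto simp: h_def)
    next
      case True
      have dm: "\<bar>\<Delta> (Suc m)\<bar> \<le> d" using d step by auto
      \<comment> \<open>Here \<open>h m = g m\<close>, so the boundary term cancels - g(m)
        \<Delta>(m), and what remains is an increment of g between consecutive jump times.\<close>
      have "(\<Sum>i=m..<n. g i * (\<Delta> (Suc i) - \<Delta> i)) + h m * \<Delta> m
        = ((\<Sum>i=Suc m..<n. g i * (\<Delta> (Suc i) - \<Delta> i)) + h (Suc m) * \<Delta> (Suc m)) + (g m - h (Suc m)) * \<Delta> (Suc m)"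
        unfolding eq using csm True by (simp add: h_def[of m] algebra_simps)
      moreover have "\<bar>(g m - h (Suc m)) * \<Delta> (Suc m)\<bar> \<le> \<bar>g m - h (Suc m)\<bar> * d"
        unfolding abs_mult using dm by (intro mult_left_mono) auto
      moreover have "\<bar>g m - h (Suc m)\<bar> * d + d * (chain_var 1 g (cs (Suc m)) + (if cs (Suc m) = [] then 0 else 1))
         \<le> d * (chain_var 1 g (cs m) + 1)"
      proof (cases "cs (Suc m)")
        case Nil
        then show ?thesis using csm True g[of m] step \<open>0 \<le> d\<close> mult_right_mono[of "\<bar>g m\<bar>" 1 d] by (simp add: h_def)
      next
        case (Cons a l)
        then show ?thesis using csm True by (simp add: h_def algebra_simps abs_minus_commute)
      qed
      moreover have "cs m \<noteq> []" using csm True by simp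
      ultimately show ?thesis using step.IH by (simp add: algebra_simps) 
    qed
  qed
  from this[of 0] have "\<bar>\<Sum>i<n. g i * (\<Delta> (Suc i) - \<Delta> i)\<bar> \<le> d * (chain_var 1 g (cs 0) + (if cs 0 = [] then 0 else 1))"
    using assms(4) by (simp add: atLeast0LessThan)
  also have "\<dots> \<le> d * (chain_var 1 g (cs 0) + 1)"
    using \<open>0 \<le> d\<close> by (intro mult_left_mono) auto
  finally show ?thesis by (simp add: cs_def)
qed

lemma abs_sum_jumps_le_card:
  fixes g \<Delta> :: "nat \<Rightarrow> real"
  assumes g: "unit_var q n g" and q: "1 \<le> q" and \<theta>: "0 < \<theta>" "\<theta> \<le> 1"
    and d: "\<And>i. i \<le> n \<Longrightarrow> \<bar>\<Delta> i\<bar> \<le> d" and C: "C \<subseteq> {..<n}" "\<And>i. i < n \<Longrightarrow> i \<notin> C \<Longrightarrow> \<Delta> (Suc i) = \<Delta> i"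
    and "\<Delta> 0 = 0" and N: "real (card C) \<le> N"
  shows "\<bar>\<Sum>i<n. g i * (\<Delta> (Suc i) - \<Delta> i)\<bar> \<le> d * (N * \<theta> + 2 * \<theta> powr (1 - q))"
proof -
  let ?cs = "filter (\<lambda>i. i \<in> C) [0..<n]"
  have len: "length ?cs = card C"
    using C(1) by (subst distinct_card[symmetric]) (auto intro!: arg_cong[where f = card])
  have "chain_var q g ?cs \<le> 1"
    using g sorted_wrt_filter[of "(\<le>)" "[0..<n]" "\<lambda>i. i \<in> C"] unfolding unit_var_def
    by (elim conjE allE[where x = ?cs] impE) auto
  then have "\<theta> powr (1 - q) * chain_var q g ?cs \<le> \<theta> powr (1 - q)"
    by (simp add: mult_left_le)
  then have "chain_var 1 g ?cs \<le> N * \<theta> + \<theta> powr (1 - q)"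
    using chain_var_1_le[OF \<theta>(1) q, of g ?cs, unfolded len] mult_right_mono[OF N less_imp_le[OF \<theta>(1)]] by linarith
  \<comment> \<open>Absorbs the boundary term \<open>+ 1\<close> of \<open>abs_sum_jumps_le\<close>,
    whence the factor 2.\<close>
  moreover have "1 \<le> \<theta> powr (1 - q)"
    using powr_mono'[of "1 - q" 0 \<theta>] \<theta> q by simp
  moreover have "0 \<le> d" using d[of 0] by auto
  ultimately have "d * (chain_var 1 g ?cs + 1) \<le> d * (N * \<theta> + 2 * \<theta> powr (1 - q))"
    by (intro mult_left_mono) auto
  moreover have "\<bar>\<Sum>i<n. g i * (\<Delta> (Suc i) - \<Delta> i)\<bar> \<le> d * (chain_var 1 g ?cs + 1)"
    using assms by (intro abs_sum_jumps_le) (auto simp: unit_var_def)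
  ultimately show ?thesis by linarith
qed

section \<open>Chaining over the dyadic scales of the recorded walk\<close>

definition var_rate :: "real \<Rightarrow> real" where "var_rate q = 2 powr (1 - 2 / q)"

lemma var_rate_bounds: "0 < q \<Longrightarrow> q < 2 \<Longrightarrow> 0 < var_rate q \<and> var_rate q < 1"
  by (auto simp: var_rate_def powr_less_one field_simps)

text \<open>The threshold \<open>2 powr (- 2 l / q)\<close> balances the two terms of the bound above
  for a walk with \<open>4 ^ l\<close> crossings.\<close>

lemma jumps_bound_eq:
  assumes "1 \<le> q"
  defines "\<theta> \<equiv> \<lambda>l::nat. 2 powr (- 2 * real l / q)"
  shows "(1 / 2) ^ l * (N * 4 ^ l * \<theta> l + 2 * \<theta> l powr (1 - q)) = var_rate q ^ l * (N + 2)"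
proof -
  have four: "(4::real) ^ l = (2 ^ l)\<^sup>2" by (simp add: power2_eq_square flip: power_mult_distrib)
  have 1: "(1 / 2 :: real) ^ l = 2 powr (- real l)" "(4::real) ^ l = 2 powr (2 * real l)" 
    using powr_realpow[of 2 "2 * l"] four by (simp_all add: powr_minus powr_realpow power_divide power_mult field_simps)
  have 2: "var_rate q ^ l = 2 powr (real l * (1 - 2 / q))"
    unfolding var_rate_def by (simp add: powr_powr mult.commute flip: powr_realpow)
  have "2 powr (- real l) * (4 ^ l * \<theta> l) = var_rate q ^ l"
    unfolding 1 2 \<theta>_def powr_add[symmetric] by (simp add: algebra_simps)
  moreover have "2 powr (- real l) * (\<theta> l powr (1 - q)) = var_rate q ^ l"
    unfolding 2 \<theta>_def powr_powr powr_add[symmetric] using assms(1) by (simp add: field_simps)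
  ultimately show ?thesis unfolding 1 by (simp add: algebra_simps)
qed

lemma abs_sum_jumps_le_level:
  fixes g \<Delta> :: "nat \<Rightarrow> real"
  assumes g: "unit_var q n g" and q: "1 \<le> q" 
    and d: "\<And>i. i \<le> n \<Longrightarrow> \<bar>\<Delta> i\<bar> \<le> c * (1 / 2) ^ l" and C: "C \<subseteq> {..<n}" "\<And>i. i < n \<Longrightarrow> i \<notin> C \<Longrightarrow> \<Delta> (Suc i) = \<Delta> i"
    and "\<Delta> 0 = 0" and N: "real (card C) \<le> N * 4 ^ l"
  shows "\<bar>\<Sum>i<n. g i * (\<Delta> (Suc i) - \<Delta> i)\<bar> \<le> c * (var_rate q ^ l * (N + 2))"
proof -
  have "2 powr (- 2 * real l / q) \<le> 2 powr 0"
    using q by (intro powr_mono) (auto simp: field_simps)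
  then have "\<bar>\<Sum>i<n. g i * (\<Delta> (Suc i) - \<Delta> i)\<bar>
    \<le> (c * (1 / 2) ^ l) * (N * 4 ^ l * 2 powr (- 2 * real l / q) + 2 * (2 powr (- 2 * real l / q)) powr (1 - q))"
    using assms by (intro abs_sum_jumps_le_card[where C = C]) auto
  also have "\<dots> = c * (var_rate q ^ l * (N + 2))"
    unfolding jumps_bound_eq[OF q, symmetric] by (rule mult.assoc)
  finally show ?thesis .
qed

abbreviation level_energy :: "nat \<Rightarrow> (nat \<Rightarrow> real) \<Rightarrow> nat \<Rightarrow> real" where
  "level_energy l \<equiv> energy ((1 / 2) ^ l)"

text \<open>The sum of the level differences. The outer \<open>2\<close>: consecutive recorded walks
  differ by at most 2 * (1/2)^l. The \<open>4\<close>: crossings at scale \<open>Suc l\<close> are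
  counted in units of 4^l. The inner \<open>2\<close> comes from the factor \<open>N + 2\<close> in
  \<open>abs_sum_jumps_le_level\<close>.\<close>

definition chain_bound :: "real \<Rightarrow> nat \<Rightarrow> nat \<Rightarrow> (nat \<Rightarrow> real) \<Rightarrow> nat \<Rightarrow> real" where
  "chain_bound q k R x n =
    (\<Sum>l=k..<R. 2 * (var_rate q ^ l * (level_energy l x n + 4 * level_energy (Suc l) x n + 2)))"

lemma card_level_crossings_le: "real (card (crossings ((1 / 2) ^ l) x n)) \<le> level_energy l x n * 4 ^ l"
  using card_crossings_le[of "(1 / 2) ^ l" x n]
  by (simp add: power_divide power2_eq_square field_simps flip: power_mult_distrib)

text \<open>Telescoping between the scales R and k; the difference of neighbouring records jumps
  only at crossings of either. At the finest scale R the walk is compared with its record trivially,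
  each of the n increments of the lag being at most 2 * (1/2)^R; R will be taken so large, depending
  on n, that this is harmless.\<close>

lemma abs_sum_diff_qwalk_le:
  assumes g: "unit_var q n g" and q: "1 \<le> q" and "k \<le> R"
  shows "\<bar>(\<Sum>i<n. g i * x i) - (\<Sum>i<n. g i * (qwalk ((1 / 2) ^ k) x (Suc i) - qwalk ((1 / 2) ^ k) x i))\<bar>
    \<le> chain_bound q k R x n + 2 * n * (1 / 2) ^ R"
  using \<open>k \<le> R\<close>
proof (induction rule: inc_induct)
  case base
  define e :: real where "e = (1 / 2) ^ R"
  have "0 < e" by (simp add: e_def)
  have "(\<Sum>i<n. g i * x i) - (\<Sum>i<n. g i * (qwalk e x (Suc i) - qwalk e x i))
      = (\<Sum>i<n. g i * (lag e x (Suc i) - lag e x i))"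
    by (simp add: sum_subtractf[symmetric] lag_def algebra_simps del: qwalk.simps)
  also have "\<bar>\<dots>\<bar> \<le> (\<Sum>i<n. 2 * e)"
  proof (intro order.trans[OF sum_abs] sum_mono)
    fix i assume "i \<in> {..<n}"
    then have "\<bar>g i\<bar> * \<bar>lag e x (Suc i) - lag e x i\<bar> \<le> 1 * (2 * e)"
      using g abs_lag_less[OF \<open>0 < e\<close>, of x i] abs_lag_less[OF \<open>0 < e\<close>, of x "Suc i"]
      by (intro mult_mono) (auto simp: unit_var_def)
    then show "\<bar>g i * (lag e x (Suc i) - lag e x i)\<bar> \<le> 2 * e" by (simp add: abs_mult)
  qed
  finally show ?case by (simp add: e_def chain_bound_def)
next
  case (step k)
  define P where "P l = qwalk ((1 / 2) ^ l) x" for l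
  have near: "\<bar>sum x {..<i} - P l i\<bar> < (1 / 2) ^ l" for l i
    using abs_lag_less[of "(1 / 2) ^ l" x i] by (simp add: P_def lag_def)
  have small: "\<bar>P (Suc k) i - P k i\<bar> \<le> 2 * (1 / 2) ^ k" for i
  proof -
    have "(1 / 2 :: real) ^ Suc k \<le> (1 / 2) ^ k" by simp
    then show ?thesis using near[of i k] near[of i "Suc k"] by linarith
  qed
  let ?C = "crossings ((1 / 2) ^ k) x n \<union> crossings ((1 / 2) ^ Suc k) x n"
  have card: "real (card ?C) \<le> (level_energy k x n + 4 * level_energy (Suc k) x n) * 4 ^ k"
    using card_Un_le[of "crossings ((1 / 2) ^ k) x n" "crossings ((1 / 2) ^ Suc k) x n"]
      card_level_crossings_le[of k x n] card_level_crossings_le[of "Suc k" x n]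
    by (simp add: algebra_simps)
  have "\<bar>\<Sum>i<n. g i * ((P (Suc k) (Suc i) - P k (Suc i)) - (P (Suc k) i - P k i))\<bar>
     \<le> 2 * (var_rate q ^ k * ((level_energy k x n + 4 * level_energy (Suc k) x n) + 2))"
    using small card
    by (intro abs_sum_jumps_le_level[OF g q, where C = ?C and \<Delta> = "\<lambda>i. P (Suc k) i - P k i"])
       (auto simp: crossings_def P_def)
  moreover have "(\<Sum>i<n. g i * ((P (Suc k) (Suc i) - P k (Suc i)) - (P (Suc k) i - P k i)))
     = (\<Sum>i<n. g i * (P (Suc k) (Suc i) - P (Suc k) i)) - (\<Sum>i<n. g i * (P k (Suc i) - P k i))"
    by (simp add: sum_subtractf[symmetric] algebra_simps)
  moreover have "chain_bound q k R x n = 2 * (var_rate q ^ k * (level_energy k x n + 4 * level_energy (Suc k) x n + 2))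
     + chain_bound q (Suc k) R x n"
    unfolding chain_bound_def using step by (subst sum.atLeast_Suc_lessThan) auto
  ultimately show ?case using step.IH unfolding P_def[symmetric] by linarith
qed

text \<open>The way from x to y leads through the two recorded walks at scale k. These differ by at
  most 3 * (1/2)^k: once for the distance of the walks, twice for the lags.\<close>

theorem abs_sum_diff_sum_le:
  assumes g: "unit_var q n g" and q: "1 \<le> q" and "k \<le> R"
    and near: "\<And>i. i \<le> n \<Longrightarrow> \<bar>sum x {..<i} - sum y {..<i}\<bar> \<le> (1 / 2) ^ k"
  shows "\<bar>(\<Sum>i<n. g i * x i) - (\<Sum>i<n. g i * y i)\<bar>
    \<le> chain_bound q k R x n + chain_bound q k R y n + 4 * n * (1 / 2) ^ R
      + 3 * (var_rate q ^ k * (level_energy k x n + level_energy k y n + 2))"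
proof -
  let ?P = "\<lambda>x. qwalk ((1 / 2) ^ k) x"
  let ?C = "crossings ((1 / 2) ^ k) x n \<union> crossings ((1 / 2) ^ k) y n"
  have near': "\<bar>sum x {..<i} - ?P x i\<bar> < (1 / 2) ^ k" for x i
    using abs_lag_less[of "(1 / 2) ^ k" x i] by (simp add: lag_def)
  have small: "\<bar>?P x i - ?P y i\<bar> \<le> 3 * (1 / 2) ^ k" if "i \<le> n" for i
    using near'[of x i] near'[of y i] near[OF that] by linarith
  have card: "real (card ?C) \<le> (level_energy k x n + level_energy k y n) * 4 ^ k"
    using card_Un_le[of "crossings ((1 / 2) ^ k) x n" "crossings ((1 / 2) ^ k) y n"]
      card_level_crossings_le[of k x n] card_level_crossings_le[of k y n]
    by (simp add: algebra_simps)
  have "\<bar>\<Sum>i<n. g i * ((?P x (Suc i) - ?P y (Suc i)) - (?P x i - ?P y i))\<bar>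
     \<le> 3 * (var_rate q ^ k * ((level_energy k x n + level_energy k y n) + 2))"
    using small card
    by (intro abs_sum_jumps_le_level[OF g q, where C = ?C and \<Delta> = "\<lambda>i. ?P x i - ?P y i"])
       (auto simp: crossings_def)
  moreover have "(\<Sum>i<n. g i * ((?P x (Suc i) - ?P y (Suc i)) - (?P x i - ?P y i)))
     = (\<Sum>i<n. g i * (?P x (Suc i) - ?P x i)) - (\<Sum>i<n. g i * (?P y (Suc i) - ?P y i))"
    by (simp add: sum_subtractf[symmetric] algebra_simps del: qwalk.simps)
  ultimately show ?thesis
    using abs_sum_diff_qwalk_le[OF g q \<open>k \<le> R\<close>, of x] abs_sum_diff_qwalk_le[OF g q \<open>k \<le> R\<close>, of y] by linarith
qed

text \<open>Starts from the total variation of the record at scale 1, which suffices because |g|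
  \<le> 1. It yields the first moment bound that later controls the tail of the linear
  process.\<close>

theorem abs_sum_le_energy:
  assumes g: "unit_var q n g" and q: "1 \<le> q"
  shows "\<bar>\<Sum>i<n. g i * x i\<bar> \<le> level_energy 0 x n + chain_bound q 0 R x n + 2 * n * (1 / 2) ^ R"
proof -
  have "\<bar>\<Sum>i<n. g i * (qwalk 1 x (Suc i) - qwalk 1 x i)\<bar> \<le> (\<Sum>i<n. \<bar>qwalk 1 x (Suc i) - qwalk 1 x i\<bar>)"
    using g by (intro order.trans[OF sum_abs] sum_mono) (auto simp: abs_mult unit_var_def mult_left_le_one_le simp del: qwalk.simps)
  also have "\<dots> \<le> level_energy 0 x n"
    using sum_abs_diff_qwalk_le[where e = 1] by simp
  finally show ?thesis
    using abs_sum_diff_qwalk_le[OF g q le0, of x R] by simp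
qed

section \<open>Walks with independent centred steps\<close>

lemma measurable_sum_PiM [measurable]:
  "finite J \<Longrightarrow> J \<subseteq> I \<Longrightarrow> (\<lambda>x. sum x J) \<in> borel_measurable (PiM I (\<lambda>_. borel :: real measure))"
  by (intro borel_measurable_sum measurable_component_singleton) auto

lemma measurable_qwalk_PiM:
  "{..<n} \<subseteq> I \<Longrightarrow> (\<lambda>x. qwalk e x n) \<in> borel_measurable (PiM I (\<lambda>_. borel))"
proof (induction n)
  case (Suc n)
  then have [measurable]: "(\<lambda>x. qwalk e x n) \<in> borel_measurable (PiM I (\<lambda>_. borel))"
    by (simp add: lessThan_Suc)
  have [measurable]: "(\<lambda>x. sum x {..<Suc n}) \<in> borel_measurable (PiM I (\<lambda>_. borel :: real measure))"
    using Suc by (intro measurable_sum_PiM) auto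
  show ?case unfolding qwalk.simps by measurable
qed auto

lemma measurable_lag_PiM:
  "{..<n} \<subseteq> I \<Longrightarrow> (\<lambda>x. lag e x n) \<in> borel_measurable (PiM I (\<lambda>_. borel))"
  unfolding lag_def by (intro borel_measurable_diff measurable_qwalk_PiM measurable_sum_PiM) auto

lemma qwalk_cong: "(\<And>i. i < n \<Longrightarrow> x i = y i) \<Longrightarrow> qwalk e x n = qwalk e y n"
  by (induction n) (auto simp: less_Suc_eq intro!: arg_cong2[where f = "(+)"] sum.cong)

lemma lag_cong: "(\<And>i. i < n \<Longrightarrow> x i = y i) \<Longrightarrow> lag e x n = lag e y n"
  unfolding lag_def using qwalk_cong[of n x y e] by (auto intro: sum.cong)

context prob_space
begin

text \<open>The martingale difference property without conditional expectations: a function of the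
  first \<open>l\<close> steps is independent of step \<open>l\<close>.\<close>

lemma past_orthogonal:
  fixes Z :: "nat \<Rightarrow> 'a \<Rightarrow> real"
  assumes Z: "indep_vars (\<lambda>_. borel) Z {..<n}" "l < n"
    and H: "H \<in> borel_measurable (PiM {..<l} (\<lambda>_. borel))" "integrable M (\<lambda>\<omega>. H (\<lambda>i\<in>{..<l}. Z i \<omega>))"
    and int: "integrable M (Z l)" "expectation (Z l) = 0"
  shows "integrable M (\<lambda>\<omega>. H (\<lambda>i\<in>{..<l}. Z i \<omega>) * Z l \<omega>)"
    and "expectation (\<lambda>\<omega>. H (\<lambda>i\<in>{..<l}. Z i \<omega>) * Z l \<omega>) = 0"
proof -
  have "indep_var (PiM {..<l} (\<lambda>_. borel)) (\<lambda>\<omega>. \<lambda>i\<in>{..<l}. Z i \<omega>) (PiM {l} (\<lambda>_. borel)) (\<lambda>\<omega>. \<lambda>i\<in>{l}. Z i \<omega>)"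
    using Z by (intro indep_var_restrict[OF Z(1)]) auto
  then have "indep_var borel (H \<circ> (\<lambda>\<omega>. \<lambda>i\<in>{..<l}. Z i \<omega>)) borel ((\<lambda>x. x l) \<circ> (\<lambda>\<omega>. \<lambda>i\<in>{l}. Z i \<omega>))"
    by (rule indep_var_compose) (use H in auto)
  then have ind: "indep_var borel (\<lambda>\<omega>. H (\<lambda>i\<in>{..<l}. Z i \<omega>)) borel (Z l)"
    by (simp add: comp_def)
  show "integrable M (\<lambda>\<omega>. H (\<lambda>i\<in>{..<l}. Z i \<omega>) * Z l \<omega>)"
    using indep_var_integrable[OF ind] H int by simp
  show "expectation (\<lambda>\<omega>. H (\<lambda>i\<in>{..<l}. Z i \<omega>) * Z l \<omega>) = 0"
    using indep_var_lebesgue_integral[OF ind] H int by simp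
qed

text \<open>\<open>v\<close> only bounds the total variance from above, so that the property passes
  to sums over disjoint groups that may leave out steps.\<close>

definition centred_walk :: "(nat \<Rightarrow> 'a \<Rightarrow> real) \<Rightarrow> nat \<Rightarrow> real \<Rightarrow> bool" where
  "centred_walk Z n v \<longleftrightarrow> indep_vars (\<lambda>_. borel) Z {..<n} \<and>
     (\<forall>i<n. integrable M (\<lambda>\<omega>. (Z i \<omega>)\<^sup>2) \<and> expectation (Z i) = 0) \<and>
     (\<Sum>i<n. expectation (\<lambda>\<omega>. (Z i \<omega>)\<^sup>2)) \<le> v"

lemma centred_walkD:
  assumes "centred_walk Z n v" "i < n"
  shows "Z i \<in> borel_measurable M" "integrable M (Z i)" "expectation (Z i) = 0" "integrable M (\<lambda>\<omega>. (Z i \<omega>)\<^sup>2)"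
proof -
  show m: "Z i \<in> borel_measurable M"
    using assms by (auto simp: centred_walk_def indep_vars_def)
  show "integrable M (\<lambda>\<omega>. (Z i \<omega>)\<^sup>2)" "expectation (Z i) = 0" 
    using assms by (auto simp: centred_walk_def)
  then show "integrable M (Z i)"
    using square_integrable_imp_integrable[OF m] by simp
qed

text \<open>The lag at time i is a function of the earlier steps bounded by e, so all cross terms
  have mean 0 by \<open>past_orthogonal\<close>.\<close>

lemma energy_integral:
  assumes Z: "centred_walk Z n v" and e: "0 < e"
  shows "integrable M (\<lambda>\<omega>. energy e (\<lambda>i. Z i \<omega>) n)"
    and "expectation (\<lambda>\<omega>. energy e (\<lambda>i. Z i \<omega>) n) \<le> v"
proof -
  have lag: "integrable M (\<lambda>\<omega>. lag e (\<lambda>i. Z i \<omega>) i * Z i \<omega>) \<and> expectation (\<lambda>\<omega>. lag e (\<lambda>i. Z i \<omega>) i * Z i \<omega>) = 0"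
    if "i < n" for i
  proof -
    have eq: "lag e (\<lambda>i'\<in>{..<i}. Z i' \<omega>) i = lag e (\<lambda>i. Z i \<omega>) i" for \<omega>
      by (intro lag_cong) auto
    have m: "(\<lambda>x. lag e x i) \<in> borel_measurable (PiM {..<i} (\<lambda>_. borel))"
      by (intro measurable_lag_PiM) auto
    have Z_meas: "(\<lambda>\<omega>. \<lambda>i'\<in>{..<i}. Z i' \<omega>) \<in> measurable M (PiM {..<i} (\<lambda>_. borel))"
      using centred_walkD(1)[OF Z] that by (intro measurable_restrict) auto
    have "integrable M (\<lambda>\<omega>. lag e (\<lambda>i'\<in>{..<i}. Z i' \<omega>) i)"
      using abs_lag_less[OF e] measurable_compose[OF Z_meas m]
      by (intro integrable_const_bound[where B = e]) (auto simp: less_imp_le)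
    from past_orthogonal[OF _ that m this] show ?thesis
      using centred_walkD[OF Z that] Z unfolding eq centred_walk_def by blast
  qed
  have 1: "integrable M (\<lambda>\<omega>. \<Sum>i<n. (Z i \<omega>)\<^sup>2)"
    using centred_walkD(4)[OF Z] by (intro Bochner_Integration.integrable_sum) auto
  have 2: "integrable M (\<lambda>\<omega>. \<Sum>i<n. lag e (\<lambda>i. Z i \<omega>) i * Z i \<omega>)"
    using lag by (intro Bochner_Integration.integrable_sum) auto
  show "integrable M (\<lambda>\<omega>. energy e (\<lambda>i. Z i \<omega>) n)"
    unfolding energy_def using 1 2 by (intro Bochner_Integration.integrable_add integrable_mult_right)
  have "expectation (\<lambda>\<omega>. \<Sum>i<n. lag e (\<lambda>i. Z i \<omega>) i * Z i \<omega>) = 0"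
    using lag by (subst Bochner_Integration.integral_sum) auto
  moreover have "expectation (\<lambda>\<omega>. \<Sum>i<n. (Z i \<omega>)\<^sup>2) = (\<Sum>i<n. expectation (\<lambda>\<omega>. (Z i \<omega>)\<^sup>2))"
    using centred_walkD(4)[OF Z] by (intro Bochner_Integration.integral_sum) auto
  ultimately have "expectation (\<lambda>\<omega>. energy e (\<lambda>i. Z i \<omega>) n) = (\<Sum>i<n. expectation (\<lambda>\<omega>. (Z i \<omega>)\<^sup>2))"
    unfolding energy_def using 1 2 by (subst Bochner_Integration.integral_add) auto
  then show "expectation (\<lambda>\<omega>. energy e (\<lambda>i. Z i \<omega>) n) \<le> v"
    using Z by (simp add: centred_walk_def)
qed

text \<open>The level energies have mean at most v, whence 5 v = v + 4 v, and the tail of a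
  geometric series bounds the sum uniformly in R. This uniformity allows R to depend on the length
  of the walk.\<close>

lemma chain_bound_integral:
  assumes Z: "centred_walk Z n v" and q: "1 \<le> q" "q < 2"
  shows "integrable M (\<lambda>\<omega>. chain_bound q k R (\<lambda>i. Z i \<omega>) n)"
    and "expectation (\<lambda>\<omega>. chain_bound q k R (\<lambda>i. Z i \<omega>) n) \<le> 2 * (5 * v + 2) * (var_rate q ^ k / (1 - var_rate q))"
proof -
  note E = energy_integral[OF Z, of "(1 / 2) ^ l" for l]
  show int: "integrable M (\<lambda>\<omega>. chain_bound q k R (\<lambda>i. Z i \<omega>) n)" for R
    unfolding chain_bound_def
    by (intro Bochner_Integration.integrable_add Bochner_Integration.integrable_sum integrable_mult_right E) auto
  define r where "r = var_rate q"
  have r: "0 < r" "r < 1" using var_rate_bounds[of q] q by (auto simp: r_def)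
  have v: "0 \<le> v"
    using order.trans[OF Bochner_Integration.integral_nonneg[OF energy_nonneg] E(2)[of 0]] by simp
  define W where "W l \<omega> = level_energy l (\<lambda>i. Z i \<omega>) n" for l \<omega>
  have W: "integrable M (W l)" "expectation (W l) \<le> v" for l
    using E[of l] by (simp_all add: W_def[abs_def])
  have "expectation (\<lambda>\<omega>. chain_bound q k R (\<lambda>i. Z i \<omega>) n)
      = (\<Sum>l=k..<R. expectation (\<lambda>\<omega>. 2 * (r ^ l * (W l \<omega> + 4 * W (Suc l) \<omega> + 2))))"
    unfolding chain_bound_def r_def W_def[symmetric] using W(1) by (intro Bochner_Integration.integral_sum) auto
  also have "\<dots> = (\<Sum>l=k..<R. 2 * (r ^ l * (expectation (W l) + 4 * expectation (W (Suc l)) + 2)))"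
    using W(1) by (simp add: prob_space)
  also have "\<dots> \<le> (\<Sum>l=k..<R. 2 * (r ^ l * (v + 4 * v + 2)))"
    using r by (intro sum_mono mult_left_mono add_mono W) auto
  also have "\<dots> = 2 * (5 * v + 2) * (\<Sum>l=k..<R. r ^ l)"
    unfolding sum_distrib_left by (intro sum.cong) (auto simp: algebra_simps)
  also have "\<dots> \<le> 2 * (5 * v + 2) * (r ^ k / (1 - r))"
  proof (intro mult_left_mono)
    have "(1 - r) * (\<Sum>l=k..<R. r ^ l) \<le> r ^ k"
    proof (cases "k \<le> R")
      case True
      have "(\<Sum>l=k..<R. r ^ l) * (1 - r) = r ^ k - r ^ R"
        using True
      proof (induction rule: dec_induct)
        case (step m)
        then show ?case
          by (simp only: sum.atLeastLessThan_Suc distrib_right) (simp add: algebra_simps)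
      qed simp
      then show ?thesis using r by (simp add: mult.commute)
    qed (use r in auto)
    then show "(\<Sum>l=k..<R. r ^ l) \<le> r ^ k / (1 - r)"
      using r by (simp add: field_simps)
  qed (use v in auto)
  finally show "expectation (\<lambda>\<omega>. chain_bound q k R (\<lambda>i. Z i \<omega>) n) \<le> 2 * (5 * v + 2) * (var_rate q ^ k / (1 - var_rate q))"
    by (simp add: r_def)
qed

lemma indep_vars_group_sums:
  fixes Z :: "'i \<Rightarrow> 'a \<Rightarrow> real"
  assumes "indep_vars (\<lambda>_. borel) Z I" "\<And>m. m \<in> L \<Longrightarrow> G m \<subseteq> I" "disjoint_family_on G L" "\<And>m. m \<in> L \<Longrightarrow> finite (G m)"
  shows "indep_vars (\<lambda>_. borel) (\<lambda>m \<omega>. \<Sum>i\<in>G m. Z i \<omega>) L"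
proof -
  have "indep_vars (\<lambda>_. borel) (\<lambda>m \<omega>. sum (\<lambda>i\<in>G m. Z i \<omega>) (G m)) L"
    using assms
    by (intro indep_vars_compose2[OF indep_vars_restrict[OF assms(1,2,3)], where Y = "\<lambda>m x. sum x (G m)"]) auto
  then show ?thesis by simp
qed

lemma sum_square_integral:
  fixes Z :: "'i \<Rightarrow> 'a \<Rightarrow> real"
  assumes "indep_vars (\<lambda>_. borel) Z F" "finite F"
    and Z: "\<And>i. i \<in> F \<Longrightarrow> integrable M (\<lambda>\<omega>. (Z i \<omega>)\<^sup>2)" "\<And>i. i \<in> F \<Longrightarrow> expectation (Z i) = 0"
  shows "integrable M (\<lambda>\<omega>. (\<Sum>i\<in>F. Z i \<omega>)\<^sup>2) \<and> expectation (\<lambda>\<omega>. (\<Sum>i\<in>F. Z i \<omega>)\<^sup>2) = (\<Sum>i\<in>F. expectation (\<lambda>\<omega>. (Z i \<omega>)\<^sup>2))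
     \<and> integrable M (\<lambda>\<omega>. \<Sum>i\<in>F. Z i \<omega>) \<and> expectation (\<lambda>\<omega>. \<Sum>i\<in>F. Z i \<omega>) = 0"
proof -
  have Z1: "integrable M (Z i)" if "i \<in> F" for i
    using Z[OF that] assms(1) that square_integrable_imp_integrable[of "Z i"] by (auto simp: indep_vars_def)
  show ?thesis
    using \<open>finite F\<close> subset_refl[of F]
  proof (induction rule: finite_subset_induct')
    case empty
    then show ?case by simp
  next
    case (insert a F')
    have ind: "indep_var borel (Z a) borel (\<lambda>\<omega>. \<Sum>i\<in>F'. Z i \<omega>)"
      using insert by (intro indep_vars_sum indep_vars_subset[OF assms(1)]) auto
    have prod: "integrable M (\<lambda>\<omega>. Z a \<omega> * (\<Sum>i\<in>F'. Z i \<omega>))" "expectation (\<lambda>\<omega>. Z a \<omega> * (\<Sum>i\<in>F'. Z i \<omega>)) = 0"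
      using indep_var_integrable[OF ind] indep_var_lebesgue_integral[OF ind] insert Z Z1 by auto
    have sq: "(\<Sum>i\<in>insert a F'. Z i \<omega>)\<^sup>2 = (Z a \<omega>)\<^sup>2 + (\<Sum>i\<in>F'. Z i \<omega>)\<^sup>2 + 2 * (Z a \<omega> * (\<Sum>i\<in>F'. Z i \<omega>))" for \<omega>
      using insert by (simp add: power2_sum)
    show ?case
      unfolding sq using insert Z Z1 prod by simp
  qed
qed

text \<open>Empty groups give zero steps, so few block sums can be spread out over a long grid; this
  puts two walks with different numbers of steps on one index set.\<close>

lemma centred_walk_group_sums:
  assumes Z: "centred_walk Z n v" and G: "\<And>m. m < N \<Longrightarrow> G m \<subseteq> {..<n}" "disjoint_family_on G {..<N}"
  shows "centred_walk (\<lambda>m \<omega>. \<Sum>i\<in>G m. Z i \<omega>) N v"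
proof -
  have fin: "finite (G m)" if "m < N" for m using G(1)[OF that] finite_subset by blast
  have ind: "indep_vars (\<lambda>_. borel) Z {..<n}" using Z by (simp add: centred_walk_def)
  have sq: "integrable M (\<lambda>\<omega>. (\<Sum>i\<in>G m. Z i \<omega>)\<^sup>2) \<and> expectation (\<lambda>\<omega>. (\<Sum>i\<in>G m. Z i \<omega>)\<^sup>2) = (\<Sum>i\<in>G m. expectation (\<lambda>\<omega>. (Z i \<omega>)\<^sup>2))
     \<and> integrable M (\<lambda>\<omega>. \<Sum>i\<in>G m. Z i \<omega>) \<and> expectation (\<lambda>\<omega>. \<Sum>i\<in>G m. Z i \<omega>) = 0" if "m < N" for m
    using G(1)[OF that] fin[OF that] centred_walkD[OF Z]
    by (intro sum_square_integral indep_vars_subset[OF ind]) auto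
  have "(\<Sum>m<N. expectation (\<lambda>\<omega>. (\<Sum>i\<in>G m. Z i \<omega>)\<^sup>2)) = (\<Sum>m<N. \<Sum>i\<in>G m. expectation (\<lambda>\<omega>. (Z i \<omega>)\<^sup>2))"
    using sq by simp
  also have "\<dots> = (\<Sum>i\<in>(\<Union>m<N. G m). expectation (\<lambda>\<omega>. (Z i \<omega>)\<^sup>2))"
    using fin G(2) by (subst sum.UNION_disjoint) (auto simp: disjoint_family_on_def)
  also have "\<dots> \<le> (\<Sum>i<n. expectation (\<lambda>\<omega>. (Z i \<omega>)\<^sup>2))"
    using G(1) by (intro sum_mono2) auto
  also have "\<dots> \<le> v" using Z by (simp add: centred_walk_def)
  finally show ?thesis
    unfolding centred_walk_def using sq G fin by (auto intro!: indep_vars_group_sums[OF ind])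
qed

end

section \<open>A maximal inequality\<close>

fun stopped_walk :: "real \<Rightarrow> (nat \<Rightarrow> real) \<Rightarrow> nat \<Rightarrow> real" where
  "stopped_walk c x 0 = 0"
| "stopped_walk c x (Suc n) = (if c \<le> (stopped_walk c x n)\<^sup>2 then stopped_walk c x n else stopped_walk c x n + x n)"

lemma stopped_walk_reaches:
  "0 < c \<Longrightarrow> l \<le> n \<Longrightarrow> c \<le> (sum x {..<l})\<^sup>2 \<Longrightarrow> c \<le> (stopped_walk c x n)\<^sup>2"
proof -
  assume "0 < c"
  have "(\<exists>l\<le>n. c \<le> (sum x {..<l})\<^sup>2) \<longrightarrow> c \<le> (stopped_walk c x n)\<^sup>2" for n
  proof -
    have "((\<exists>l\<le>n. c \<le> (sum x {..<l})\<^sup>2) \<longrightarrow> c \<le> (stopped_walk c x n)\<^sup>2) \<and>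
      (\<not> c \<le> (stopped_walk c x n)\<^sup>2 \<longrightarrow> stopped_walk c x n = sum x {..<n})"
      by (induction n) (use \<open>0 < c\<close> in \<open>auto simp: le_Suc_eq\<close>)
    then show ?thesis by blast
  qed
  then show "l \<le> n \<Longrightarrow> c \<le> (sum x {..<l})\<^sup>2 \<Longrightarrow> c \<le> (stopped_walk c x n)\<^sup>2" by blast
qed

lemma stopped_walk_cong: "(\<And>i. i < n \<Longrightarrow> x i = y i) \<Longrightarrow> stopped_walk c x n = stopped_walk c y n"
  by (induction n) (auto simp: less_Suc_eq)

lemma abs_stopped_walk_le: "\<bar>stopped_walk c x n\<bar> \<le> (\<Sum>i<n. \<bar>x i\<bar>)"
  by (induction n) (auto intro: order.trans[OF abs_triangle_ineq] add_mono)

lemma measurable_stopped_walk_PiM: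
  "{..<n} \<subseteq> I \<Longrightarrow> (\<lambda>x. stopped_walk c x n) \<in> borel_measurable (PiM I (\<lambda>_. borel))"
proof (induction n)
  case (Suc n)
  then have [measurable]: "(\<lambda>x. stopped_walk c x n) \<in> borel_measurable (PiM I (\<lambda>_. borel))"
    by (simp add: lessThan_Suc)
  have [measurable]: "(\<lambda>x. x n) \<in> borel_measurable (PiM I (\<lambda>_. borel :: real measure))"
    using Suc by (intro measurable_component_singleton) auto
  show ?case unfolding stopped_walk.simps by measurable
qed auto

text \<open>Convexity of \<open>y \<mapsto> max 0 (y\<^sup>2 - \<epsilon>\<^sup>2)\<close>, applied between the stopped walk and its end point.\<close>

lemma stopped_walk_convex_le:
  fixes x :: "nat \<Rightarrow> real" and n :: nat
  assumes "0 < \<epsilon>"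
  defines "T \<equiv> stopped_walk (2 * \<epsilon>\<^sup>2) x" and "S \<equiv> sum x {..<n}"
  shows "\<epsilon>\<^sup>2 * of_bool (2 * \<epsilon>\<^sup>2 \<le> (T n)\<^sup>2) + (\<Sum>l<n. (if 2 * \<epsilon>\<^sup>2 \<le> (T l)\<^sup>2 then 2 * T l else 0) * x l)
     \<le> S\<^sup>2 - min (S\<^sup>2) (\<epsilon>\<^sup>2)"
proof -
  \<comment> \<open>Before the threshold is reached all coefficients vanish and T is still the walk;
    afterwards T is frozen and the weighted steps add up to 2 T (S - T).\<close>
  have *: "(if 2 * \<epsilon>\<^sup>2 \<le> (T n)\<^sup>2 then (\<Sum>l<n. (if 2 * \<epsilon>\<^sup>2 \<le> (T l)\<^sup>2 then 2 * T l else 0) * x l) = 2 * T n * (sum x {..<n} - T n)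
     else (\<Sum>l<n. (if 2 * \<epsilon>\<^sup>2 \<le> (T l)\<^sup>2 then 2 * T l else 0) * x l) = 0 \<and> sum x {..<n} = T n)" for n
    by (induction n) (use assms(1) in \<open>auto simp: T_def algebra_simps split: if_splits\<close>)
  show ?thesis
  proof (cases "2 * \<epsilon>\<^sup>2 \<le> (T n)\<^sup>2")
    case True
    \<comment> \<open>The tangent inequality S^2 \<ge> T^2 + 2 T (S - T); as T^2 \<ge> 2
      \<epsilon>^2, at least \<epsilon>^2 remains after subtracting the truncated square.\<close>
    have "0 \<le> (S - T n)\<^sup>2" by simp
    then have "2 * T n * (S - T n) + (T n)\<^sup>2 \<le> S\<^sup>2" by (simp add: power2_eq_square algebra_simps)
    then show ?thesis using *[of n] True by (simp add: S_def)
  next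
    case False
    then show ?thesis using *[of n] by simp
  qed
qed

text \<open>The right-hand side is the mean of max 0 (S^2 - \<epsilon>^2). Kolmogorov's inequality
  would have the mean of S^2 in its place, whose sum over the blocks is the full variance, however
  fine the blocks. The excess over \<epsilon>^2 does get small, and it is a variance minus the mean
  of a bounded Lipschitz function of S, so the central limit theorem yields its limit.\<close>

lemma (in prob_space) maximal_inequality:
  fixes Z :: "nat \<Rightarrow> 'a \<Rightarrow> real" and n :: nat
  assumes Z: "centred_walk Z n v" and \<epsilon>: "0 < \<epsilon>"
  defines "S \<equiv> \<lambda>\<omega>. \<Sum>i<n. Z i \<omega>"
  shows "{\<omega> \<in> space M. \<exists>l\<le>n. 2 * \<epsilon>\<^sup>2 \<le> (\<Sum>i<l. Z i \<omega>)\<^sup>2} \<in> events"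
    and "prob {\<omega> \<in> space M. \<exists>l\<le>n. 2 * \<epsilon>\<^sup>2 \<le> (\<Sum>i<l. Z i \<omega>)\<^sup>2} * \<epsilon>\<^sup>2
      \<le> expectation (\<lambda>\<omega>. (S \<omega>)\<^sup>2) - expectation (\<lambda>\<omega>. min ((S \<omega>)\<^sup>2) (\<epsilon>\<^sup>2))"
proof -
  define T where "T l \<omega> = stopped_walk (2 * \<epsilon>\<^sup>2) (\<lambda>i. Z i \<omega>) l" for l \<omega>
  define H where "H l x = (let t = stopped_walk (2 * \<epsilon>\<^sup>2) x l in if 2 * \<epsilon>\<^sup>2 \<le> t\<^sup>2 then 2 * t else 0)" for l x
  note ZD = centred_walkD[OF Z]
  have ind: "indep_vars (\<lambda>_. borel) Z {..<n}" using Z by (simp add: centred_walk_def)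
  have sum_meas: "(\<lambda>\<omega>. \<Sum>i<l. Z i \<omega>) \<in> borel_measurable M" if "l \<le> n" for l
    using ZD(1) that by (intro borel_measurable_sum) auto
  have "{\<omega> \<in> space M. \<exists>l\<le>n. 2 * \<epsilon>\<^sup>2 \<le> (\<Sum>i<l. Z i \<omega>)\<^sup>2} = (\<Union>l\<le>n. {\<omega> \<in> space M. 2 * \<epsilon>\<^sup>2 \<le> (\<Sum>i<l. Z i \<omega>)\<^sup>2})"
    by auto
  also have "\<dots> \<in> events"
    using sum_meas by (intro sets.finite_UN) (auto intro!: borel_measurable_le borel_measurable_power)
  finally show ev: "{\<omega> \<in> space M. \<exists>l\<le>n. 2 * \<epsilon>\<^sup>2 \<le> (\<Sum>i<l. Z i \<omega>)\<^sup>2} \<in> events" .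
  have Hmeas: "H l \<in> borel_measurable (PiM {..<l} (\<lambda>_. borel))" for l
  proof -
    have [measurable]: "(\<lambda>x. stopped_walk (2 * \<epsilon>\<^sup>2) x l) \<in> borel_measurable (PiM {..<l} (\<lambda>_. borel))"
      by (intro measurable_stopped_walk_PiM) auto
    show ?thesis unfolding H_def[abs_def] Let_def by measurable
  qed
  have restr: "(\<lambda>\<omega>. \<lambda>i'\<in>{..<l}. Z i' \<omega>) \<in> measurable M (PiM {..<l} (\<lambda>_. borel))" if "l \<le> n" for l
    using ZD(1) that by (intro measurable_restrict) auto
  have Heq: "H l (\<lambda>i\<in>{..<l}. Z i \<omega>) = (if 2 * \<epsilon>\<^sup>2 \<le> (T l \<omega>)\<^sup>2 then 2 * T l \<omega> else 0)" for l \<omega>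
    using stopped_walk_cong[of l "\<lambda>i\<in>{..<l}. Z i \<omega>" "\<lambda>i. Z i \<omega>"] by (simp add: H_def Let_def T_def)
  have HZ: "integrable M (\<lambda>\<omega>. H l (\<lambda>i\<in>{..<l}. Z i \<omega>) * Z l \<omega>) \<and> expectation (\<lambda>\<omega>. H l (\<lambda>i\<in>{..<l}. Z i \<omega>) * Z l \<omega>) = 0" if "l < n" for l
  proof -
    have "integrable M (\<lambda>\<omega>. H l (\<lambda>i\<in>{..<l}. Z i \<omega>))"
    proof (rule Bochner_Integration.integrable_bound)
      show "integrable M (\<lambda>\<omega>. 2 * (\<Sum>i<l. \<bar>Z i \<omega>\<bar>))"
        using ZD(2) that by (intro integrable_mult_right Bochner_Integration.integrable_sum integrable_abs) auto
      show "(\<lambda>\<omega>. H l (\<lambda>i\<in>{..<l}. Z i \<omega>)) \<in> borel_measurable M"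
        using measurable_compose[OF restr Hmeas] that by simp
      show "AE \<omega> in M. norm (H l (\<lambda>i\<in>{..<l}. Z i \<omega>)) \<le> norm (2 * (\<Sum>i<l. \<bar>Z i \<omega>\<bar>))"
      proof (rule AE_I2)
        fix \<omega>
        show "norm (H l (\<lambda>i\<in>{..<l}. Z i \<omega>)) \<le> norm (2 * (\<Sum>i<l. \<bar>Z i \<omega>\<bar>))"
          using abs_stopped_walk_le[of "2 * \<epsilon>\<^sup>2" "\<lambda>i. Z i \<omega>" l] unfolding Heq T_def by (auto simp: sum_nonneg abs_mult)
      qed
    qed
    from past_orthogonal[OF ind that Hmeas this] show ?thesis using ZD[OF that] by blast
  qed
  have Tmeas: "T n \<in> borel_measurable M"
  proof -
    have "stopped_walk (2 * \<epsilon>\<^sup>2) (\<lambda>i\<in>{..<n}. Z i \<omega>) n = T n \<omega>" for \<omega>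
      unfolding T_def by (intro stopped_walk_cong) auto
    then show ?thesis
      using measurable_compose[OF restr[OF order.refl] measurable_stopped_walk_PiM[of n "{..<n}" "2 * \<epsilon>\<^sup>2"]] by simp
  qed
  define B where "B = {\<omega> \<in> space M. 2 * \<epsilon>\<^sup>2 \<le> (T n \<omega>)\<^sup>2}"
  have B: "B \<in> events" using Tmeas unfolding B_def by measurable
  have S: "integrable M (\<lambda>\<omega>. (S \<omega>)\<^sup>2)"
    using sum_square_integral[OF ind] ZD unfolding S_def by auto
  have Smeas: "S \<in> borel_measurable M" using sum_meas[of n] by (simp add: S_def[abs_def])
  have minint: "integrable M (\<lambda>\<omega>. min ((S \<omega>)\<^sup>2) (\<epsilon>\<^sup>2))"
    using Smeas by (intro integrable_const_bound[where B = "\<epsilon>\<^sup>2"]) auto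
  define G where "G \<omega> = (\<Sum>l<n. H l (\<lambda>i\<in>{..<l}. Z i \<omega>) * Z l \<omega>)" for \<omega>
  have G: "integrable M G" "expectation G = 0"
    using HZ unfolding G_def[abs_def]
    by (auto intro!: Bochner_Integration.integrable_sum simp: Bochner_Integration.integral_sum)
  have Bint: "integrable M (\<lambda>\<omega>. \<epsilon>\<^sup>2 * indicator B \<omega>)"
    using B by (intro integrable_mult_right) (auto simp: emeasure_eq_measure)
  have "prob {\<omega> \<in> space M. \<exists>l\<le>n. 2 * \<epsilon>\<^sup>2 \<le> (\<Sum>i<l. Z i \<omega>)\<^sup>2} \<le> prob B"
    using \<epsilon> unfolding B_def T_def
    by (intro finite_measure_mono B[unfolded B_def T_def]) (auto intro: stopped_walk_reaches)
  then have "prob {\<omega> \<in> space M. \<exists>l\<le>n. 2 * \<epsilon>\<^sup>2 \<le> (\<Sum>i<l. Z i \<omega>)\<^sup>2} * \<epsilon>\<^sup>2 \<le> prob B * \<epsilon>\<^sup>2"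
    by (intro mult_right_mono) auto
  also have "\<dots> = expectation (\<lambda>\<omega>. \<epsilon>\<^sup>2 * indicator B \<omega> + G \<omega>)"
    using Bint G B by simp
  also have "\<dots> \<le> expectation (\<lambda>\<omega>. (S \<omega>)\<^sup>2 - min ((S \<omega>)\<^sup>2) (\<epsilon>\<^sup>2))"
  proof (intro integral_mono)
    fix \<omega> assume "\<omega> \<in> space M"
    then have "indicator B \<omega> = (of_bool (2 * \<epsilon>\<^sup>2 \<le> (T n \<omega>)\<^sup>2) :: real)" by (simp add: B_def)
    then show "\<epsilon>\<^sup>2 * indicator B \<omega> + G \<omega> \<le> (S \<omega>)\<^sup>2 - min ((S \<omega>)\<^sup>2) (\<epsilon>\<^sup>2)"
      using stopped_walk_convex_le[OF \<epsilon>, of "\<lambda>i. Z i \<omega>" n]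
      unfolding G_def Heq T_def[symmetric] S_def by simp
  qed (use Bint G S minint in auto)
  also have "\<dots> = expectation (\<lambda>\<omega>. (S \<omega>)\<^sup>2) - expectation (\<lambda>\<omega>. min ((S \<omega>)\<^sup>2) (\<epsilon>\<^sup>2))"
    using S minint by simp
  finally show "prob {\<omega> \<in> space M. \<exists>l\<le>n. 2 * \<epsilon>\<^sup>2 \<le> (\<Sum>i<l. Z i \<omega>)\<^sup>2} * \<epsilon>\<^sup>2
      \<le> expectation (\<lambda>\<omega>. (S \<omega>)\<^sup>2) - expectation (\<lambda>\<omega>. min ((S \<omega>)\<^sup>2) (\<epsilon>\<^sup>2))" .
qed

section \<open>Comparison of a walk with its block sums\<close>

text \<open>Block \<open>b\<close> of \<open>{..<n}\<close> consists of the \<open>i\<close> with \<open>(i + 1) / n\<close> in \<open>{b / L <.. (b + 1) / L}\<close>;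
  \<open>block_of\<close> is the inverse map.\<close>

definition block_start :: "nat \<Rightarrow> nat \<Rightarrow> nat \<Rightarrow> nat" where
  "block_start n L b = b * n div L"

definition block_of :: "nat \<Rightarrow> nat \<Rightarrow> nat \<Rightarrow> nat" where
  "block_of n L i = (Suc i * L - 1) div n"

text \<open>The walk and its block sums are put on a common grid of \<open>2 n\<close> points: step \<open>i\<close> of the walk, at time
  \<open>(i + 1) / n\<close>, gets the index \<open>2 i\<close>, and the sum over the block \<open>b\<close> that ends with step \<open>i\<close>,
  at time \<open>(b + 1) / L\<close>, gets the index \<open>2 i + 1\<close>. The other odd indices carry no step.\<close>

definition grid_time :: "nat \<Rightarrow> nat \<Rightarrow> nat \<Rightarrow> real" where
  "grid_time n L m = (let i = m div 2; b = block_of n L i in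
     if odd m \<and> Suc i = block_start n L (Suc b) then real (Suc b) / L else real (Suc i) / n)"

definition grid_step :: "nat \<Rightarrow> nat set" where
  "grid_step m = (if even m then {m div 2} else {})"

definition grid_block :: "nat \<Rightarrow> nat \<Rightarrow> nat \<Rightarrow> nat set" where
  "grid_block n L m = (let i = m div 2; b = block_of n L i in
     if odd m \<and> Suc i = block_start n L (Suc b) then {block_start n L b..<block_start n L (Suc b)} else {})"

section \<open>Arithmetic of the blocks and of the common grid\<close>

context
  fixes n L :: nat
  assumes L: "0 < L" "L \<le> n"
begin

text \<open>The adjunction that characterises floor division. It turns questions about blocks into
  inequalities between products of natural numbers.\<close>

lemma block_start_le_iff: "c \<le> block_start n L b \<longleftrightarrow> c * L \<le> b * n"
  using L by (simp add: block_start_def less_eq_div_iff_mult_less_eq)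

lemma block_of_bounds: "block_of n L i * n < Suc i * L" "Suc i * L \<le> Suc (block_of n L i) * n"
proof -
  define a where "a = Suc i * L - 1"
  have a: "Suc i * L = Suc a" using L by (simp add: a_def)
  have "a div n * n \<le> a" "a < Suc (a div n) * n"
    using L by (simp_all add: dividend_less_div_times)
  then show "block_of n L i * n < Suc i * L" "Suc i * L \<le> Suc (block_of n L i) * n"
    unfolding a block_of_def diff_Suc_1 by (simp_all add: less_Suc_eq_le)
qed

lemma block_of_eqI:
  assumes "b * n < Suc i * L" "Suc i * L \<le> Suc b * n" shows "block_of n L i = b"
proof -
  have "block_of n L i * n < Suc b * n" "b * n < Suc (block_of n L i) * n"
    using assms block_of_bounds[of i] by linarith+
  then show ?thesis using L by (metis less_Suc_eq_le mult_less_cancel2 order_antisym)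
qed

lemma block_start_0 [simp]: "block_start n L 0 = 0" and block_start_L [simp]: "block_start n L L = n"
  using L by (auto simp: block_start_def)

lemma block_start_mono: "b \<le> c \<Longrightarrow> block_start n L b \<le> block_start n L c"
  by (simp add: block_start_def div_le_mono)

lemma block_start_less: "block_start n L b < block_start n L (Suc b)"
proof -
  have "Suc (block_start n L b) * L \<le> Suc b * n"
    using block_start_le_iff[of "block_start n L b" b] L by simp
  then show ?thesis using block_start_le_iff[of "Suc (block_start n L b)" "Suc b"] by simp
qed

lemma block_of_block_start: "block_of n L (block_start n L (Suc b) - 1) = b"
proof -
  have S: "Suc (block_start n L (Suc b) - 1) = block_start n L (Suc b)"
    using block_start_less[of b] by simp
  show ?thesis
  proof (rule block_of_eqI; unfold S)
    show "block_start n L (Suc b) * L \<le> Suc b * n"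
      using block_start_le_iff[of "block_start n L (Suc b)" "Suc b"] by simp
    have "\<not> Suc (block_start n L (Suc b)) * L \<le> Suc b * n"
      using block_start_le_iff[of "Suc (block_start n L (Suc b))" "Suc b"] by simp
    then show "b * n < block_start n L (Suc b) * L" using L by simp
  qed
qed

lemma block_of_Suc:
  "block_of n L (Suc i) = (if Suc i = block_start n L (Suc (block_of n L i)) then Suc (block_of n L i) else block_of n L i)"
proof -
  let ?b = "block_of n L i"
  note b = block_of_bounds[of i]
  have le: "Suc i \<le> block_start n L (Suc ?b)" using b by (simp add: block_start_le_iff)
  show ?thesis
  proof (cases "Suc i = block_start n L (Suc ?b)")
    case True
    then have "\<not> Suc (Suc i) * L \<le> Suc ?b * n"
      using block_start_le_iff[of "Suc (Suc i)" "Suc ?b"] by simp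
    then have "block_of n L (Suc i) = Suc ?b"
      using b L by (intro block_of_eqI) auto
    then show ?thesis using True by simp
  next
    case False
    with le have "Suc (Suc i) \<le> block_start n L (Suc ?b)" by simp
    then have "Suc (Suc i) * L \<le> Suc ?b * n" by (simp only: block_start_le_iff)
    then have "block_of n L (Suc i) = ?b"
      using b L by (intro block_of_eqI) auto
    then show ?thesis using False by simp
  qed
qed

lemma block_of_less:
  assumes "i < n" shows "block_of n L i < L"
proof -
  have "Suc i * L \<le> n * L" using assms by (intro mult_right_mono) auto
  then have "block_of n L i * n < L * n" using block_of_bounds(1)[of i] unfolding mult.commute[of L n] by linarith
  then show ?thesis by (simp only: mult_less_cancel2)
qed

text \<open>Sampling at these times has to preserve \<open>unit_var\<close>. If step
  \<open>i\<close> ends block b, then (i + 1) / n \<le> (b + 1) / L \<le> (i + 2) / n, so the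
  inserted block time fits between its neighbours.\<close>

lemma incseq_grid_time: "incseq (grid_time n L)"
proof (rule incseq_SucI)
  fix m :: nat
  let ?i = "m div 2"
  let ?b = "block_of n L ?i"
  have pos: "0 < n" using L by simp
  have le: "real a / real c \<le> real a' / real c'" if "a * c' \<le> a' * c" "0 < c" "0 < c'" for a a' c c'
    using that by (simp add: field_simps flip: of_nat_mult)
  show "grid_time n L m \<le> grid_time n L (Suc m)"
  proof (cases "even m")
    case True
    then have "Suc m div 2 = ?i" by simp
    then show ?thesis
      using True block_of_bounds[of ?i] L pos le[of "Suc ?i" L "Suc ?b" n]
      by (auto simp: grid_time_def Let_def)
  next
    case False
    then have d: "Suc m div 2 = Suc ?i" by simp
    have "Suc ?b * n \<le> Suc (Suc ?i) * L" if "Suc ?i = block_start n L (Suc ?b)"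
      using that block_start_le_iff[of "Suc (Suc ?i)" "Suc ?b"] by simp
    then have "real (Suc ?b) / L \<le> real (Suc (Suc ?i)) / n" if "Suc ?i = block_start n L (Suc ?b)"
      using that L pos by (intro le) auto
    moreover have "grid_time n L m = (if Suc ?i = block_start n L (Suc ?b) then real (Suc ?b) / L else real (Suc ?i) / n)"
      "grid_time n L (Suc m) = real (Suc (Suc ?i)) / n"
      using False by (simp_all add: grid_time_def Let_def)
    moreover have "real (Suc ?i) / n \<le> real (Suc (Suc ?i)) / n"
      by (simp add: divide_right_mono)
    ultimately show ?thesis by presburger
  qed
qed

lemma grid_time_bounds: "m < 2 * n \<Longrightarrow> grid_time n L m \<in> {0..1}"
proof -
  assume "m < 2 * n"
  then have "grid_time n L m \<le> grid_time n L (2 * n - 1)"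
    by (intro incseqD[OF incseq_grid_time]) auto
  \<comment> \<open>The last grid index is odd and ends block L - 1, whose time is L / L.\<close>
  also have "\<dots> = 1"
  proof -
    obtain l where l: "L = Suc l" using L(1) gr0_conv_Suc by auto
    have d: "(2 * n - 1) div 2 = n - 1" "odd (2 * n - 1)" using L by (auto elim: evenE)
    have "block_of n L (n - 1) = l"
      using block_of_block_start[of l] by (simp add: l[symmetric])
    then show ?thesis using L unfolding grid_time_def Let_def d(1) by (simp add: l d)
  qed
  finally show ?thesis by (auto simp: grid_time_def Let_def)
qed

lemma sum_grid_step: "(\<Sum>i<m. \<Sum>j\<in>grid_step i. z j) = (\<Sum>j<Suc m div 2. z j)" for z :: "nat \<Rightarrow> real"
  by (induction m) (auto simp: grid_step_def elim!: evenE oddE)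

text \<open>Only completed blocks have been added, and those completed before step \<open>c\<close>
  make up everything in front of the block that contains step \<open>c\<close>.\<close>

lemma sum_grid_block: "(\<Sum>i<2 * c. \<Sum>j\<in>grid_block n L i. z j) = (\<Sum>j<block_start n L (block_of n L c). z j)" for z :: "nat \<Rightarrow> real"
proof (induction c)
  case 0
  have "block_of n L 0 = 0" using L by (intro block_of_eqI) auto
  then show ?case by simp
next
  case (Suc c)
  let ?b = "block_of n L c"
  have 1: "grid_block n L (2 * c) = {}" by (simp add: grid_block_def Let_def)
  have 2: "grid_block n L (Suc (2 * c)) = (if Suc c = block_start n L (Suc ?b) then {block_start n L ?b..<block_start n L (Suc ?b)} else {})"
    by (simp add: grid_block_def Let_def)
  have 3: "sum z {..<block_start n L (Suc ?b)} = sum z {..<block_start n L ?b} + sum z {block_start n L ?b..<block_start n L (Suc ?b)}"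
    using block_start_mono[of ?b "Suc ?b"] by (subst sum.union_disjoint[symmetric]) (auto intro: sum.cong)
  show ?case using Suc by (simp add: 1 2 block_of_Suc 3)
qed

text \<open>At every grid time the two walks differ by the part of the current block that has
  already been walked through.\<close>

lemma abs_sum_grid_diff_less:
  fixes z :: "nat \<Rightarrow> real"
  assumes osc: "\<And>b l. b < L \<Longrightarrow> l \<le> block_start n L (Suc b) - block_start n L b \<Longrightarrow> \<bar>\<Sum>i<l. z (block_start n L b + i)\<bar> < e"
    and m: "m \<le> 2 * n"
  shows "\<bar>(\<Sum>i<m. \<Sum>j\<in>grid_step i. z j) - (\<Sum>i<m. \<Sum>j\<in>grid_block n L i. z j)\<bar> < e"
proof -
  define c where "c = m div 2"
  define a where "a = Suc m div 2"
  have m': "m = 2 * c \<or> m = Suc (2 * c)" and a: "c \<le> a" "a \<le> Suc c" by (auto simp: c_def a_def)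
  have "grid_block n L (2 * c) = {}" by (simp add: grid_block_def Let_def)
  then have B: "(\<Sum>i<m. \<Sum>j\<in>grid_block n L i. z j) = (\<Sum>j<block_start n L (block_of n L c). z j)"
    using m' sum_grid_block[of z c] by auto
  let ?b = "block_of n L c"
  have e: "0 < e" using osc[of 0 0] L by simp
  show ?thesis
  proof (cases "c < n")
    case False
    \<comment> \<open>At the end of the grid all blocks are complete: \<open>block_of\<close> takes
      the value L at n, and the difference is 0.\<close>
    then have "c = n" "a = n" using m by (auto simp: c_def a_def)
    moreover have "block_of n L n = L" using L by (intro block_of_eqI) auto
    ultimately show ?thesis using e by (simp add: B sum_grid_step a_def[symmetric])
  next
    case True
    have b: "?b * n < Suc c * L" "Suc c * L \<le> Suc ?b * n" by (fact block_of_bounds)+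
    have bL: "?b < L" using True by (rule block_of_less)
    have up: "Suc c \<le> block_start n L (Suc ?b)" using b by (simp add: block_start_le_iff)
    have "\<not> Suc c \<le> block_start n L ?b" using b by (simp only: block_start_le_iff not_le)
    then have lo: "block_start n L ?b \<le> c" by simp
    have "(\<Sum>j<a. z j) - (\<Sum>j<block_start n L ?b. z j) = (\<Sum>j=block_start n L ?b..<a. z j)"
      using lo a by (subst sum_diff_nat_ivl[of 0 _ a, symmetric, unfolded atLeast0LessThan]) auto
    also have "\<dots> = (\<Sum>i<a - block_start n L ?b. z (block_start n L ?b + i))"
      by (rule sum.reindex_bij_witness[of _ "\<lambda>i. block_start n L ?b + i" "\<lambda>j. j - block_start n L ?b"]) auto
    also have "\<bar>\<dots>\<bar> < e"
      using a up by (intro osc bL) auto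
    finally show ?thesis by (simp add: B sum_grid_step a_def[symmetric])
  qed
qed

lemma sum_grid_step_weighted:
  "(\<Sum>m<2 * n. f (grid_time n L m) * (\<Sum>j\<in>grid_step m. z j)) = (\<Sum>i<n. f (real (Suc i) / n) * z i)" for f z :: "_ \<Rightarrow> real"
proof -
  have "(\<Sum>m<2 * c. f (grid_time n L m) * (\<Sum>j\<in>grid_step m. z j)) = (\<Sum>i<c. f (real (Suc i) / n) * z i)" for c
    by (induction c) (auto simp: grid_step_def grid_time_def Let_def)
  then show ?thesis .
qed

lemma sum_grid_block_weighted:
  "(\<Sum>m<2 * n. f (grid_time n L m) * (\<Sum>j\<in>grid_block n L m. z j))
     = (\<Sum>b<L. f (real (Suc b) / L) * (\<Sum>j=block_start n L b..<block_start n L (Suc b). z j))" for f z :: "_ \<Rightarrow> real"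
proof -
  \<comment> \<open>The odd index that carries the sum over block \<open>b\<close>: its last step s
    - 1, with s = \<open>block_start n L (Suc b)\<close>, gives 2 (s - 1) + 1.\<close>
  define h where "h b = 2 * block_start n L (Suc b) - 1" for b
  have h: "h b div 2 = block_start n L (Suc b) - 1" "odd (h b)" "Suc (block_start n L (Suc b) - 1) = block_start n L (Suc b)" for b
    using block_start_less[of b] by (auto simp: h_def)
  have gt: "grid_time n L (h b) = real (Suc b) / L"
    and gb: "grid_block n L (h b) = {block_start n L b..<block_start n L (Suc b)}" for b
    unfolding grid_time_def grid_block_def Let_def h block_of_block_start using h(2) by auto
  have inj: "inj_on h {..<L}"
  proof (rule inj_onI)
    fix a b assume "h a = h b"
    then show "a = b" using h(1)[of a] h(1)[of b] block_of_block_start by metis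
  qed
  have "(\<Sum>m<2 * n. f (grid_time n L m) * (\<Sum>j\<in>grid_block n L m. z j)) = (\<Sum>m\<in>h ` {..<L}. f (grid_time n L m) * (\<Sum>j\<in>grid_block n L m. z j))"
  proof (rule sum.mono_neutral_right)
    show "h ` {..<L} \<subseteq> {..<2 * n}"
    proof safe
      fix b assume "b < L"
      then have "block_start n L (Suc b) \<le> n" using block_start_mono[of "Suc b" L] by simp
      then show "h b < 2 * n" using L by (auto simp: h_def)
    qed
    show "\<forall>m\<in>{..<2 * n} - h ` {..<L}. f (grid_time n L m) * (\<Sum>j\<in>grid_block n L m. z j) = 0"
    proof safe
      fix m assume m: "m < 2 * n" "m \<notin> h ` {..<L}"
      let ?b = "block_of n L (m div 2)"
      have "?b < L" using m by (intro block_of_less) auto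
      then have "\<not> (odd m \<and> Suc (m div 2) = block_start n L (Suc ?b))"
      proof (intro notI)
        assume "odd m \<and> Suc (m div 2) = block_start n L (Suc ?b)"
        then have "h ?b = m" unfolding h_def by (auto elim!: oddE simp flip: h_def)
        with \<open>?b < L\<close> m(2) show False by (metis image_eqI lessThan_iff)
      qed
      then have "grid_block n L m = {}" by (auto simp: grid_block_def Let_def)
      then show "f (grid_time n L m) * (\<Sum>j\<in>grid_block n L m. z j) = 0" by simp
    qed
  qed auto
  also have "\<dots> = (\<Sum>b<L. f (real (Suc b) / L) * (\<Sum>j=block_start n L b..<block_start n L (Suc b). z j))"
    by (simp add: sum.reindex[OF inj] gt gb)
  finally show ?thesis .
qed

lemma disjoint_grid_block: "disjoint_family_on (grid_block n L) I"
  unfolding disjoint_family_on_def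
proof safe
  fix m m' i assume "m \<noteq> m'" and i: "i \<in> grid_block n L m" "i \<in> grid_block n L m'"
  have *: "m = Suc (2 * (block_start n L (Suc (block_of n L i)) - 1))" if "i \<in> grid_block n L m" for m
  proof -
    let ?b = "block_of n L (m div 2)"
    from that have b: "odd m" "Suc (m div 2) = block_start n L (Suc ?b)" "block_start n L ?b \<le> i" "i < block_start n L (Suc ?b)"
      by (auto simp: grid_block_def Let_def split: if_splits)
    have "\<not> Suc i * L \<le> ?b * n" "Suc i * L \<le> Suc ?b * n"
      using b(3,4) by (simp_all only: not_le Suc_le_eq flip: block_start_le_iff)
    then have "block_of n L i = ?b" by (intro block_of_eqI) auto
    with b(1,2) show ?thesis by (auto elim!: oddE)
  qed
  show "i \<in> {}" using *[OF i(1)] *[OF i(2)] \<open>m \<noteq> m'\<close> by simp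
qed

lemma grid_block_subset: "m < 2 * n \<Longrightarrow> grid_block n L m \<subseteq> {..<n}"
  by (auto simp: grid_block_def Let_def split: if_splits)

lemma grid_step_subset: "m < 2 * n \<Longrightarrow> grid_step m \<subseteq> {..<n}"
  by (auto simp: grid_step_def)

lemma disjoint_grid_step: "disjoint_family_on grid_step I"
  by (auto simp: disjoint_family_on_def grid_step_def)

end

text \<open>The threshold has the form of \<open>maximal_inequality\<close>. Outside this event the
  walk and its block sums differ by less than sqrt 2 * \<epsilon> on the whole grid.\<close>

definition osc_event :: "'a measure \<Rightarrow> (nat \<Rightarrow> 'a \<Rightarrow> real) \<Rightarrow> nat \<Rightarrow> nat \<Rightarrow> real \<Rightarrow> 'a set" where
  "osc_event M Z n L \<epsilon> = (\<Union>b<L. {\<omega> \<in> space M. \<exists>l\<le>block_start n L (Suc b) - block_start n L b.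
      2 * \<epsilon>\<^sup>2 \<le> (\<Sum>i<l. Z (block_start n L b + i) \<omega>)\<^sup>2})"

text \<open>The first term is the bound of \<open>chain_bound_integral\<close> for two walks; 6 v +
  6 is the comparison term 3 (v + v + 2) of \<open>abs_sum_diff_sum_le\<close>, and the last 1 is
  for the discretisation remainder.\<close>

definition walk_const :: "real \<Rightarrow> real \<Rightarrow> real" where
  "walk_const q v = 4 * (5 * v + 2) / (1 - var_rate q) + 6 * v + 7"

lemma half_le_var_rate: "1 \<le> q \<Longrightarrow> 1 / 2 \<le> var_rate q"
proof -
  assume "1 \<le> q"
  then have "2 powr (-1) \<le> 2 powr (1 - 2 / q)" by (intro powr_mono) (auto simp: field_simps)
  then show ?thesis by (simp add: var_rate_def powr_minus)
qed

section \<open>Dominating variables for a walk and its block sums\<close>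

context prob_space
begin

lemma osc_event:
  fixes Z :: "nat \<Rightarrow> 'a \<Rightarrow> real"
  assumes Z: "centred_walk Z n v" and L: "0 < L" "L \<le> n" and \<epsilon>: "0 < \<epsilon>"
  defines "D \<equiv> \<lambda>b \<omega>. \<Sum>i=block_start n L b..<block_start n L (Suc b). Z i \<omega>"
  shows "osc_event M Z n L \<epsilon> \<in> events"
    and "prob (osc_event M Z n L \<epsilon>) * \<epsilon>\<^sup>2
      \<le> (\<Sum>b<L. expectation (\<lambda>\<omega>. (D b \<omega>)\<^sup>2) - expectation (\<lambda>\<omega>. min ((D b \<omega>)\<^sup>2) (\<epsilon>\<^sup>2)))"
proof -
  let ?s = "block_start n L"
  define E where "E b = {\<omega> \<in> space M. \<exists>l\<le>?s (Suc b) - ?s b. 2 * \<epsilon>\<^sup>2 \<le> (\<Sum>i<l. Z (?s b + i) \<omega>)\<^sup>2}" for b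
  have le: "?s (Suc b) \<le> n" if "b < L" for b
    using block_start_mono[OF L, of "Suc b" L] block_start_L[OF L] that by simp
  have E: "E b \<in> events" "prob (E b) * \<epsilon>\<^sup>2 \<le> expectation (\<lambda>\<omega>. (D b \<omega>)\<^sup>2) - expectation (\<lambda>\<omega>. min ((D b \<omega>)\<^sup>2) (\<epsilon>\<^sup>2))"
    if "b < L" for b
  proof -
    have "centred_walk (\<lambda>m \<omega>. \<Sum>i\<in>{?s b + m}. Z i \<omega>) (?s (Suc b) - ?s b) v"
      using le[OF that] by (intro centred_walk_group_sums[OF Z]) (auto simp: disjoint_family_on_def)
    then have W: "centred_walk (\<lambda>m. Z (?s b + m)) (?s (Suc b) - ?s b) v" by simp
    have eq: "(\<Sum>i<?s (Suc b) - ?s b. Z (?s b + i) \<omega>) = D b \<omega>" for \<omega>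
      unfolding D_def
      by (rule sum.reindex_bij_witness[of _ "\<lambda>j. j - ?s b" "\<lambda>i. ?s b + i"]) auto
    show "E b \<in> events" "prob (E b) * \<epsilon>\<^sup>2 \<le> expectation (\<lambda>\<omega>. (D b \<omega>)\<^sup>2) - expectation (\<lambda>\<omega>. min ((D b \<omega>)\<^sup>2) (\<epsilon>\<^sup>2))"
      unfolding E_def using maximal_inequality[OF W \<epsilon>, unfolded eq] by blast+
  qed
  have eq: "osc_event M Z n L \<epsilon> = (\<Union>b<L. E b)" by (simp add: osc_event_def E_def)
  show "osc_event M Z n L \<epsilon> \<in> events" unfolding eq using E(1) by (intro sets.finite_UN) auto
  have "prob (osc_event M Z n L \<epsilon>) * \<epsilon>\<^sup>2 \<le> (\<Sum>b<L. prob (E b)) * \<epsilon>\<^sup>2"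
    unfolding eq using E(1) by (intro mult_right_mono finite_measure_subadditive_finite) auto
  also have "\<dots> \<le> (\<Sum>b<L. expectation (\<lambda>\<omega>. (D b \<omega>)\<^sup>2) - expectation (\<lambda>\<omega>. min ((D b \<omega>)\<^sup>2) (\<epsilon>\<^sup>2)))"
    unfolding sum_distrib_right using E(2) by (intro sum_mono) auto
  finally show "prob (osc_event M Z n L \<epsilon>) * \<epsilon>\<^sup>2
      \<le> (\<Sum>b<L. expectation (\<lambda>\<omega>. (D b \<omega>)\<^sup>2) - expectation (\<lambda>\<omega>. min ((D b \<omega>)\<^sup>2) (\<epsilon>\<^sup>2)))" .
qed

text \<open>A supremum over f may fail to be measurable, so the estimates are stated through
  integrable U and V chosen before f. U has small mean and is valid where the walks are uniformly
  close; V has bounded mean and is valid everywhere, as needed for the tail of the linear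
  process.\<close>

lemma two_walks_bound:
  fixes x y :: "nat \<Rightarrow> 'a \<Rightarrow> real" and \<tau> :: "nat \<Rightarrow> real"
  assumes x: "centred_walk x N v" and y: "centred_walk y N v" and q: "1 \<le> q" "q < 2"
    and \<tau>: "mono_on {..<N} \<tau>" "\<tau> ` {..<N} \<subseteq> {0..1}"
  shows "\<exists>U V. integrable M U \<and> expectation U \<le> walk_const q v * var_rate q ^ k
     \<and> integrable M V \<and> expectation V \<le> walk_const q v
     \<and> (\<forall>\<omega>. 0 \<le> U \<omega>) \<and> (\<forall>\<omega>. 0 \<le> V \<omega>)
     \<and> (\<forall>\<omega> f \<delta>. f \<in> F_class q \<delta> \<longrightarrow>
           ((\<forall>i\<le>N. \<bar>(\<Sum>m<i. x m \<omega>) - (\<Sum>m<i. y m \<omega>)\<bar> \<le> (1 / 2) ^ k) \<longrightarrow>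
              \<bar>(\<Sum>m<N. f (\<tau> m) * x m \<omega>) - (\<Sum>m<N. f (\<tau> m) * y m \<omega>)\<bar> \<le> U \<omega>) \<and>
           \<bar>\<Sum>m<N. f (\<tau> m) * x m \<omega>\<bar> \<le> V \<omega> \<and> \<bar>\<Sum>m<N. f (\<tau> m) * y m \<omega>\<bar> \<le> V \<omega>)"
proof -
  define r where "r = var_rate q"
  have r: "0 < r" "r < 1" "1 / 2 \<le> r"
    using var_rate_bounds[of q] half_le_var_rate[of q] q by (auto simp: r_def)
  \<comment> \<open>With this scale the trivial remainder is 4 N (1/2)^R = N (1/2)^N (1/2)^k \<le>
    r^k, because N \<le> 2^N and r \<ge> 1 / 2.\<close>
  define R where "R = N + k + 2"
  have rem: "4 * N * (1 / 2) ^ R \<le> r ^ k" "2 * N * (1 / 2 :: real) ^ (N + 1) \<le> 1"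
  proof -
    have N: "real N * (1 / 2) ^ N \<le> 1"
      using less_exp[of N] by (simp add: power_divide field_simps less_imp_le flip: of_nat_power) 
    have "4 * N * (1 / 2) ^ R = (real N * (1 / 2) ^ N) * (1 / 2) ^ k"
      by (simp add: R_def power_add field_simps)
    also have "\<dots> \<le> 1 * r ^ k"
      using N r by (intro mult_mono power_mono) auto
    finally show "4 * N * (1 / 2) ^ R \<le> r ^ k" by simp
    show "2 * N * (1 / 2 :: real) ^ (N + 1) \<le> 1" using N by simp
  qed
  let ?x = "\<lambda>\<omega> i. x i \<omega>" and ?y = "\<lambda>\<omega> i. y i \<omega>"
  define U where "U \<omega> = chain_bound q k R (?x \<omega>) N + chain_bound q k R (?y \<omega>) N
      + 3 * (r ^ k * (level_energy k (?x \<omega>) N + level_energy k (?y \<omega>) N + 2)) + r ^ k" for \<omega>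
  define Vz where "Vz z \<omega> = level_energy 0 (\<lambda>i. z i \<omega>) N + chain_bound q 0 (N + 1) (\<lambda>i. z i \<omega>) N" for z :: "nat \<Rightarrow> 'a \<Rightarrow> real" and \<omega>
  define V where "V \<omega> = Vz x \<omega> + Vz y \<omega> + 1" for \<omega>
  note Ex = energy_integral[OF x, of "(1 / 2) ^ l" for l] and Ey = energy_integral[OF y, of "(1 / 2) ^ l" for l]
  note Cx = chain_bound_integral[OF x q] and Cy = chain_bound_integral[OF y q]
  have U: "integrable M U"
    unfolding U_def[abs_def]
    by (intro Bochner_Integration.integrable_add integrable_mult_right Ex Ey Cx Cy) auto
  have "expectation U = expectation (\<lambda>\<omega>. chain_bound q k R (?x \<omega>) N) + expectation (\<lambda>\<omega>. chain_bound q k R (?y \<omega>) N)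
     + 3 * (r ^ k * (expectation (\<lambda>\<omega>. level_energy k (?x \<omega>) N) + expectation (\<lambda>\<omega>. level_energy k (?y \<omega>) N) + 2)) + r ^ k"
    unfolding U_def[abs_def] using Ex(1)[of k] Ey(1)[of k] Cx(1) Cy(1) by (simp add: prob_space)
  also have "\<dots> \<le> 2 * (5 * v + 2) * (r ^ k / (1 - r)) + 2 * (5 * v + 2) * (r ^ k / (1 - r)) + 3 * (r ^ k * (v + v + 2)) + r ^ k"
    using Ex(2)[of k] Ey(2)[of k] Cx(2)[of k R] Cy(2)[of k R] r(1)
    by (intro add_mono mult_left_mono) (auto simp: r_def)
  also have "\<dots> = walk_const q v * r ^ k"
    by (simp add: walk_const_def r_def[symmetric] add_divide_distrib algebra_simps)
  finally have EU: "expectation U \<le> walk_const q v * var_rate q ^ k" by (simp add: r_def)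
  have V: "integrable M V"
    unfolding V_def[abs_def] Vz_def[abs_def] using Ex(1)[of 0] Ey(1)[of 0] 
    by (intro Bochner_Integration.integrable_add Cx Cy) auto
  have "expectation V = expectation (\<lambda>\<omega>. level_energy 0 (?x \<omega>) N) + expectation (\<lambda>\<omega>. chain_bound q 0 (N + 1) (?x \<omega>) N)
     + (expectation (\<lambda>\<omega>. level_energy 0 (?y \<omega>) N) + expectation (\<lambda>\<omega>. chain_bound q 0 (N + 1) (?y \<omega>) N)) + 1"
    unfolding V_def[abs_def] Vz_def[abs_def] using Ex(1)[of 0] Ey(1)[of 0] Cx(1) Cy(1) by (simp add: prob_space)
  also have "\<dots> \<le> v + 2 * (5 * v + 2) * (r ^ 0 / (1 - r)) + (v + 2 * (5 * v + 2) * (r ^ 0 / (1 - r))) + 1"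
    using Ex(2)[of 0] Ey(2)[of 0] Cx(2)[of 0 "N + 1"] Cy(2)[of 0 "N + 1"]
    by (intro add_mono) (auto simp: r_def)
  also have "\<dots> \<le> walk_const q v"
  proof -
    have "0 \<le> v"
      using order.trans[OF Bochner_Integration.integral_nonneg[OF energy_nonneg] Ex(2)[of 0]] by simp
    then show ?thesis by (simp add: walk_const_def r_def[symmetric])
  qed
  finally have EV: "expectation V \<le> walk_const q v" .
  have "((\<forall>i\<le>N. \<bar>(\<Sum>m<i. x m \<omega>) - (\<Sum>m<i. y m \<omega>)\<bar> \<le> (1 / 2) ^ k) \<longrightarrow>
              \<bar>(\<Sum>m<N. f (\<tau> m) * x m \<omega>) - (\<Sum>m<N. f (\<tau> m) * y m \<omega>)\<bar> \<le> U \<omega>) \<and>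
           \<bar>\<Sum>m<N. f (\<tau> m) * x m \<omega>\<bar> \<le> V \<omega> \<and> \<bar>\<Sum>m<N. f (\<tau> m) * y m \<omega>\<bar> \<le> V \<omega>"
    if f: "f \<in> F_class q \<delta>" for f \<delta> \<omega>
  proof (intro conjI impI)
    have g: "unit_var q N (\<lambda>m. f (\<tau> m))" by (intro F_class_unit_var[OF q(1) f] \<tau>)
    have Vz: "\<bar>\<Sum>m<N. f (\<tau> m) * z m \<omega>\<bar> \<le> Vz z \<omega> + 1" for z
      using abs_sum_le_energy[OF g q(1), of "\<lambda>i. z i \<omega>" "N + 1"] rem(2) by (simp add: Vz_def)
    have nonneg: "0 \<le> Vz z \<omega>" for z
      using energy_nonneg r unfolding Vz_def chain_bound_def by (auto intro!: add_nonneg_nonneg sum_nonneg mult_nonneg_nonneg simp: r_def)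
    show "\<bar>\<Sum>m<N. f (\<tau> m) * x m \<omega>\<bar> \<le> V \<omega>" "\<bar>\<Sum>m<N. f (\<tau> m) * y m \<omega>\<bar> \<le> V \<omega>"
      using Vz[of x] Vz[of y] nonneg[of x] nonneg[of y] by (simp_all add: V_def)
    assume near: "\<forall>i\<le>N. \<bar>(\<Sum>m<i. x m \<omega>) - (\<Sum>m<i. y m \<omega>)\<bar> \<le> (1 / 2) ^ k"
    show "\<bar>(\<Sum>m<N. f (\<tau> m) * x m \<omega>) - (\<Sum>m<N. f (\<tau> m) * y m \<omega>)\<bar> \<le> U \<omega>"
      using abs_sum_diff_sum_le[OF g q(1), of k R "?x \<omega>" "?y \<omega>"] near rem(1) by (simp add: U_def R_def r_def)
  qed
  moreover have "0 \<le> U \<omega>" "0 \<le> V \<omega>" for \<omega>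
    using energy_nonneg r unfolding U_def V_def Vz_def chain_bound_def
    by (auto intro!: add_nonneg_nonneg sum_nonneg mult_nonneg_nonneg simp: r_def)
  ultimately show ?thesis using U EU V EV by blast
qed

text \<open>Both sums are integrals of f over the common grid, so \<open>two_walks_bound\<close>
  applies with 2 n steps; outside \<open>osc_event\<close> the walks are within (1/2)^k of each
  other by the choice of \<epsilon>.\<close>

theorem block_approximation:
  fixes Z :: "nat \<Rightarrow> 'a \<Rightarrow> real"
  assumes Z: "centred_walk Z n v" and L: "0 < L" "L \<le> n" and q: "1 \<le> q" "q < 2"
    and \<epsilon>: "2 * \<epsilon>\<^sup>2 = ((1 / 2) ^ k)\<^sup>2"
  defines "S \<equiv> \<lambda>f \<omega>. \<Sum>i<n. f (real (Suc i) / n) * Z i \<omega>"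
    and "\<Phi> \<equiv> \<lambda>f \<omega>. \<Sum>b<L. f (real (Suc b) / L) * (\<Sum>i=block_start n L b..<block_start n L (Suc b). Z i \<omega>)"
  shows "\<exists>U V. integrable M U \<and> expectation U \<le> walk_const q v * var_rate q ^ k
     \<and> integrable M V \<and> expectation V \<le> walk_const q v
     \<and> (\<forall>\<omega>. 0 \<le> U \<omega>) \<and> (\<forall>\<omega>. 0 \<le> V \<omega>)
     \<and> (\<forall>\<omega>\<in>space M. \<forall>f \<delta>. f \<in> F_class q \<delta> \<longrightarrow>
           (\<omega> \<notin> osc_event M Z n L \<epsilon> \<longrightarrow> \<bar>S f \<omega> - \<Phi> f \<omega>\<bar> \<le> U \<omega>) \<and> \<bar>S f \<omega>\<bar> \<le> V \<omega> \<and> \<bar>\<Phi> f \<omega>\<bar> \<le> V \<omega>)"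
proof -
  define x where "x m \<omega> = (\<Sum>j\<in>grid_step m. Z j \<omega>)" for m \<omega>
  define y where "y m \<omega> = (\<Sum>j\<in>grid_block n L m. Z j \<omega>)" for m \<omega>
  have x: "centred_walk x (2 * n) v" and y: "centred_walk y (2 * n) v"
    unfolding x_def[abs_def] y_def[abs_def]
    by (intro centred_walk_group_sums[OF Z] grid_step_subset[OF L] grid_block_subset[OF L] disjoint_grid_step[OF L] disjoint_grid_block[OF L]; simp)+
  have near: "\<bar>(\<Sum>m<i. x m \<omega>) - (\<Sum>m<i. y m \<omega>)\<bar> \<le> (1 / 2) ^ k"
    if "\<omega> \<in> space M" "\<omega> \<notin> osc_event M Z n L \<epsilon>" "i \<le> 2 * n" for i \<omega>
  proof -
    have "\<bar>\<Sum>i<l. Z (block_start n L b + i) \<omega>\<bar> < (1 / 2) ^ k"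
      if "b < L" "l \<le> block_start n L (Suc b) - block_start n L b" for b l
    proof -
      have "\<not> ((1 / 2) ^ k)\<^sup>2 \<le> (\<Sum>i<l. Z (block_start n L b + i) \<omega>)\<^sup>2"
        using \<open>\<omega> \<notin> osc_event M Z n L \<epsilon>\<close> \<open>\<omega> \<in> space M\<close> that by (auto simp: osc_event_def \<epsilon>)
      then show ?thesis
        using power2_less_imp_less[of "\<bar>\<Sum>i<l. Z (block_start n L b + i) \<omega>\<bar>" "(1 / 2) ^ k"] by simp
    qed
    from abs_sum_grid_diff_less[where z = "\<lambda>j. Z j \<omega>", OF L this that(3)]
    show ?thesis by (simp add: x_def y_def)
  qed
  have \<tau>: "mono_on {..<2 * n} (grid_time n L)" "grid_time n L ` {..<2 * n} \<subseteq> {0..1}"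
    using incseq_grid_time[OF L] grid_time_bounds[OF L] by (auto simp: mono_on_def incseq_def)
  have S: "S f \<omega> = (\<Sum>m<2 * n. f (grid_time n L m) * x m \<omega>)" for f \<omega>
    unfolding S_def x_def sum_grid_step_weighted[OF L] ..
  have \<Phi>: "\<Phi> f \<omega> = (\<Sum>m<2 * n. f (grid_time n L m) * y m \<omega>)" for f \<omega>
    unfolding \<Phi>_def y_def sum_grid_block_weighted[OF L] ..
  obtain U V where UV: "integrable M U" "expectation U \<le> walk_const q v * var_rate q ^ k"
      "integrable M V" "expectation V \<le> walk_const q v" "\<And>\<omega>. 0 \<le> U \<omega>" "\<And>\<omega>. 0 \<le> V \<omega>"
    and b: "\<And>\<omega> f \<delta>. f \<in> F_class q \<delta> \<Longrightarrow> \<forall>i\<le>2 * n. \<bar>(\<Sum>m<i. x m \<omega>) - (\<Sum>m<i. y m \<omega>)\<bar> \<le> (1 / 2) ^ k \<Longrightarrow>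
        \<bar>S f \<omega> - \<Phi> f \<omega>\<bar> \<le> U \<omega>"
      "\<And>\<omega> f \<delta>. f \<in> F_class q \<delta> \<Longrightarrow> \<bar>S f \<omega>\<bar> \<le> V \<omega>"
      "\<And>\<omega> f \<delta>. f \<in> F_class q \<delta> \<Longrightarrow> \<bar>\<Phi> f \<omega>\<bar> \<le> V \<omega>"
    using two_walks_bound[OF x y q \<tau>, of k] unfolding S[symmetric] \<Phi>[symmetric] by blast
  show ?thesis
    by (rule exI[of _ U], rule exI[of _ V], intro conjI ballI allI impI UV b) (use near in auto)
qed

end

section \<open>Convergence in outer distribution by approximation\<close>

text \<open>The sup-convolution of \<open>g\<close>, for bounded \<open>g\<close> its least
  j-Lipschitz majorant. If \<open>g\<close> is also continuous, it decreases to \<open>g\<close> as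
  j grows, which reduces continuous test functions to Lipschitz ones.\<close>

definition envelope :: "'e metric \<Rightarrow> real \<Rightarrow> ('e \<Rightarrow> real) \<Rightarrow> 'e \<Rightarrow> real" where
  "envelope m j g x = (SUP y\<in>mspace m. g y - j * mdist m x y)"

definition bounded_lipschitz :: "'e metric \<Rightarrow> ('e \<Rightarrow> real) \<Rightarrow> bool" where
  "bounded_lipschitz m h \<longleftrightarrow> (\<exists>c. \<forall>x\<in>mspace m. \<bar>h x\<bar> \<le> c) \<and>
     (\<exists>j\<ge>0. \<forall>x\<in>mspace m. \<forall>y\<in>mspace m. \<bar>h x - h y\<bar> \<le> j * mdist m x y)"

context
  fixes m :: "'e metric" and g :: "'e \<Rightarrow> real" and c j :: real
  assumes g: "\<And>x. x \<in> mspace m \<Longrightarrow> \<bar>g x\<bar> \<le> c" and j: "0 \<le> j"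
begin

lemma envelope_bdd: "x \<in> mspace m \<Longrightarrow> bdd_above ((\<lambda>y. g y - j * mdist m x y) ` mspace m)"
proof (rule bdd_aboveI2)
  fix y assume "y \<in> mspace m"
  then have "g y \<le> c" using g[of y] by auto
  then show "g y - j * mdist m x y \<le> c" using j by (smt (verit) mdist_nonneg mult_nonneg_nonneg)
qed

lemma envelope_ge: "x \<in> mspace m \<Longrightarrow> g x \<le> envelope m j g x"
  unfolding envelope_def by (rule cSUP_upper2[OF envelope_bdd, of _ x]) (auto simp: Metric_space.mdist_zero[OF Metric_space_mspace_mdist])

lemma envelope_leI:
  "x \<in> mspace m \<Longrightarrow> (\<And>y. y \<in> mspace m \<Longrightarrow> g y - j * mdist m x y \<le> a) \<Longrightarrow> envelope m j g x \<le> a"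
  unfolding envelope_def by (rule cSUP_least) auto

lemma envelope_abs_le: assumes "x \<in> mspace m" shows "\<bar>envelope m j g x\<bar> \<le> c"
proof -
  have "envelope m j g x \<le> c"
    using g j assms by (intro envelope_leI) (smt (verit) mdist_nonneg mult_nonneg_nonneg)+
  then show ?thesis using envelope_ge[OF assms] g[OF assms] by linarith
qed

lemma envelope_lipschitz:
  assumes "x \<in> mspace m" "y \<in> mspace m"
  shows "envelope m j g x \<le> envelope m j g y + j * mdist m x y"
proof (rule envelope_leI[OF assms(1)])
  fix z assume z: "z \<in> mspace m"
  have "g z - j * mdist m y z \<le> envelope m j g y"
    unfolding envelope_def using envelope_bdd[OF assms(2)] z by (rule cSUP_upper2) simp
  moreover have "j * mdist m y z \<le> j * (mdist m x y + mdist m x z)"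
    using mdist_triangle[of y m x z] assms z j by (intro mult_left_mono) (auto simp: mdist_commute)
  ultimately show "g z - j * mdist m x z \<le> envelope m j g y + j * mdist m x y"
    by (simp add: algebra_simps)
qed

lemma bounded_lipschitz_envelope: "bounded_lipschitz m (envelope m j g)"
  unfolding bounded_lipschitz_def
proof
  show "\<exists>c. \<forall>x\<in>mspace m. \<bar>envelope m j g x\<bar> \<le> c" using envelope_abs_le by blast
  have "\<bar>envelope m j g x - envelope m j g y\<bar> \<le> j * mdist m x y" if "x \<in> mspace m" "y \<in> mspace m" for x y
    using envelope_lipschitz[OF that] envelope_lipschitz[OF that(2,1)] by (simp add: mdist_commute abs_le_iff)
  then show "\<exists>j'\<ge>0. \<forall>x\<in>mspace m. \<forall>y\<in>mspace m. \<bar>envelope m j g x - envelope m j g y\<bar> \<le> j' * mdist m x y"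
    using j by blast
qed

end

lemma continuous_map_mtopology_ofD:
  assumes "continuous_map (mtopology_of m) euclideanreal h" "x \<in> mspace m" "0 < e"
  obtains \<delta> where "0 < \<delta>" "\<And>y. y \<in> mspace m \<Longrightarrow> mdist m x y < \<delta> \<Longrightarrow> \<bar>h x - h y\<bar> < e"
proof -
  interpret Metric_space "mspace m" "mdist m" by simp
  have "continuous_map mtopology (Met_TC.mtopology :: real topology) h"
    using assms(1) by (simp add: mtopology_of_def)
  then show ?thesis
    using metric_continuous_map[OF Met_TC.Metric_space_axioms] assms that by (metis dist_real_def)
qed

lemma envelope_tendsto:
  assumes h: "continuous_map (mtopology_of m) euclideanreal h" and c: "\<And>x. x \<in> mspace m \<Longrightarrow> \<bar>h x\<bar> \<le> c"
    and x: "x \<in> mspace m"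
  shows "(\<lambda>j. envelope m (real j) h x) \<longlonglongrightarrow> h x"
proof (rule LIMSEQ_I)
  fix e :: real assume "0 < e"
  obtain \<delta> where \<delta>: "0 < \<delta>" "\<And>y. y \<in> mspace m \<Longrightarrow> mdist m x y < \<delta> \<Longrightarrow> \<bar>h x - h y\<bar> < e / 2"
    using continuous_map_mtopology_ofD[OF h x, of "e / 2"] \<open>0 < e\<close> by auto
  \<comment> \<open>From this j on, a point at distance at least \<delta> pays a penalty above 2 c,
    more than \<open>h\<close> can vary, so only points near x compete for the supremum.\<close>
  obtain J where J: "2 * c / \<delta> < real J" using reals_Archimedean2 by blast
  have "norm (envelope m (real j) h x - h x) < e" if "J \<le> j" for j
  proof -
    have "envelope m (real j) h x \<le> h x + e / 2"
    proof (rule envelope_leI[OF c _ x])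
      fix y assume y: "y \<in> mspace m"
      show "h y - real j * mdist m x y \<le> h x + e / 2"
      proof (cases "mdist m x y < \<delta>")
        case True
        have "0 \<le> real j * mdist m x y" by simp
        with \<delta>(2)[OF y True] show ?thesis by linarith
      next
        case False
        have "2 * c < real J * \<delta>" using J \<delta>(1) by (simp add: field_simps)
        also have "\<dots> \<le> real j * mdist m x y" using False \<delta>(1) that by (intro mult_mono) auto
        finally show ?thesis using c[OF x] c[OF y] \<open>0 < e\<close> by linarith
      qed
    qed auto
    with envelope_ge[of m h c "real j" x] c x \<open>0 < e\<close> show ?thesis by auto
  qed
  then show "\<exists>J. \<forall>j\<ge>J. norm (envelope m (real j) h x - h x) < e" by blast
qed

section \<open>Integrable bounds for outer expectations\<close>

lemma extended_expectation_ereal: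
  assumes "integrable M u" shows "extended_expectation M (\<lambda>x. ereal (u x)) = ereal (\<integral>x. u x \<partial>M)"
proof -
  have 1: "(\<integral>\<^sup>+ x. ennreal (u x) \<partial>M) < \<infinity>" "(\<integral>\<^sup>+ x. ennreal (- u x) \<partial>M) < \<infinity>"
    using assms by (auto simp: real_integrable_def less_top)
  have "enn2ereal a = ereal (enn2real a)" if "a < \<infinity>" for a
    using that by (cases a) auto
  then show ?thesis
    using 1 by (simp add: extended_expectation_def real_lebesgue_integral_def[OF assms] e2ennreal_ereal)
qed

lemma outer_expectation_le:
  assumes u: "integrable M u" and "\<And>x. x \<in> space M \<Longrightarrow> T x \<le> u x"
  shows "outer_expectation M T \<le> ereal (\<integral>x. u x \<partial>M)"
  unfolding outer_expectation_def extended_expectation_ereal[OF u, symmetric]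
proof (rule Inf_lower, rule CollectI, intro exI[of _ "\<lambda>x. ereal (u x)"] conjI refl ballI)
  show "expectation_exists M (\<lambda>x. ereal (u x))"
    using u by (auto simp: expectation_exists_def real_integrable_def less_top e2ennreal_ereal)
qed (use assms in auto)

lemma outer_expectation_ge:
  assumes l: "integrable M l" and "\<And>x. x \<in> space M \<Longrightarrow> l x \<le> T x"
  shows "ereal (\<integral>x. l x \<partial>M) \<le> outer_expectation M T"
  unfolding outer_expectation_def extended_expectation_ereal[OF l, symmetric]
proof (rule Inf_greatest, safe)
  fix U assume U: "U \<in> borel_measurable M" "\<forall>x\<in>space M. ereal (T x) \<le> U x"
  have lU: "ereal (l x) \<le> U x" if "x \<in> space M" for x
    using U(2) that assms(2)[OF that] by (meson ereal_less_eq(3) order_trans)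
  show "extended_expectation M (\<lambda>x. ereal (l x)) \<le> extended_expectation M U"
    unfolding extended_expectation_def
  proof (rule ereal_minus_mono)
    show "enn2ereal (\<integral>\<^sup>+ x. e2ennreal (ereal (l x)) \<partial>M) \<le> enn2ereal (\<integral>\<^sup>+ x. e2ennreal (U x) \<partial>M)"
      unfolding less_eq_ennreal.rep_eq[symmetric] by (intro nn_integral_mono e2ennreal_mono lU)
    have "- U x \<le> - ereal (l x)" if "x \<in> space M" for x
      using lU[OF that] by (simp only: ereal_minus_le_minus)
    then show "enn2ereal (\<integral>\<^sup>+ x. e2ennreal (- U x) \<partial>M) \<le> enn2ereal (\<integral>\<^sup>+ x. e2ennreal (- ereal (l x)) \<partial>M)"
      unfolding less_eq_ennreal.rep_eq[symmetric] by (intro nn_integral_mono e2ennreal_mono)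
  qed
qed

text \<open>The target will be a non-separable space, where Borel measurability of the
  approximations is delicate. Measurability is assumed for their bounded Lipschitz functionals; that
  of the limit on its range is derived from it.\<close>

locale pointwise_limit = P: prob_space P for P :: "'b measure" +
  fixes m :: "'e metric" and Ys :: "nat \<Rightarrow> 'b \<Rightarrow> 'e" and Y :: "'b \<Rightarrow> 'e"
  assumes Ys_in: "\<And>K. Ys K \<in> space P \<rightarrow> mspace m" and Y_in: "Y \<in> space P \<rightarrow> mspace m"
    and Ys_lim: "\<And>\<omega>. \<omega> \<in> space P \<Longrightarrow> (\<lambda>K. mdist m (Ys K \<omega>) (Y \<omega>)) \<longlonglongrightarrow> 0"
    and Ys_meas: "\<And>K h. bounded_lipschitz m h \<Longrightarrow> (\<lambda>\<omega>. h (Ys K \<omega>)) \<in> borel_measurable P"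
begin

lemma bounded_lipschitz_Ys_lim:
  assumes h: "bounded_lipschitz m h" and \<omega>: "\<omega> \<in> space P"
  shows "(\<lambda>K. h (Ys K \<omega>)) \<longlonglongrightarrow> h (Y \<omega>)"
proof -
  obtain j where j: "\<And>x y. x \<in> mspace m \<Longrightarrow> y \<in> mspace m \<Longrightarrow> \<bar>h x - h y\<bar> \<le> j * mdist m x y"
    using h by (auto simp: bounded_lipschitz_def)
  have "(\<lambda>K. h (Ys K \<omega>) - h (Y \<omega>)) \<longlonglongrightarrow> 0"
  proof (rule Lim_null_comparison)
    show "\<forall>\<^sub>F K in sequentially. norm (h (Ys K \<omega>) - h (Y \<omega>)) \<le> j * mdist m (Ys K \<omega>) (Y \<omega>)"
      using j Ys_in Y_in \<omega> by (intro always_eventually) (auto simp: Pi_iff)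
    show "(\<lambda>K. j * mdist m (Ys K \<omega>) (Y \<omega>)) \<longlonglongrightarrow> 0"
      using tendsto_mult_right_zero[OF Ys_lim[OF \<omega>], of j] by simp
  qed
  then show ?thesis using LIM_zero_iff by blast
qed

lemma bounded_lipschitz_Y_meas: "bounded_lipschitz m h \<Longrightarrow> (\<lambda>\<omega>. h (Y \<omega>)) \<in> borel_measurable P"
  by (rule borel_measurable_LIMSEQ_real[OF bounded_lipschitz_Ys_lim Ys_meas])

lemma Y_borel_measurable_on_range: "borel_measurable_on_range P m Y"
proof -
  define T where "T = subtopology (mtopology_of m) (Y ` space P)"
  have ts: "topspace T = Y ` space P" using Y_in by (auto simp: T_def)
  interpret Metric_space "mspace m" "mdist m" by simp
  show ?thesis
    unfolding borel_measurable_on_range_def borel_on_def T_def[symmetric]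
  proof (rule measurable_measure_of)
    show "{U. openin T U} \<subseteq> Pow (topspace T)" using openin_subset by auto
    show "Y \<in> space P \<rightarrow> topspace T" by (auto simp: ts)
    fix W assume "W \<in> {U. openin T U}"
    then obtain U where U: "openin (mtopology_of m) U" "W = U \<inter> Y ` space P"
      by (auto simp: T_def openin_subtopology)
    \<comment> \<open>The envelope of the indicator of the complement of U is max 0 (1 - distance to
      the complement), which is below 1 exactly on U. So every open set is recovered from a bounded
      Lipschitz functional.\<close>
    define g where "g x = (if x \<in> U then 0 else 1 :: real)" for x
    have g: "\<bar>g x\<bar> \<le> 1" for x by (simp add: g_def)
    have "x \<in> U \<longleftrightarrow> envelope m 1 g x < 1" if x: "x \<in> mspace m" for x
    proof
      assume "x \<in> U"
      then obtain r where r: "0 < r" "mball x r \<subseteq> U" using U(1) unfolding mtopology_of_def openin_mtopology by blast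
      have "envelope m 1 g x \<le> max 0 (1 - r)"
      proof (rule envelope_leI[OF g _ x])
        fix y assume y: "y \<in> mspace m"
        show "g y - 1 * mdist m x y \<le> max 0 (1 - r)"
        proof (cases "y \<in> U")
          case False
          then have "r \<le> mdist m x y" using r(2) x y by (auto simp: in_mball not_less[symmetric])
          with False show ?thesis by (simp add: g_def)
        qed (simp add: g_def le_max_iff_disj)
      qed auto
      then show "envelope m 1 g x < 1" using r by auto
    next
      assume "envelope m 1 g x < 1"
      then show "x \<in> U" using envelope_ge[of m g 1 1 x, OF g] x by (auto simp: g_def split: if_splits)
    qed
    then have "Y -` W \<inter> space P = {\<omega> \<in> space P. envelope m 1 g (Y \<omega>) < 1}"
      using Y_in U(2) by (auto simp: Pi_iff)
    also have "\<dots> \<in> sets P"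
      using bounded_lipschitz_Y_meas[OF bounded_lipschitz_envelope[of m g 1 1]] g by measurable
    finally show "Y -` W \<inter> space P \<in> sets P" .
  qed
qed

lemma Y_separably_valued:
  assumes "countable C" "C \<subseteq> mspace m" and C: "\<And>\<omega> e. \<omega> \<in> space P \<Longrightarrow> 0 < e \<Longrightarrow> \<exists>c\<in>C. mdist m (Y \<omega>) c < e"
  shows "separably_valued P m Y"
proof -
  interpret Metric_space "mspace m" "mdist m" by simp
  define S where "S = mtopology closure_of C"
  have CS: "C \<subseteq> S" unfolding S_def using assms(2) by (intro closure_of_subset) auto
  have "subtopology mtopology S closure_of C = S"
    using CS by (simp add: closure_of_subtopology S_def inf.absorb2 inf.absorb_iff2[symmetric] Int_absorb1)
  then have "separable_space (subtopology (mtopology_of m) S)"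
    unfolding separable_space_def mtopology_of_def
    using assms(1) CS closure_of_subset_topspace[of mtopology C] by (intro exI[of _ C]) (auto simp: S_def)
  moreover have "Y \<in> space P \<rightarrow> S"
  proof
    fix \<omega> assume "\<omega> \<in> space P"
    then show "Y \<omega> \<in> S"
      using C Y_in assms(2) unfolding S_def metric_closure_of in_mball by (auto simp: Pi_iff in_mball) (meson in_mono)
  qed
  moreover have "S \<subseteq> mspace m" using closure_of_subset_topspace[of mtopology C] by (simp add: S_def)
  ultimately show ?thesis unfolding separably_valued_def by blast
qed

lemma continuous_Y_meas:
  assumes h: "continuous_map (mtopology_of m) euclideanreal h" and c: "\<And>x. x \<in> mspace m \<Longrightarrow> \<bar>h x\<bar> \<le> c"
  shows "(\<lambda>\<omega>. h (Y \<omega>)) \<in> borel_measurable P"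
proof (rule borel_measurable_LIMSEQ_real)
  show "(\<lambda>j. envelope m (real j) h (Y \<omega>)) \<longlonglongrightarrow> h (Y \<omega>)" if "\<omega> \<in> space P" for \<omega>
    using Y_in that by (intro envelope_tendsto[OF h c]) auto
  show "(\<lambda>\<omega>. envelope m (real j) h (Y \<omega>)) \<in> borel_measurable P" for j
    using c by (intro bounded_lipschitz_Y_meas bounded_lipschitz_envelope[of m h c]) auto
qed

end

text \<open>The converging-together theorem in two indices: \<open>X K n\<close> tends to
  \<open>Ys K\<close> in law as n grows, \<open>Ys K\<close> tends to Y, and for large K all but
  finitely many \<open>Z n\<close> are close to \<open>X K n\<close>. As the distance need not be
  measurable, closeness is required outside a measurable set of small probability.\<close>

locale outer_approximation = M: prob_space M + pointwise_limit P m Ys Y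
  for M :: "'a measure" and P :: "'b measure" and m :: "'e metric" and Ys :: "nat \<Rightarrow> 'b \<Rightarrow> 'e" and Y :: "'b \<Rightarrow> 'e" +
  fixes Z :: "nat \<Rightarrow> 'a \<Rightarrow> 'e" and X :: "nat \<Rightarrow> nat \<Rightarrow> 'a \<Rightarrow> 'e"
  assumes Z_in: "\<forall>\<^sub>F n in sequentially. Z n \<in> space M \<rightarrow> mspace m"
    and X_in: "\<And>K n. X K n \<in> space M \<rightarrow> mspace m"
    and approx: "\<And>e. 0 < e \<Longrightarrow> \<forall>\<^sub>F K in sequentially. \<forall>\<^sub>F n in sequentially.
        \<exists>B\<in>sets M. measure M B \<le> e \<and> (\<forall>\<omega>\<in>space M - B. mdist m (Z n \<omega>) (X K n \<omega>) \<le> e)"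
    and X_meas: "\<And>K n h. bounded_lipschitz m h \<Longrightarrow> (\<lambda>\<omega>. h (X K n \<omega>)) \<in> borel_measurable M"
    and X_lim: "\<And>K h. bounded_lipschitz m h \<Longrightarrow>
        (\<lambda>n. \<integral>\<omega>. h (X K n \<omega>) \<partial>M) \<longlonglongrightarrow> (\<integral>\<omega>. h (Ys K \<omega>) \<partial>P)"
begin

text \<open>The majorant is the envelope at \<open>X K n\<close> plus j d, and plus 2 c on the
  exceptional set, where only boundedness is available. It is measurable although
  \<open>h (Z n \<omega>)\<close> may not be, and so bounds the outer expectation.\<close>

lemma eventually_upper:
  assumes h: "continuous_map (mtopology_of m) euclideanreal h" and c: "\<And>x. x \<in> mspace m \<Longrightarrow> \<bar>h x\<bar> \<le> c"
    and e: "0 < e"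
  shows "\<forall>\<^sub>F n in sequentially. \<exists>u. integrable M u \<and> (\<forall>\<omega>\<in>space M. h (Z n \<omega>) \<le> u \<omega>) \<and>
     (\<integral>\<omega>. u \<omega> \<partial>M) < (\<integral>\<omega>. h (Y \<omega>) \<partial>P) + e"
proof -
  have "0 \<le> c"
  proof -
    obtain \<omega> where "\<omega> \<in> space P" using P.not_empty by blast
    then show ?thesis using c[of "Y \<omega>"] Y_in by (auto simp: Pi_iff)
  qed
  let ?h = "\<lambda>j. envelope m (real j) h"
  have lip: "bounded_lipschitz m (?h j)" for j using c by (intro bounded_lipschitz_envelope) auto
  have bnd: "\<bar>?h j x\<bar> \<le> c" if "x \<in> mspace m" for j x using c that by (intro envelope_abs_le) auto
  have "(\<lambda>j. \<integral>\<omega>. ?h j (Y \<omega>) \<partial>P) \<longlonglongrightarrow> (\<integral>\<omega>. h (Y \<omega>) \<partial>P)"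
    using Y_in c bnd
    by (intro integral_dominated_convergence[where w = "\<lambda>_. c"] continuous_Y_meas[OF h c] bounded_lipschitz_Y_meas lip AE_I2 envelope_tendsto[OF h c])
       (auto simp: Pi_iff)
  then have "\<forall>\<^sub>F j in sequentially. (\<integral>\<omega>. ?h j (Y \<omega>) \<partial>P) < (\<integral>\<omega>. h (Y \<omega>) \<partial>P) + e / 4"
    using e by (intro order_tendstoD) auto
  then obtain j where j: "(\<integral>\<omega>. ?h j (Y \<omega>) \<partial>P) < (\<integral>\<omega>. h (Y \<omega>) \<partial>P) + e / 4"
    by (auto simp: eventually_sequentially)
  have "(\<lambda>K. \<integral>\<omega>. ?h j (Ys K \<omega>) \<partial>P) \<longlonglongrightarrow> (\<integral>\<omega>. ?h j (Y \<omega>) \<partial>P)"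
    using Ys_in bnd
    by (intro integral_dominated_convergence[where w = "\<lambda>_. c"] bounded_lipschitz_Y_meas Ys_meas lip AE_I2 bounded_lipschitz_Ys_lim)
       (auto simp: Pi_iff)
  then have K1: "\<forall>\<^sub>F K in sequentially. (\<integral>\<omega>. ?h j (Ys K \<omega>) \<partial>P) < (\<integral>\<omega>. ?h j (Y \<omega>) \<partial>P) + e / 4"
    using e by (intro order_tendstoD) auto
  \<comment> \<open>Makes the Lipschitz error j d and the error 2 c d of the exceptional set
    together at most e / 4; the other three quarters go to the limits in j, K and n.\<close>
  define d where "d = e / 4 / (real j + 2 * c + 1)"
  have d: "0 < d" "(real j + 2 * c + 1) * d = e / 4"
    using e \<open>0 \<le> c\<close> unfolding d_def by (auto simp del: divide_divide_eq_left)
  then have d: "0 < d" "real j * d + 2 * c * d \<le> e / 4"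
    by (auto simp: algebra_simps)
  from eventually_happens[OF eventually_conj[OF K1 approx[OF d(1)]]] obtain K where
    K: "(\<integral>\<omega>. ?h j (Ys K \<omega>) \<partial>P) < (\<integral>\<omega>. ?h j (Y \<omega>) \<partial>P) + e / 4"
    and ev: "\<forall>\<^sub>F n in sequentially. \<exists>B\<in>sets M. measure M B \<le> d \<and> (\<forall>\<omega>\<in>space M - B. mdist m (Z n \<omega>) (X K n \<omega>) \<le> d)"
    by auto
  have ev2: "\<forall>\<^sub>F n in sequentially. (\<integral>\<omega>. ?h j (X K n \<omega>) \<partial>M) < (\<integral>\<omega>. ?h j (Ys K \<omega>) \<partial>P) + e / 4"
    using e by (intro order_tendstoD(2)[OF X_lim[OF lip]]) auto
  show ?thesis
    using ev ev2 Z_in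
  proof eventually_elim
    case (elim n)
    then obtain B where B: "B \<in> sets M" "measure M B \<le> d" "\<And>\<omega>. \<omega> \<in> space M - B \<Longrightarrow> mdist m (Z n \<omega>) (X K n \<omega>) \<le> d"
      by blast
    define u where "u \<omega> = ?h j (X K n \<omega>) + real j * d + 2 * c * indicator B \<omega>" for \<omega>
    have i1: "integrable M (\<lambda>\<omega>. ?h j (X K n \<omega>))"
      using X_in bnd by (intro M.integrable_const_bound[where B = c] X_meas lip AE_I2) (auto simp: Pi_iff)
    have i2: "integrable M (\<lambda>\<omega>. 2 * c * indicator B \<omega>)"
      using B(1) by (intro integrable_mult_right) (auto simp: M.emeasure_eq_measure)
    have "integrable M u" unfolding u_def[abs_def] using i1 i2 by (intro Bochner_Integration.integrable_add) auto
    moreover have "h (Z n \<omega>) \<le> u \<omega>" if \<omega>: "\<omega> \<in> space M" for \<omega>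
    proof -
      have in': "Z n \<omega> \<in> mspace m" "X K n \<omega> \<in> mspace m" using elim(3) X_in \<omega> by (auto simp: Pi_iff)
      show ?thesis
      proof (cases "\<omega> \<in> B")
        case True
        have "0 \<le> real j * d" using d(1) by simp
        then show ?thesis using True c[OF in'(1)] bnd[OF in'(2), of j] by (simp add: u_def)
      next
        case False
        have "h (Z n \<omega>) \<le> ?h j (Z n \<omega>)" using c in' by (intro envelope_ge) auto
        also have "\<dots> \<le> ?h j (X K n \<omega>) + real j * mdist m (Z n \<omega>) (X K n \<omega>)"
          using c in' by (intro envelope_lipschitz) auto
        also have "real j * mdist m (Z n \<omega>) (X K n \<omega>) \<le> real j * d"
          using B(3) \<omega> False by (intro mult_left_mono) auto
        finally show ?thesis using False by (simp add: u_def)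
      qed
    qed
    moreover have "(\<integral>\<omega>. u \<omega> \<partial>M) < (\<integral>\<omega>. h (Y \<omega>) \<partial>P) + e"
    proof -
      have "(\<integral>\<omega>. u \<omega> \<partial>M) = (\<integral>\<omega>. ?h j (X K n \<omega>) \<partial>M) + real j * d + 2 * c * measure M B"
        unfolding u_def using i1 i2 B(1) by (simp add: M.prob_space)
      also have "2 * c * measure M B \<le> 2 * c * d" using \<open>0 \<le> c\<close> B(2) by (intro mult_left_mono) auto
      finally show ?thesis using d(2) j K elim(2) e by linarith
    qed
    ultimately show ?case by blast
  qed
qed

theorem converges:
  assumes "separably_valued P m Y"
  shows "converges_outer_distribution m (\<lambda>_. M) Z P Y"
  unfolding converges_outer_distribution_def
proof (intro conjI allI impI Z_in assms Y_borel_measurable_on_range)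
  fix h assume "continuous_map (mtopology_of m) euclideanreal h \<and> bounded (h ` mspace m)"
  then obtain c where h: "continuous_map (mtopology_of m) euclideanreal h" and c: "\<And>x. x \<in> mspace m \<Longrightarrow> \<bar>h x\<bar> \<le> c"
    by (auto simp: bounded_iff)
  \<comment> \<open>The negative of a majorant for \<open>- h\<close> is an integrable minorant for
    \<open>h\<close>, so the lower bound follows from the upper one.\<close>
  have h': "continuous_map (mtopology_of m) euclideanreal (\<lambda>x. - h x)" using h by (rule continuous_map_minus)
  note up = eventually_upper[where c = c]
  have "\<forall>\<^sub>F n in sequentially. outer_expectation M (\<lambda>\<omega>. h (Z n \<omega>)) < ereal a" if "ereal (\<integral>\<omega>. h (Y \<omega>) \<partial>P) < ereal a" for a
  proof (rule eventually_mono[OF up[OF h, of "a - (\<integral>\<omega>. h (Y \<omega>) \<partial>P)"]], goal_cases)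
    case (3 n)
    then obtain u where u: "integrable M u" "\<forall>\<omega>\<in>space M. h (Z n \<omega>) \<le> u \<omega>" "(\<integral>\<omega>. u \<omega> \<partial>M) < a" by auto
    have "outer_expectation M (\<lambda>\<omega>. h (Z n \<omega>)) \<le> ereal (\<integral>\<omega>. u \<omega> \<partial>M)"
      using u by (intro outer_expectation_le) auto
    also have "\<dots> < ereal a" using u by simp
    finally show ?case .
  qed (use that c in auto)
  moreover have "\<forall>\<^sub>F n in sequentially. ereal a < outer_expectation M (\<lambda>\<omega>. h (Z n \<omega>))" if "ereal a < ereal (\<integral>\<omega>. h (Y \<omega>) \<partial>P)" for a
  proof (rule eventually_mono[OF up[OF h', of "(\<integral>\<omega>. h (Y \<omega>) \<partial>P) - a"]], goal_cases)
    case (3 n)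
    then obtain u where u: "integrable M u" "\<forall>\<omega>\<in>space M. - h (Z n \<omega>) \<le> u \<omega>" "(\<integral>\<omega>. u \<omega> \<partial>M) < - a" by auto
    have "ereal a < ereal (\<integral>\<omega>. - u \<omega> \<partial>M)" using u by simp
    also have "\<dots> \<le> outer_expectation M (\<lambda>\<omega>. h (Z n \<omega>))"
      using u by (intro outer_expectation_ge) (auto simp: minus_le_iff)
    finally show ?case .
  qed (use that c in auto)
  ultimately show "(\<lambda>n. outer_expectation M (\<lambda>\<omega>. h (Z n \<omega>))) \<longlonglongrightarrow> ereal (\<integral>\<omega>. h (Y \<omega>) \<partial>P)"
  proof (intro order_tendstoI, goal_cases)
    case (1 a)
    show ?case
    proof (cases a)
      case MInf
      then show ?thesis using 1(2)[of "(\<integral>\<omega>. h (Y \<omega>) \<partial>P) - 1"] by (auto elim: eventually_mono)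
    qed (use 1 in auto)
  next
    case (2 a)
    show ?case
    proof (cases a)
      case PInf
      then show ?thesis using 2(1)[of "(\<integral>\<omega>. h (Y \<omega>) \<partial>P) + 1"] by (auto elim: eventually_mono)
    qed (use 2 in auto)
  qed
qed

end

section \<open>The central limit theorem for block sums\<close>

text \<open>Asking the bound for all sequences x and y makes \<open>g\<close> blind to the
  coordinates from L on, so no convention for vectors of length L is required.\<close>

definition l1_lipschitz :: "nat \<Rightarrow> ((nat \<Rightarrow> real) \<Rightarrow> real) \<Rightarrow> bool" where
  "l1_lipschitz L g \<longleftrightarrow> (\<exists>c. \<forall>x y. \<bar>g x - g y\<bar> \<le> c * (\<Sum>b<L. \<bar>x b - y b\<bar>))"

lemma l1_lipschitz_cong: "l1_lipschitz L g \<Longrightarrow> (\<And>b. b < L \<Longrightarrow> x b = y b) \<Longrightarrow> g x = g y"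
proof -
  assume "l1_lipschitz L g" and eq: "\<And>b. b < L \<Longrightarrow> x b = y b"
  then obtain c where "\<bar>g x - g y\<bar> \<le> c * (\<Sum>b<L. \<bar>x b - y b\<bar>)" unfolding l1_lipschitz_def by blast
  also have "(\<Sum>b<L. \<bar>x b - y b\<bar>) = 0" using eq by (intro sum.neutral) auto
  finally show ?thesis by simp
qed

lemma l1_lipschitz_tendsto:
  assumes "l1_lipschitz L g" "\<And>b. b < L \<Longrightarrow> ((\<lambda>n. x n b) \<longlongrightarrow> y b) F"
  shows "((\<lambda>n. g (x n)) \<longlongrightarrow> g y) F"
proof -
  obtain c where c: "\<And>x y. \<bar>g x - g y\<bar> \<le> c * (\<Sum>b<L. \<bar>x b - y b\<bar>)"
    using assms(1) by (auto simp: l1_lipschitz_def)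
  have "((\<lambda>n. c * (\<Sum>b<L. \<bar>x n b - y b\<bar>)) \<longlongrightarrow> c * (\<Sum>b<L. \<bar>y b - y b\<bar>)) F"
    using assms(2) by (intro tendsto_intros) auto
  then have "((\<lambda>n. c * (\<Sum>b<L. \<bar>x n b - y b\<bar>)) \<longlongrightarrow> 0) F" by simp
  then have "((\<lambda>n. g (x n) - g y) \<longlongrightarrow> 0) F"
    by (rule Lim_null_comparison[rotated]) (use c in auto)
  then show ?thesis using LIM_zero_iff by blast
qed

lemma l1_lipschitz_scale:
  fixes a :: "nat \<Rightarrow> real"
  assumes "l1_lipschitz L g" shows "l1_lipschitz L (\<lambda>x. g (\<lambda>b. a b * x b))"
proof -
  obtain c where c: "\<And>x y. \<bar>g x - g y\<bar> \<le> c * (\<Sum>b<L. \<bar>x b - y b\<bar>)" using assms by (auto simp: l1_lipschitz_def)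
  define A where "A = (\<Sum>b<L. \<bar>a b\<bar>)"
  have "\<bar>g (\<lambda>b. a b * x b) - g (\<lambda>b. a b * y b)\<bar> \<le> (\<bar>c\<bar> * A) * (\<Sum>b<L. \<bar>x b - y b\<bar>)" for x y
  proof -
    have "(\<Sum>b<L. \<bar>a b * x b - a b * y b\<bar>) \<le> (\<Sum>b<L. A * \<bar>x b - y b\<bar>)"
    proof (intro sum_mono)
      fix b assume "b \<in> {..<L}"
      then have "\<bar>a b\<bar> \<le> A" unfolding A_def by (intro member_le_sum) auto
      then have "\<bar>a b\<bar> * \<bar>x b - y b\<bar> \<le> A * \<bar>x b - y b\<bar>" by (rule mult_right_mono) simp
      then show "\<bar>a b * x b - a b * y b\<bar> \<le> A * \<bar>x b - y b\<bar>" by (simp add: abs_mult flip: right_diff_distrib)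
    qed
    then have "\<bar>c\<bar> * (\<Sum>b<L. \<bar>a b * x b - a b * y b\<bar>) \<le> \<bar>c\<bar> * (A * (\<Sum>b<L. \<bar>x b - y b\<bar>))"
      by (intro mult_left_mono) (auto simp: sum_distrib_left)
    moreover have "c * (\<Sum>b<L. \<bar>a b * x b - a b * y b\<bar>) \<le> \<bar>c\<bar> * (\<Sum>b<L. \<bar>a b * x b - a b * y b\<bar>)"
      by (intro mult_right_mono sum_nonneg) auto
    ultimately show ?thesis using c[of "\<lambda>b. a b * x b" "\<lambda>b. a b * y b"] by (simp add: mult.assoc)
  qed
  then show ?thesis unfolding l1_lipschitz_def by blast
qed

lemma l1_lipschitz_measurable:
  assumes "l1_lipschitz L g" shows "g \<in> borel_measurable (PiM UNIV (\<lambda>_. borel))"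
proof -
  have "continuous_on UNIV g"
    unfolding continuous_on_eq_continuous_at[OF open_UNIV] isCont_def
  proof
    fix x :: "nat \<Rightarrow> real"
    have "continuous_on UNIV (\<lambda>y :: nat \<Rightarrow> real. y b)" for b by (rule continuous_on_product_coordinates)
    then have "((\<lambda>y. y b) \<longlongrightarrow> x b) (at x)" for b by (simp add: continuous_on_def)
    then show "g \<midarrow>x\<rightarrow> g x" by (intro l1_lipschitz_tendsto[OF assms])
  qed
  then have "g \<in> borel_measurable borel" by (rule borel_measurable_continuous_onI)
  then show ?thesis
    by (subst measurable_cong_sets[OF sets_PiM_equal_borel refl])
qed

lemma l1_lipschitz_compose_measurable:
  assumes "l1_lipschitz L g" "\<And>b. V b \<in> borel_measurable M"
  shows "(\<lambda>\<omega>. g (\<lambda>b. V b \<omega>)) \<in> borel_measurable M"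
proof -
  have "(\<lambda>\<omega> b. V b \<omega>) \<in> measurable M (PiM UNIV (\<lambda>_. borel))"
    by (intro measurable_PiM_single') (use assms(2) in auto)
  from measurable_compose[OF this l1_lipschitz_measurable[OF assms(1)]] show ?thesis .
qed

section \<open>Independent vectors as product measures\<close>

lemma measurable_PiM_component:
  "i \<in> I \<Longrightarrow> V \<in> measurable (\<Omega> i) N \<Longrightarrow> (\<lambda>\<omega>. V (\<omega> i)) \<in> measurable (PiM I \<Omega>) N"
  by (rule measurable_compose[OF measurable_component_singleton])

lemma distr_PiM_components:
  fixes \<Omega> :: "'i \<Rightarrow> 'b measure"
  assumes "finite I" "\<And>i. prob_space (\<Omega> i)" and V: "\<And>i. V i \<in> measurable (\<Omega> i) (N i)"
  shows "distr (PiM I \<Omega>) (PiM I N) (\<lambda>\<omega>. \<lambda>i\<in>I. V i (\<omega> i)) = PiM I (\<lambda>i. distr (\<Omega> i) (N i) (V i))"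
proof -
  interpret A: product_prob_space \<Omega> I by (rule product_prob_spaceI) fact
  interpret B: product_prob_space "\<lambda>i. distr (\<Omega> i) (N i) (V i)" I
    by (rule product_prob_spaceI) (rule prob_space.prob_space_distr[OF assms(2) V])
  have meas: "(\<lambda>\<omega>. \<lambda>i\<in>I. V i (\<omega> i)) \<in> measurable (PiM I \<Omega>) (PiM I N)"
  proof (rule measurable_restrict)
    show "(\<lambda>\<omega>. V i (\<omega> i)) \<in> measurable (PiM I \<Omega>) (N i)" if "i \<in> I" for i
      using that V by (rule measurable_PiM_component)
  qed
  show ?thesis
  proof (rule B.PiM_eqI[OF assms(1)])
    show "sets (distr (PiM I \<Omega>) (PiM I N) (\<lambda>\<omega>. \<lambda>i\<in>I. V i (\<omega> i))) = sets (PiM I (\<lambda>i. distr (\<Omega> i) (N i) (V i)))"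
      by (simp cong: sets_PiM_cong)
    fix A assume A: "\<And>i. i \<in> I \<Longrightarrow> A i \<in> sets (distr (\<Omega> i) (N i) (V i))"
    have "emeasure (distr (PiM I \<Omega>) (PiM I N) (\<lambda>\<omega>. \<lambda>i\<in>I. V i (\<omega> i))) (Pi\<^sub>E I A)
       = emeasure (PiM I \<Omega>) ((\<lambda>\<omega>. \<lambda>i\<in>I. V i (\<omega> i)) -` (Pi\<^sub>E I A) \<inter> space (PiM I \<Omega>))"
      using A assms(1) meas by (intro emeasure_distr sets_PiM_I_finite) auto
    also have "(\<lambda>\<omega>. \<lambda>i\<in>I. V i (\<omega> i)) -` (Pi\<^sub>E I A) \<inter> space (PiM I \<Omega>) = Pi\<^sub>E I (\<lambda>i. V i -` A i \<inter> space (\<Omega> i))"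
      by (auto simp: space_PiM PiE_iff)
    also have "emeasure (PiM I \<Omega>) \<dots> = (\<Prod>i\<in>I. emeasure (\<Omega> i) (V i -` A i \<inter> space (\<Omega> i)))"
      using A V assms(1) by (intro A.emeasure_PiM) (auto intro: measurable_sets)
    also have "\<dots> = (\<Prod>i\<in>I. emeasure (distr (\<Omega> i) (N i) (V i)) (A i))"
      using A V by (intro prod.cong refl emeasure_distr[symmetric]) auto
    finally show "emeasure (distr (PiM I \<Omega>) (PiM I N) (\<lambda>\<omega>. \<lambda>i\<in>I. V i (\<omega> i))) (Pi\<^sub>E I A) = (\<Prod>i\<in>I. emeasure (distr (\<Omega> i) (N i) (V i)) (A i))" .
  qed
qed

lemma l1_lipschitz_extend_measurable:
  assumes "l1_lipschitz L g"
  shows "g \<in> borel_measurable (PiM {..<L} (\<lambda>_. borel))"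
proof -
  have "(\<lambda>x. \<lambda>b. if b < L then x b else 0) \<in> measurable (PiM {..<L} (\<lambda>_. borel)) (PiM UNIV (\<lambda>_. borel :: real measure))"
  proof (rule measurable_PiM_single')
    show "(\<lambda>x. if b < L then x b else 0) \<in> borel_measurable (PiM {..<L} (\<lambda>_. borel :: real measure))" for b
      by (cases "b < L") auto
  qed auto
  from measurable_compose[OF this l1_lipschitz_measurable[OF assms]]
  have "(\<lambda>x. g (\<lambda>b. if b < L then x b else 0)) \<in> borel_measurable (PiM {..<L} (\<lambda>_. borel))" .
  moreover have "g (\<lambda>b. if b < L then x b else 0) = g x" for x
    by (intro l1_lipschitz_cong[OF assms]) auto
  ultimately show ?thesis by simp
qed

text \<open>Under independence both vectors have the product of their marginals as law. This allows
  block sums to be replaced by copies on another space that converge pointwise.\<close>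

lemma integral_indep_eq:
  fixes V :: "nat \<Rightarrow> 'a \<Rightarrow> real" and V' :: "nat \<Rightarrow> 'b \<Rightarrow> real"
  assumes M: "prob_space M" "prob_space.indep_vars M (\<lambda>_. borel) V {..<L}"
    and N: "prob_space N" "prob_space.indep_vars N (\<lambda>_. borel) V' {..<L}"
    and eq: "\<And>b. b < L \<Longrightarrow> distr M borel (V b) = distr N borel (V' b)" and "0 < L" and g: "l1_lipschitz L g"
  shows "(\<integral>\<omega>. g (\<lambda>b. V b \<omega>) \<partial>M) = (\<integral>\<omega>. g (\<lambda>b. V' b \<omega>) \<partial>N)"
proof -
  have repr: "(\<integral>\<omega>. g (\<lambda>b. W b \<omega>) \<partial>Q) = (\<integral>x. g x \<partial>PiM {..<L} (\<lambda>b. distr Q borel (W b)))"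
    if Q: "prob_space Q" "prob_space.indep_vars Q (\<lambda>_. borel) W {..<L}" for Q :: "'c measure" and W
  proof -
    interpret prob_space Q by fact
    have W: "W b \<in> borel_measurable Q" if "b < L" for b using Q(2) that by (auto simp: indep_vars_def)
    have "(\<integral>\<omega>. g (\<lambda>b. W b \<omega>) \<partial>Q) = (\<integral>\<omega>. g (\<lambda>b\<in>{..<L}. W b \<omega>) \<partial>Q)"
      by (intro Bochner_Integration.integral_cong refl l1_lipschitz_cong[OF g]) auto
    also have "\<dots> = (\<integral>x. g x \<partial>distr Q (PiM {..<L} (\<lambda>_. borel)) (\<lambda>\<omega>. \<lambda>b\<in>{..<L}. W b \<omega>))"
      using W by (intro integral_distr[symmetric] measurable_restrict l1_lipschitz_extend_measurable[OF g]) auto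
    also have "distr Q (PiM {..<L} (\<lambda>_. borel)) (\<lambda>\<omega>. \<lambda>b\<in>{..<L}. W b \<omega>) = PiM {..<L} (\<lambda>b. distr Q borel (W b))"
      using W Q(2) \<open>0 < L\<close> by (subst indep_vars_iff_distr_eq_PiM'[symmetric]) auto
    finally show ?thesis .
  qed
  have "PiM {..<L} (\<lambda>b. distr M borel (V b)) = PiM {..<L} (\<lambda>b. distr N borel (V' b))"
    using eq by (intro PiM_cong) auto
  then show ?thesis by (simp add: repr[OF M] repr[OF N])
qed

lemma block_length_bounds:
  assumes "0 < L"
  shows "\<bar>real (block_start n L (Suc b) - block_start n L b) - real n / L\<bar> \<le> 1"
proof -
  have *: "real (c * n) / L - 1 < real (block_start n L c)" "real (block_start n L c) \<le> real (c * n) / L" for c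
  proof -
    have "real (c * n) = real (block_start n L c) * L + real (c * n mod L)"
      unfolding block_start_def by (metis div_mult_mod_eq of_nat_add of_nat_mult)
    moreover have "real (c * n mod L) < L" using assms by simp
    ultimately show "real (c * n) / L - 1 < real (block_start n L c)" "real (block_start n L c) \<le> real (c * n) / L"
      using assms by (simp_all add: field_simps)
  qed
  have "block_start n L b \<le> block_start n L (Suc b)" by (simp add: block_start_def div_le_mono)
  moreover have "real (Suc b * n) / L = real (b * n) / L + real n / L" by (simp add: add_divide_distrib)
  ultimately show ?thesis using *[of b] *[of "Suc b"] by (simp add: of_nat_diff abs_le_iff)
qed

lemma block_length_limits:
  assumes "0 < L"
  shows "filterlim (\<lambda>n. block_start n L (Suc b) - block_start n L b) at_top sequentially"
    and "(\<lambda>n. real (block_start n L (Suc b) - block_start n L b) / n) \<longlonglongrightarrow> 1 / L"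
proof -
  define k where "k n = block_start n L (Suc b) - block_start n L b" for n
  have k: "\<bar>real (k n) - real n / L\<bar> \<le> 1" for n using block_length_bounds[OF assms] by (simp add: k_def)
  have "filterlim (\<lambda>n. real n / L - 1) at_top sequentially" using assms by real_asymp
  then have "filterlim (\<lambda>n. real (k n)) at_top sequentially"
    by (rule filterlim_at_top_mono) (use k in \<open>auto intro!: always_eventually simp: abs_le_iff\<close>, smt (verit) k)
  then show "filterlim (\<lambda>n. block_start n L (Suc b) - block_start n L b) at_top sequentially"
    using filterlim_sequentially_iff_filterlim_real k_def[abs_def] by auto
  have "(\<lambda>n. real (k n) / n - 1 / L) \<longlonglongrightarrow> 0"
  proof (rule Lim_null_comparison)
    have "norm (real (k n) / n - 1 / L) \<le> 1 / n" if "0 < n" for n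
    proof -
      have "real (k n) / n - 1 / L = (real (k n) - real n / L) / n" using that assms by (simp add: field_simps)
      then show ?thesis using k[of n] that by (simp add: divide_right_mono)
    qed
    then show "\<forall>\<^sub>F n in sequentially. norm (real (k n) / n - 1 / L) \<le> 1 / n"
      by (rule eventually_mono[OF eventually_gt_at_top[of 0]])
    show "(\<lambda>n. 1 / real n) \<longlonglongrightarrow> 0" by (rule lim_1_over_n)
  qed
  then show "(\<lambda>n. real (block_start n L (Suc b) - block_start n L b) / n) \<longlonglongrightarrow> 1 / L"
    unfolding k_def[symmetric] using LIM_zero_iff by blast
qed

lemma (in prob_space) distr_iid_sum_shift:
  fixes X :: "nat \<Rightarrow> 'a \<Rightarrow> real"
  assumes X: "indep_vars (\<lambda>_. borel) X UNIV" and eq: "\<And>i j. distr M borel (X i) = distr M borel (X j)"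
  shows "distr M borel (\<lambda>\<omega>. \<Sum>i=a..<a + k. X i \<omega>) = distr M borel (\<lambda>\<omega>. \<Sum>i<k. X i \<omega>)"
proof (cases "k = 0")
  case False
  have Xm: "X i \<in> borel_measurable M" for i using X by (auto simp: indep_vars_def)
  have *: "distr M borel (\<lambda>\<omega>. \<Sum>i<k. X (a + i) \<omega>) = distr (PiM {..<k} (\<lambda>_. distr M borel (X 0))) borel (\<lambda>x. sum x {..<k})" for a
  proof -
    have "indep_vars (\<lambda>_. borel) (\<lambda>i \<omega>. \<Sum>j\<in>{a + i}. X j \<omega>) {..<k}"
      by (intro indep_vars_group_sums[OF X]) (auto simp: disjoint_family_on_def)
    then have ind: "indep_vars (\<lambda>_. borel) (\<lambda>i. X (a + i)) {..<k}" by simp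
    have "PiM {..<k} (\<lambda>i. distr M borel (X (a + i))) = distr M (PiM {..<k} (\<lambda>_. borel)) (\<lambda>\<omega>. \<lambda>i\<in>{..<k}. X (a + i) \<omega>)"
      by (intro indep_vars_iff_distr_eq_PiM'[THEN iffD1, symmetric] ind) (use False Xm in auto)
    also have "distr \<dots> borel (\<lambda>x. sum x {..<k}) = distr M borel (\<lambda>\<omega>. \<Sum>i<k. X (a + i) \<omega>)"
      using Xm by (subst distr_distr) (auto intro!: measurable_restrict measurable_sum_PiM simp: comp_def)
    finally show ?thesis
      using PiM_cong[of "{..<k}" "{..<k}" "\<lambda>i. distr M borel (X (a + i))" "\<lambda>_. distr M borel (X 0)"] eq by metis
  qed
  have "(\<Sum>i=a..<a + k. X i \<omega>) = (\<Sum>i<k. X (a + i) \<omega>)" for \<omega>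
    by (rule sum.reindex_bij_witness[of _ "\<lambda>i. a + i" "\<lambda>j. j - a"]) auto
  then show ?thesis using *[of a] *[of 0] by simp
qed simp

text \<open>The one-dimensional central limit theorem is applied to each block, and Skorohod's
  representation turns it into pointwise convergence on a space of its own. On the product of these
  spaces the copies are independent again, so the expectations agree and dominated convergence
  applies.\<close>

theorem (in prob_space) block_clt:
  fixes X :: "nat \<Rightarrow> 'a \<Rightarrow> real" and N :: "nat \<Rightarrow> 'b \<Rightarrow> real"
  assumes X: "indep_vars (\<lambda>_. borel) X UNIV" and eq: "\<And>i j. distr M borel (X i) = distr M borel (X j)"
    and mean: "\<And>i. expectation (X i) = 0" and sq: "\<And>i. integrable M (\<lambda>\<omega>. (X i \<omega>)\<^sup>2)" "\<And>i. expectation (\<lambda>\<omega>. (X i \<omega>)\<^sup>2) = \<sigma>\<^sup>2"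
    and \<sigma>: "0 < \<sigma>" and L: "0 < L"
    and P: "prob_space P" "prob_space.indep_vars P (\<lambda>_. borel) N {..<L}" "\<And>b. b < L \<Longrightarrow> distr P borel (N b) = std_normal_distribution"
    and g: "l1_lipschitz L g" "\<And>x. \<bar>g x\<bar> \<le> c"
  shows "(\<lambda>n. expectation (\<lambda>\<omega>. g (\<lambda>b. (\<Sum>i=block_start n L b..<block_start n L (Suc b). X i \<omega>) / sqrt n)))
    \<longlonglongrightarrow> (\<integral>\<omega>. g (\<lambda>b. \<sigma> / sqrt L * N b \<omega>) \<partial>P)"
proof -
  have Xm[measurable]: "X i \<in> borel_measurable M" for i using X by (auto simp: indep_vars_def)
  define k where "k n b = block_start n L (Suc b) - block_start n L b" for n b
  define S where "S n b \<omega> = (\<Sum>i=block_start n L b..<block_start n L (Suc b). X i \<omega>)" for n b \<omega>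
  define U where "U n b \<omega> = S n b \<omega> / sqrt (k n b * \<sigma>\<^sup>2)" for n b \<omega>
  define s where "s n b = sqrt (k n b / n) * \<sigma>" for n b
  define \<nu> where "\<nu> j = distr M borel (\<lambda>\<omega>. (\<Sum>i<j. X i \<omega>) / sqrt (real j * \<sigma>\<^sup>2))" for j :: nat
  have bs: "block_start n L (Suc b) = block_start n L b + k n b" for n b
    unfolding k_def by (simp add: block_start_def div_le_mono)
  have Sm[measurable]: "S n b \<in> borel_measurable M" for n b unfolding S_def[abs_def] by measurable
  have Um[measurable]: "U n b \<in> borel_measurable M" for n b unfolding U_def[abs_def] by measurable
  \<comment> \<open>The empty block is consistent: its sum and its scale \<open>s n b\<close> are
    both 0.\<close>
  have sU: "S n b \<omega> / sqrt n = s n b * U n b \<omega>" for n b \<omega>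
  proof (cases "k n b = 0")
    case True
    then show ?thesis using bs[of n b] by (simp add: S_def s_def)
  next
    case False
    then show ?thesis using \<sigma> by (simp add: s_def U_def real_sqrt_mult real_sqrt_divide)
  qed
  have lawU: "distr M borel (U n b) = \<nu> (k n b)" for n b
  proof -
    have "distr M borel (U n b) = distr (distr M borel (S n b)) borel (\<lambda>x. x / sqrt (k n b * \<sigma>\<^sup>2))"
      by (subst distr_distr) (auto simp: comp_def U_def[abs_def])
    also have "distr M borel (S n b) = distr M borel (\<lambda>\<omega>. \<Sum>i<k n b. X i \<omega>)"
      unfolding S_def[abs_def] bs by (rule distr_iid_sum_shift[OF X eq])
    finally show ?thesis by (subst (asm) distr_distr) (auto simp: comp_def \<nu>_def)
  qed
  have clt: "weak_conv_m \<nu> std_normal_distribution"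
    unfolding \<nu>_def[abs_def] using mean sq \<sigma> eq
    by (intro central_limit_theorem_zero_mean[OF X, where \<mu> = "distr M borel (X 0)"]) auto
  have rd: "real_distribution (\<nu> j)" for j
    unfolding \<nu>_def by (intro real_distribution_distr) measurable
  let ?R = "\<lambda>b (\<Omega> :: real measure) (Yn :: nat \<Rightarrow> real \<Rightarrow> real) (Y :: real \<Rightarrow> real).
    prob_space \<Omega> \<and> (\<forall>n. Yn n \<in> measurable \<Omega> borel) \<and> (\<forall>n. distr \<Omega> borel (Yn n) = \<nu> (k n b)) \<and>
    Y \<in> measurable \<Omega> lborel \<and> distr \<Omega> borel Y = std_normal_distribution \<and> (\<forall>x \<in> space \<Omega>. (\<lambda>n. Yn n x) \<longlonglongrightarrow> Y x)"
  have "\<forall>b. \<exists>\<Omega> Yn Y. ?R b \<Omega> Yn Y"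
  proof
    fix b
    \<comment> \<open>The length of block b tends to infinity with n, so the central limit theorem
      may be read along \<open>k n b\<close>.\<close>
    have "weak_conv_m (\<lambda>n. \<nu> (k n b)) std_normal_distribution"
      using clt filterlim_compose[OF _ block_length_limits(1)[OF L, of b]]
      unfolding weak_conv_m_def weak_conv_def k_def by blast
    then show "\<exists>\<Omega> Yn Y. ?R b \<Omega> Yn Y" by (rule Skorohod[OF rd real_dist_normal_dist])
  qed
  from choice[OF this] obtain \<Omega> where "\<forall>b. \<exists>Yn Y. ?R b (\<Omega> b) Yn Y" by blast
  from choice[OF this] obtain Yn where "\<forall>b. \<exists>Y. ?R b (\<Omega> b) (Yn b) Y" by blast
  from choice[OF this] obtain Y :: "nat \<Rightarrow> real \<Rightarrow> real" where
    \<Omega>: "\<And>b. prob_space (\<Omega> b)" and Yn[measurable]: "\<And>b n. Yn b n \<in> measurable (\<Omega> b) borel"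
    and Ynd: "\<And>b n. distr (\<Omega> b) borel (Yn b n) = \<nu> (k n b)"
    and Y: "\<And>b. Y b \<in> measurable (\<Omega> b) lborel" and Yd: "\<And>b. distr (\<Omega> b) borel (Y b) = std_normal_distribution"
    and lim: "\<And>b x. x \<in> space (\<Omega> b) \<Longrightarrow> (\<lambda>n. Yn b n x) \<longlonglongrightarrow> Y b x"
    by blast
  have Ym[measurable]: "Y b \<in> measurable (\<Omega> b) borel" for b using Y[of b] by simp
  define Q where "Q = PiM {..<L} \<Omega>"
  have Q: "prob_space Q" unfolding Q_def using \<Omega> by (intro prob_space_PiM) auto
  interpret Q: prob_space Q by fact
  have indQ: "Q.indep_vars (\<lambda>_. borel) (\<lambda>b \<omega>. V b (\<omega> b)) {..<L}" and lawQ: "\<And>b. b < L \<Longrightarrow> distr Q borel (\<lambda>\<omega>. V b (\<omega> b)) = distr (\<Omega> b) borel (V b)"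
    if V: "\<And>b. V b \<in> borel_measurable (\<Omega> b)" for V :: "nat \<Rightarrow> real \<Rightarrow> real"
  proof -
    have m: "(\<lambda>\<omega>. V b (\<omega> b)) \<in> borel_measurable Q" if "b < L" for b
      unfolding Q_def using that V by (intro measurable_PiM_component) simp_all
    show law: "distr Q borel (\<lambda>\<omega>. V b (\<omega> b)) = distr (\<Omega> b) borel (V b)" if "b < L" for b
    proof -
      have "distr (\<Omega> b) borel (V b) = distr (distr Q (\<Omega> b) (\<lambda>\<omega>. \<omega> b)) borel (V b)"
        unfolding Q_def using \<Omega> that by (subst distr_PiM_component) auto
      also have "\<dots> = distr Q borel (\<lambda>\<omega>. V b (\<omega> b))"
        using V that unfolding Q_def by (subst distr_distr) (auto simp: comp_def)
      finally show ?thesis ..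
    qed
    show "Q.indep_vars (\<lambda>_. borel) (\<lambda>b \<omega>. V b (\<omega> b)) {..<L}"
    proof (subst Q.indep_vars_iff_distr_eq_PiM')
      have "distr Q (PiM {..<L} (\<lambda>_. borel)) (\<lambda>\<omega>. \<lambda>b\<in>{..<L}. V b (\<omega> b)) = PiM {..<L} (\<lambda>b. distr (\<Omega> b) borel (V b))"
        unfolding Q_def by (rule distr_PiM_components[OF finite_lessThan \<Omega> V])
      also have "\<dots> = PiM {..<L} (\<lambda>b. distr Q borel (\<lambda>\<omega>. V b (\<omega> b)))"
        using law by (intro PiM_cong) auto
      finally show "distr Q (PiM {..<L} (\<lambda>_. borel)) (\<lambda>\<omega>. \<lambda>b\<in>{..<L}. V b (\<omega> b)) = PiM {..<L} (\<lambda>b. distr Q borel (\<lambda>\<omega>. V b (\<omega> b)))" .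
    qed (use L m in auto)
  qed
  note sl1 = l1_lipschitz_scale[OF g(1)]
  have indU: "indep_vars (\<lambda>_. borel) (U n) {..<L}" for n
  proof -
    have "disjoint_family_on (\<lambda>b. {block_start n L b..<block_start n L (Suc b)}) {..<L}"
      unfolding disjoint_family_on_def
    proof safe
      fix a b i assume *: "a \<noteq> b" "i \<in> {block_start n L a..<block_start n L (Suc a)}" "i \<in> {block_start n L b..<block_start n L (Suc b)}"
      have mono: "block_start n L (Suc a) \<le> block_start n L b" if "a < b" for a b
        unfolding block_start_def using that by (intro div_le_mono mult_right_mono) auto
      show "i \<in> {}" using * mono[of a b] mono[of b a] by (cases a b rule: linorder_cases) auto
    qed
    then have "indep_vars (\<lambda>_. borel) (S n) {..<L}"
      unfolding S_def[abs_def] by (intro indep_vars_group_sums[OF X]) auto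
    from indep_vars_compose2[OF this, where Y = "\<lambda>b x. x / sqrt (k n b * \<sigma>\<^sup>2)"]
    show ?thesis unfolding U_def[abs_def] by simp
  qed
  have step: "expectation (\<lambda>\<omega>. g (\<lambda>b. S n b \<omega> / sqrt n)) = (\<integral>\<omega>. g (\<lambda>b. s n b * Yn b n (\<omega> b)) \<partial>Q)" for n
    unfolding sU using lawU Ynd lawQ[of "\<lambda>b. Yn b n"]
    by (intro integral_indep_eq[OF prob_space_axioms indU Q indQ _ L sl1]) auto
  have "(\<lambda>n. \<integral>\<omega>. g (\<lambda>b. s n b * Yn b n (\<omega> b)) \<partial>Q) \<longlonglongrightarrow> (\<integral>\<omega>. g (\<lambda>b. \<sigma> / sqrt L * Y b (\<omega> b)) \<partial>Q)"
  proof (rule integral_dominated_convergence[where w = "\<lambda>_. c"])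
    have meas: "(\<lambda>\<omega>. g (\<lambda>b. a b * V b (\<omega> b))) \<in> borel_measurable Q" if V: "\<And>b. V b \<in> borel_measurable (\<Omega> b)" for a V
    proof -
      have "(\<lambda>\<omega>. \<lambda>b\<in>{..<L}. V b (\<omega> b)) \<in> measurable Q (PiM {..<L} (\<lambda>_. borel))"
        unfolding Q_def
      proof (rule measurable_restrict)
        show "(\<lambda>\<omega>. V b (\<omega> b)) \<in> borel_measurable (PiM {..<L} \<Omega>)" if "b \<in> {..<L}" for b
          using that V by (rule measurable_PiM_component)
      qed
      from measurable_compose[OF this l1_lipschitz_extend_measurable[OF sl1[of a]]]
      have "(\<lambda>\<omega>. g (\<lambda>b. a b * (\<lambda>b\<in>{..<L}. V b (\<omega> b)) b)) \<in> borel_measurable Q" .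
      moreover have "g (\<lambda>b. a b * (\<lambda>b\<in>{..<L}. V b (\<omega> b)) b) = g (\<lambda>b. a b * V b (\<omega> b))" for \<omega>
        by (intro l1_lipschitz_cong[OF g(1)]) auto
      ultimately show ?thesis by simp
    qed
    show "(\<lambda>\<omega>. g (\<lambda>b. \<sigma> / sqrt L * Y b (\<omega> b))) \<in> borel_measurable Q" by (rule meas) measurable
    show "(\<lambda>\<omega>. g (\<lambda>b. s n b * Yn b n (\<omega> b))) \<in> borel_measurable Q" for n by (rule meas) measurable
    have s: "(\<lambda>n. s n b) \<longlonglongrightarrow> \<sigma> / sqrt L" for b
    proof -
      have "(\<lambda>n. s n b) \<longlonglongrightarrow> sqrt (1 / L) * \<sigma>"
        unfolding s_def k_def by (intro tendsto_intros block_length_limits(2)[OF L])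
      then show ?thesis by (simp add: real_sqrt_divide)
    qed
    show "AE \<omega> in Q. (\<lambda>n. g (\<lambda>b. s n b * Yn b n (\<omega> b))) \<longlonglongrightarrow> g (\<lambda>b. \<sigma> / sqrt L * Y b (\<omega> b))"
      by (intro AE_I2 l1_lipschitz_tendsto[OF g(1)] tendsto_mult s lim) (auto simp: Q_def space_PiM PiE_iff)
  qed (use g(2) in auto)
  also have "(\<integral>\<omega>. g (\<lambda>b. \<sigma> / sqrt L * Y b (\<omega> b)) \<partial>Q) = (\<integral>\<omega>. g (\<lambda>b. \<sigma> / sqrt L * N b \<omega>) \<partial>P)"
    using P(3) Yd lawQ[of Y] by (intro integral_indep_eq[OF Q indQ P(1,2) _ L sl1]) auto
  finally show ?thesis by (simp add: step[unfolded S_def])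
qed

section \<open>A dyadic tower of Gaussian vectors\<close>

text \<open>Invariance of the planar Gaussian law under an orthogonal map, by Fubini and two
  one-dimensional affine substitutions, whose Jacobians sqrt 2 and 1 / sqrt 2 cancel.\<close>

lemma nn_integral_std_normal_rotation:
  assumes [measurable]: "A \<in> sets borel" "B \<in> sets borel"
  shows "(\<integral>\<^sup>+ x. \<integral>\<^sup>+ y. indicator A ((x + y) / sqrt 2) * indicator B ((x - y) / sqrt 2) \<partial>std_normal_distribution \<partial>std_normal_distribution)
     = emeasure std_normal_distribution A * emeasure std_normal_distribution B"
proof -
  define \<phi> where "\<phi> x = ennreal (std_normal_density x)" for x
  have [measurable]: "\<phi> \<in> borel_measurable borel" unfolding \<phi>_def by measurable
  define F :: "real \<Rightarrow> real \<Rightarrow> ennreal" where "F u v = indicator A u * indicator B v" for u v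
  have [measurable]: "(\<lambda>p. F (f p) (g p)) \<in> borel_measurable M"
    if "f \<in> borel_measurable M" "g \<in> borel_measurable M" for f g and M :: "'c measure"
    using that unfolding F_def by measurable
  have rot: "\<phi> ((u + v) / sqrt 2) * \<phi> ((u - v) / sqrt 2) = \<phi> u * \<phi> v" for u v
  proof -
    have "exp (- ((u + v) / sqrt 2)\<^sup>2 / 2) * exp (- ((u - v) / sqrt 2)\<^sup>2 / 2) = exp (- u\<^sup>2 / 2) * exp (- v\<^sup>2 / 2)"
      unfolding exp_add[symmetric] by (simp add: power2_eq_square field_simps)
    then show ?thesis
      unfolding \<phi>_def by (simp add: std_normal_density_def ennreal_mult[symmetric])
  qed
  have "(\<integral>\<^sup>+ x. \<integral>\<^sup>+ y. F ((x + y) / sqrt 2) ((x - y) / sqrt 2) \<partial>std_normal_distribution \<partial>std_normal_distribution)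
     = (\<integral>\<^sup>+ x. \<phi> x * (\<integral>\<^sup>+ y. \<phi> y * F ((x + y) / sqrt 2) ((x - y) / sqrt 2) \<partial>lborel) \<partial>lborel)"
    unfolding \<phi>_def by (subst nn_integral_density; measurable?; subst nn_integral_density; measurable?; simp)
  also have "\<dots> = (\<integral>\<^sup>+ x. \<integral>\<^sup>+ y. \<phi> x * (\<phi> y * F ((x + y) / sqrt 2) ((x - y) / sqrt 2)) \<partial>lborel \<partial>lborel)"
    by (subst nn_integral_cmult) auto
  also have "\<dots> = (\<integral>\<^sup>+ y. \<integral>\<^sup>+ x. \<phi> x * (\<phi> y * F ((x + y) / sqrt 2) ((x - y) / sqrt 2)) \<partial>lborel \<partial>lborel)"
    by (rule lborel_pair.Fubini'[symmetric]) measurable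
  also have "\<dots> = (\<integral>\<^sup>+ y. \<integral>\<^sup>+ u. ennreal (sqrt 2) * (\<phi> (- y + sqrt 2 * u) * (\<phi> y * F u (u - sqrt 2 * y))) \<partial>lborel \<partial>lborel)"
  proof (rule nn_integral_cong)
    fix y :: real
    have eq: "(- y + sqrt 2 * u + y) / sqrt 2 = u" "(- y + sqrt 2 * u - y) / sqrt 2 = u - sqrt 2 * y" for u
      by (simp_all add: field_simps)
    show "(\<integral>\<^sup>+ x. \<phi> x * (\<phi> y * F ((x + y) / sqrt 2) ((x - y) / sqrt 2)) \<partial>lborel) =
      (\<integral>\<^sup>+ u. ennreal (sqrt 2) * (\<phi> (- y + sqrt 2 * u) * (\<phi> y * F u (u - sqrt 2 * y))) \<partial>lborel)"
      by (subst nn_integral_real_affine[where c = "sqrt 2" and t = "- y"]; (unfold eq)?; simp add: nn_integral_cmult)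
  qed
  also have "\<dots> = (\<integral>\<^sup>+ u. \<integral>\<^sup>+ y. ennreal (sqrt 2) * (\<phi> (- y + sqrt 2 * u) * (\<phi> y * F u (u - sqrt 2 * y))) \<partial>lborel \<partial>lborel)"
    by (rule lborel_pair.Fubini'[symmetric]) measurable
  also have "\<dots> = (\<integral>\<^sup>+ u. \<integral>\<^sup>+ v. \<phi> u * \<phi> v * F u v \<partial>lborel \<partial>lborel)"
  proof (rule nn_integral_cong)
    fix u :: real
    have eq: "u / sqrt 2 + - 1 / sqrt 2 * v = (u - v) / sqrt 2" "- ((u - v) / sqrt 2) + sqrt 2 * u = (u + v) / sqrt 2"
      "u - sqrt 2 * ((u - v) / sqrt 2) = v" for v
      by (simp_all add: field_simps)
    have one: "ennreal (1 / sqrt 2) * ennreal (sqrt 2) = 1"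
      by (simp add: ennreal_mult[symmetric])
    have "(\<integral>\<^sup>+ y. ennreal (sqrt 2) * (\<phi> (- y + sqrt 2 * u) * (\<phi> y * F u (u - sqrt 2 * y))) \<partial>lborel)
      = ennreal \<bar>- 1 / sqrt 2\<bar> * (\<integral>\<^sup>+ v. ennreal (sqrt 2) * (\<phi> ((u + v) / sqrt 2) * (\<phi> ((u - v) / sqrt 2) * F u v)) \<partial>lborel)"
      by (subst nn_integral_real_affine[where c = "- 1 / sqrt 2" and t = "u / sqrt 2"]; (unfold eq)?; simp)
    also have "\<dots> = (\<integral>\<^sup>+ v. \<phi> ((u + v) / sqrt 2) * (\<phi> ((u - v) / sqrt 2) * F u v) \<partial>lborel)"
      by (subst nn_integral_cmult) (auto simp: mult.assoc[symmetric] one)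
    finally show "(\<integral>\<^sup>+ y. ennreal (sqrt 2) * (\<phi> (- y + sqrt 2 * u) * (\<phi> y * F u (u - sqrt 2 * y))) \<partial>lborel) = (\<integral>\<^sup>+ v. \<phi> u * \<phi> v * F u v \<partial>lborel)"
      by (simp only: mult.assoc[symmetric] rot)
  qed
  also have "\<dots> = (\<integral>\<^sup>+ u. \<phi> u * indicator A u * (\<integral>\<^sup>+ v. \<phi> v * indicator B v \<partial>lborel) \<partial>lborel)"
    by (subst nn_integral_cmult[symmetric]) (auto simp: F_def mult_ac)
  also have "\<dots> = (\<integral>\<^sup>+ u. \<phi> u * indicator A u \<partial>lborel) * (\<integral>\<^sup>+ v. \<phi> v * indicator B v \<partial>lborel)"
    by (rule nn_integral_multc) measurable
  also have "\<dots> = emeasure std_normal_distribution A * emeasure std_normal_distribution B"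
    by (simp add: emeasure_density \<phi>_def)
  finally show ?thesis by (simp add: F_def)
qed

lemma prob_space_std_normal: "prob_space std_normal_distribution"
  using real_dist_normal_dist by (simp add: real_distribution_def)

context prob_space
begin

definition iid_std_normal :: "('i \<Rightarrow> 'a \<Rightarrow> real) \<Rightarrow> 'i set \<Rightarrow> bool" where
  "iid_std_normal V I \<longleftrightarrow> indep_vars (\<lambda>_. borel) V I \<and> (\<forall>i\<in>I. distr M borel (V i) = std_normal_distribution)"

text \<open>Boxes determine the joint law. The pair (a, b) is independent of the remaining
  coordinates, and the probability that its image lies in a box is given by
  \<open>nn_integral_std_normal_rotation\<close>.\<close>

lemma iid_std_normal_rotate:
  assumes V: "iid_std_normal V I" and I: "finite I" "a \<in> I" "b \<in> I" "a \<noteq> b"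
  shows "iid_std_normal (V(a := \<lambda>\<omega>. (V a \<omega> + V b \<omega>) / sqrt 2, b := \<lambda>\<omega>. (V a \<omega> - V b \<omega>) / sqrt 2)) I"
proof -
  define W where "W = V(a := \<lambda>\<omega>. (V a \<omega> + V b \<omega>) / sqrt 2, b := \<lambda>\<omega>. (V a \<omega> - V b \<omega>) / sqrt 2)"
  let ?\<Phi> = "std_normal_distribution"
  interpret \<Phi>: prob_space ?\<Phi> by (rule prob_space_std_normal)
  have ind: "indep_vars (\<lambda>_. borel) V I" and law: "\<And>i. i \<in> I \<Longrightarrow> distr M borel (V i) = ?\<Phi>"
    using V by (auto simp: iid_std_normal_def)
  have m: "V i \<in> borel_measurable M" if "i \<in> I" for i using ind that by (auto simp: indep_vars_def)
  have [measurable]: "V a \<in> borel_measurable M" "V b \<in> borel_measurable M" using I m by auto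
  have Va: "W a = (\<lambda>\<omega>. (V a \<omega> + V b \<omega>) / sqrt 2)" and Vb: "W b = (\<lambda>\<omega>. (V a \<omega> - V b \<omega>) / sqrt 2)"
    and Vo: "i \<noteq> a \<Longrightarrow> i \<noteq> b \<Longrightarrow> W i = V i" for i
    using I by (auto simp: W_def)
  have m': "W i \<in> borel_measurable M" if "i \<in> I" for i
  proof -
    consider "i = a" | "i = b" | "i \<noteq> a" "i \<noteq> b" by blast
    then show ?thesis
    proof cases
      case 1 show ?thesis unfolding 1 Va by measurable
    next
      case 2 show ?thesis unfolding 2 Vb by measurable
    next
      case 3 then show ?thesis using m[OF that] by (simp add: Vo)
    qed
  qed
  have box: "prob {\<omega> \<in> space M. \<forall>i\<in>I. W i \<omega> \<in> A i} = (\<Prod>i\<in>I. measure ?\<Phi> (A i))"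
    if A: "\<And>i. i \<in> I \<Longrightarrow> A i \<in> sets borel" for A
  proof -
    have [measurable]: "A a \<in> sets borel" "A b \<in> sets borel" using A I by auto
    let ?R = "I - {a, b}"
    let ?X = "\<lambda>\<omega>. \<lambda>i\<in>{a, b}. V i \<omega>" and ?Y = "\<lambda>\<omega>. \<lambda>i\<in>?R. V i \<omega>"
    define B1 where "B1 = {x \<in> space (PiM {a, b} (\<lambda>_. borel)). (x a + x b) / sqrt 2 \<in> A a \<and> (x a - x b) / sqrt 2 \<in> A b}"
    have B1: "B1 \<in> sets (PiM {a, b} (\<lambda>_. borel))" unfolding B1_def by measurable
    have B2: "PiE ?R A \<in> sets (PiM ?R (\<lambda>_. borel))" using I A by (intro sets_PiM_I_finite) auto
    have indXY: "indep_var (PiM {a, b} (\<lambda>_. borel)) ?X (PiM ?R (\<lambda>_. borel)) ?Y"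
      using I by (intro indep_var_restrict[OF ind]) auto
    have "{\<omega> \<in> space M. \<forall>i\<in>I. W i \<omega> \<in> A i} = (\<lambda>\<omega>. (?X \<omega>, ?Y \<omega>)) -` (B1 \<times> PiE ?R A) \<inter> space M"
    proof (rule set_eqI, rule iffI)
      fix \<omega> assume "\<omega> \<in> {\<omega> \<in> space M. \<forall>i\<in>I. W i \<omega> \<in> A i}"
      then have \<omega>: "\<omega> \<in> space M" "\<And>i. i \<in> I \<Longrightarrow> W i \<omega> \<in> A i" by blast+
      have "V i \<omega> \<in> A i" if "i \<in> ?R" for i using \<omega>(2)[of i] that Vo[of i] by simp
      then show "\<omega> \<in> (\<lambda>\<omega>. (?X \<omega>, ?Y \<omega>)) -` (B1 \<times> PiE ?R A) \<inter> space M"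
        using \<omega>(1) \<omega>(2)[OF I(2)] \<omega>(2)[OF I(3)] unfolding Va Vb by (simp add: B1_def space_PiM PiE_iff)
    next
      fix \<omega> assume "\<omega> \<in> (\<lambda>\<omega>. (?X \<omega>, ?Y \<omega>)) -` (B1 \<times> PiE ?R A) \<inter> space M"
      then have \<omega>: "\<omega> \<in> space M" "(V a \<omega> + V b \<omega>) / sqrt 2 \<in> A a" "(V a \<omega> - V b \<omega>) / sqrt 2 \<in> A b" "\<And>i. i \<in> ?R \<Longrightarrow> V i \<omega> \<in> A i"
        by (simp_all add: B1_def PiE_iff)
      have "W i \<omega> \<in> A i" if "i \<in> I" for i
        using \<omega>(2-4) that Va Vb Vo[of i] by (cases "i = a"; cases "i = b") auto
      then show "\<omega> \<in> {\<omega> \<in> space M. \<forall>i\<in>I. W i \<omega> \<in> A i}" using \<omega>(1) by blast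
    qed
    then have "prob {\<omega> \<in> space M. \<forall>i\<in>I. W i \<omega> \<in> A i} = prob (?X -` B1 \<inter> space M) * prob (?Y -` PiE ?R A \<inter> space M)"
      using indep_varD[OF indXY B1 B2] by simp
    also have "prob (?Y -` PiE ?R A \<inter> space M) = (\<Prod>i\<in>?R. measure ?\<Phi> (A i))"
    proof (cases "?R = {}")
      case True
      show ?thesis unfolding True by (simp add: prob_space restrict_def)
    next
      case False
      have "?Y -` PiE ?R A \<inter> space M = (\<Inter>i\<in>?R. V i -` A i \<inter> space M)"
        using False by auto
      also have "prob \<dots> = (\<Prod>i\<in>?R. prob (V i -` A i \<inter> space M))"
        using False I A by (intro indep_varsD_finite[OF indep_vars_subset[OF ind]]) auto
      also have "\<dots> = (\<Prod>i\<in>?R. measure ?\<Phi> (A i))"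
      proof (rule prod.cong[OF refl])
        fix i assume "i \<in> ?R"
        then have i: "i \<in> I" by simp
        show "prob (V i -` A i \<inter> space M) = measure ?\<Phi> (A i)"
          unfolding law[OF i, symmetric] by (rule measure_distr[symmetric]) (use m[OF i] A[OF i] in auto)
      qed
      finally show ?thesis .
    qed
    also have "prob (?X -` B1 \<inter> space M) = measure ?\<Phi> (A a) * measure ?\<Phi> (A b)"
    proof -
      have "indep_var borel ((\<lambda>x. x a) \<circ> (\<lambda>\<omega>. \<lambda>i\<in>{a}. V i \<omega>)) borel ((\<lambda>x. x b) \<circ> (\<lambda>\<omega>. \<lambda>i\<in>{b}. V i \<omega>))"
        using I by (intro indep_var_compose[OF indep_var_restrict[OF ind, of "{a}" "{b}"]]) auto
      then have "indep_var borel (V a) borel (V b)" by (simp add: comp_def)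
      then have pair: "distr M (borel \<Otimes>\<^sub>M borel) (\<lambda>\<omega>. (V a \<omega>, V b \<omega>)) = ?\<Phi> \<Otimes>\<^sub>M ?\<Phi>"
        unfolding indep_var_distribution_eq using law I by simp
      define C where "C = {p :: real \<times> real. (fst p + snd p) / sqrt 2 \<in> A a \<and> (fst p - snd p) / sqrt 2 \<in> A b}"
      have C: "C \<in> sets (borel \<Otimes>\<^sub>M borel)"
      proof -
        have "C = {p \<in> space (borel \<Otimes>\<^sub>M borel). (fst p + snd p) / sqrt 2 \<in> A a \<and> (fst p - snd p) / sqrt 2 \<in> A b}"
          by (auto simp: C_def space_pair_measure)
        also have "\<dots> \<in> sets (borel \<Otimes>\<^sub>M borel)" by measurable
        finally show ?thesis .
      qed
      have "?X -` B1 \<inter> space M = (\<lambda>\<omega>. (V a \<omega>, V b \<omega>)) -` C \<inter> space M"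
        using I by (auto simp: B1_def C_def space_PiM)
      then have "emeasure M (?X -` B1 \<inter> space M) = emeasure (?\<Phi> \<Otimes>\<^sub>M ?\<Phi>) C"
        using C by (simp add: pair[symmetric] emeasure_distr)
      also have "\<dots> = (\<integral>\<^sup>+ x. \<integral>\<^sup>+ y. indicator C (x, y) \<partial>?\<Phi> \<partial>?\<Phi>)"
        by (rule \<Phi>.emeasure_pair_measure) (use C in \<open>simp cong: sets_pair_measure_cong\<close>)
      also have "\<dots> = (\<integral>\<^sup>+ x. \<integral>\<^sup>+ y. indicator (A a) ((x + y) / sqrt 2) * indicator (A b) ((x - y) / sqrt 2) \<partial>?\<Phi> \<partial>?\<Phi>)"
        by (intro nn_integral_cong) (auto simp: C_def indicator_def)
      also have "\<dots> = emeasure ?\<Phi> (A a) * emeasure ?\<Phi> (A b)"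
        by (rule nn_integral_std_normal_rotation) measurable
      finally show ?thesis
        by (simp add: emeasure_eq_measure \<Phi>.emeasure_eq_measure ennreal_mult[symmetric])
    qed
    finally show ?thesis
      using I by (simp add: prod.remove[of I a] prod.remove[of "I - {a}" b] Diff_insert2[symmetric] mult.assoc)
  qed
  have law': "distr M borel (W i) = ?\<Phi>" if "i \<in> I" for i
  proof (rule measure_eqI)
    fix B assume "B \<in> sets (distr M borel (W i))"
    then have B: "B \<in> sets borel" by simp
    have "prob {\<omega> \<in> space M. \<forall>j\<in>I. W j \<omega> \<in> (if j = i then B else UNIV)} = (\<Prod>j\<in>I. measure ?\<Phi> (if j = i then B else UNIV))"
      using B by (intro box) auto
    also have "\<dots> = (\<Prod>j\<in>I. if j = i then measure ?\<Phi> B else 1)"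
      using \<Phi>.prob_space by (intro prod.cong) auto
    also have "\<dots> = measure ?\<Phi> B" using I that by (simp add: prod.delta)
    also have "{\<omega> \<in> space M. \<forall>j\<in>I. W j \<omega> \<in> (if j = i then B else UNIV)} = W i -` B \<inter> space M"
      using that by auto
    finally show "emeasure (distr M borel (W i)) B = emeasure ?\<Phi> B"
      using m'[OF that] B by (simp add: emeasure_distr emeasure_eq_measure \<Phi>.emeasure_eq_measure)
  qed simp
  interpret S: product_prob_space "\<lambda>_. ?\<Phi>" I by (rule product_prob_spaceI) (rule prob_space_std_normal)
  have "distr M (PiM I (\<lambda>_. borel)) (\<lambda>\<omega>. \<lambda>i\<in>I. W i \<omega>) = PiM I (\<lambda>_. ?\<Phi>)"
  proof (rule S.PiM_eqI[OF I(1)])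
    show "sets (distr M (PiM I (\<lambda>_. borel)) (\<lambda>\<omega>. \<lambda>i\<in>I. W i \<omega>)) = sets (PiM I (\<lambda>_. ?\<Phi>))"
      by (simp cong: sets_PiM_cong)
    fix A assume "\<And>i. i \<in> I \<Longrightarrow> A i \<in> sets ?\<Phi>"
    then have A: "\<And>i. i \<in> I \<Longrightarrow> A i \<in> sets borel" by simp
    have "emeasure (distr M (PiM I (\<lambda>_. borel)) (\<lambda>\<omega>. \<lambda>i\<in>I. W i \<omega>)) (PiE I A)
       = emeasure M ((\<lambda>\<omega>. \<lambda>i\<in>I. W i \<omega>) -` PiE I A \<inter> space M)"
      using A I(1) m' by (intro emeasure_distr measurable_restrict sets_PiM_I_finite) auto
    also have "(\<lambda>\<omega>. \<lambda>i\<in>I. W i \<omega>) -` PiE I A \<inter> space M = {\<omega> \<in> space M. \<forall>i\<in>I. W i \<omega> \<in> A i}"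
      by auto
    also have "emeasure M \<dots> = ennreal (prob \<dots>)" by (rule emeasure_eq_measure)
    also have "prob {\<omega> \<in> space M. \<forall>i\<in>I. W i \<omega> \<in> A i} = (\<Prod>i\<in>I. measure ?\<Phi> (A i))"
      using A by (rule box)
    also have "ennreal \<dots> = (\<Prod>i\<in>I. emeasure ?\<Phi> (A i))"
      by (simp add: \<Phi>.emeasure_eq_measure prod_ennreal)
    finally show "emeasure (distr M (PiM I (\<lambda>_. borel)) (\<lambda>\<omega>. \<lambda>i\<in>I. W i \<omega>)) (PiE I A) = (\<Prod>i\<in>I. emeasure ?\<Phi> (A i))" .
  qed
  also have "\<dots> = PiM I (\<lambda>i. distr M borel (W i))"
    using law' by (intro PiM_cong) auto
  finally have "indep_vars (\<lambda>_. borel) W I"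
    using I m' by (subst indep_vars_iff_distr_eq_PiM') auto
  then show ?thesis using law' unfolding iid_std_normal_def W_def by blast
qed

end

text \<open>\<open>pair_rot L\<close> rotates the pairs of coordinates \<open>(m, L + m)\<close>, \<open>m < L\<close>, by 45 degrees. Rotating
  \<open>(N, \<xi>)\<close> to \<open>((N + \<xi>) / sqrt 2, (N - \<xi>) / sqrt 2)\<close> splits the increment of a Brownian motion over a
  dyadic interval into those over the two halves. The rotations are done in place, so block \<open>b\<close> of
  level \<open>K\<close> ends up in the bit-reversed position \<open>bit_rev K b\<close>.\<close>

definition pair_rot :: "nat \<Rightarrow> (nat \<Rightarrow> 'a \<Rightarrow> real) \<Rightarrow> nat \<Rightarrow> 'a \<Rightarrow> real" where
  "pair_rot L V m = (if m < L then \<lambda>\<omega>. (V m \<omega> + V (L + m) \<omega>) / sqrt 2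
     else if m < 2 * L then \<lambda>\<omega>. (V (m - L) \<omega> - V m \<omega>) / sqrt 2 else V m)"

primrec rot_tower :: "(nat \<Rightarrow> 'a \<Rightarrow> real) \<Rightarrow> nat \<Rightarrow> nat \<Rightarrow> 'a \<Rightarrow> real" where
  "rot_tower \<xi> 0 = \<xi>"
| "rot_tower \<xi> (Suc K) = pair_rot (2 ^ K) (rot_tower \<xi> K)"

primrec bit_rev :: "nat \<Rightarrow> nat \<Rightarrow> nat" where
  "bit_rev 0 b = 0"
| "bit_rev (Suc K) b = bit_rev K (b div 2) + (if odd b then 2 ^ K else 0)"

definition dyadic_normal :: "(nat \<Rightarrow> 'a \<Rightarrow> real) \<Rightarrow> nat \<Rightarrow> nat \<Rightarrow> 'a \<Rightarrow> real" where
  "dyadic_normal \<xi> K b = rot_tower \<xi> K (bit_rev K b)"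

lemma bit_rev_less: "bit_rev K b < 2 ^ K"
proof (induction K arbitrary: b)
  case (Suc K)
  show ?case using Suc[of "b div 2"] by auto
qed simp

lemma inj_on_bit_rev: "inj_on (bit_rev K) {..<2 ^ K}"
proof (induction K)
  case (Suc K)
  show ?case
  proof (rule inj_onI)
    fix a b assume *: "a \<in> {..<2 ^ Suc K}" "b \<in> {..<2 ^ Suc K}" "bit_rev (Suc K) a = bit_rev (Suc K) b"
    have "odd a \<longleftrightarrow> odd b" using *(3) bit_rev_less[of K "a div 2"] bit_rev_less[of K "b div 2"] by (auto split: if_splits)
    moreover from this have eq: "bit_rev K (a div 2) = bit_rev K (b div 2)" using *(3) by (auto split: if_splits)
    have "a div 2 \<in> {..<2 ^ K}" "b div 2 \<in> {..<2 ^ K}" using *(1,2) by auto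
    from inj_onD[OF Suc eq this] have "a div 2 = b div 2" .
    ultimately show "a = b" by (metis even_two_times_div_two odd_two_times_div_two_succ)
  qed
qed (simp add: inj_on_def)

text \<open>Levels up to K act on positions below 2^K only, so the variable at 2^K +
  \<open>bit_rev K b\<close> is still the original one: each step is Levy's midpoint displacement
  with a fresh normal.\<close>

lemma dyadic_normal_Suc:
  "dyadic_normal \<xi> (Suc K) (2 * b) = (\<lambda>\<omega>. (dyadic_normal \<xi> K b \<omega> + rot_tower \<xi> K (2 ^ K + bit_rev K b) \<omega>) / sqrt 2)"
  "dyadic_normal \<xi> (Suc K) (Suc (2 * b)) = (\<lambda>\<omega>. (dyadic_normal \<xi> K b \<omega> - rot_tower \<xi> K (2 ^ K + bit_rev K b) \<omega>) / sqrt 2)"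
  using bit_rev_less[of K b] by (auto simp: dyadic_normal_def pair_rot_def add.commute)

text \<open>After division by the roots of 2^(K+1) and 2^K this is additivity of increments over the
  two halves of a dyadic interval, so all levels belong to one path.\<close>

lemma dyadic_normal_refine:
  "dyadic_normal \<xi> (Suc K) (2 * b) \<omega> + dyadic_normal \<xi> (Suc K) (Suc (2 * b)) \<omega> = sqrt 2 * dyadic_normal \<xi> K b \<omega>"
  unfolding dyadic_normal_Suc by (simp add: field_simps)

context prob_space
begin

lemma iid_std_normal_pair_rot:
  assumes V: "iid_std_normal V {..<n}" and n: "2 * L \<le> n"
  shows "iid_std_normal (pair_rot L V) {..<n}"
proof -
  \<comment> \<open>\<open>R j\<close> has the first j pairs rotated, so that
    \<open>iid_std_normal_rotate\<close> can be applied to one pair at a time.\<close>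
  define R where "R j m = (if m < j then \<lambda>\<omega>. (V m \<omega> + V (L + m) \<omega>) / sqrt 2
     else if L \<le> m \<and> m < L + j then \<lambda>\<omega>. (V (m - L) \<omega> - V m \<omega>) / sqrt 2 else V m)" for j m
  have "iid_std_normal (R j) {..<n}" if "j \<le> L" for j
    using that
  proof (induction j)
    case 0
    have "R 0 = V" by (auto simp: R_def fun_eq_iff)
    then show ?case using V by simp
  next
    case (Suc j)
    have "R (Suc j) = (R j)(j := \<lambda>\<omega>. (R j j \<omega> + R j (L + j) \<omega>) / sqrt 2, L + j := \<lambda>\<omega>. (R j j \<omega> - R j (L + j) \<omega>) / sqrt 2)"
    proof
      fix m
      have a: "R j j = V j" "R j (L + j) = V (L + j)" using Suc by (auto simp: R_def)
      consider "m = j" | "m = L + j" | "m \<noteq> j" "m \<noteq> L + j" by blast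
      then show "R (Suc j) m = ((R j)(j := \<lambda>\<omega>. (R j j \<omega> + R j (L + j) \<omega>) / sqrt 2, L + j := \<lambda>\<omega>. (R j j \<omega> - R j (L + j) \<omega>) / sqrt 2)) m"
        unfolding a using Suc by cases (auto simp: R_def)
    qed
    then show ?case using Suc n by (simp only:) (intro iid_std_normal_rotate, auto)
  qed
  moreover have "R L = pair_rot L V" by (auto simp: R_def pair_rot_def fun_eq_iff)
  ultimately show ?thesis by (metis order.refl)
qed

lemma iid_std_normal_rot_tower:
  "iid_std_normal \<xi> {..<n} \<Longrightarrow> 2 ^ K \<le> n \<Longrightarrow> iid_std_normal (rot_tower \<xi> K) {..<n}"
  by (induction K) (auto intro!: iid_std_normal_pair_rot)

lemma iid_dyadic_normal:
  assumes \<xi>: "iid_std_normal \<xi> UNIV"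
  shows "iid_std_normal (dyadic_normal \<xi> K) {..<2 ^ K}"
proof -
  have "iid_std_normal \<xi> {..<2 ^ K}"
    using \<xi> by (auto simp: iid_std_normal_def intro: indep_vars_subset)
  then have W: "iid_std_normal (rot_tower \<xi> K) {..<2 ^ K}" by (rule iid_std_normal_rot_tower) simp
  then have "indep_vars (\<lambda>_. borel) (\<lambda>b \<omega>. \<Sum>i\<in>{bit_rev K b}. rot_tower \<xi> K i \<omega>) {..<2 ^ K}"
    using inj_on_bit_rev[of K] bit_rev_less[of K]
    by (intro indep_vars_group_sums[where I = "{..<2 ^ K}"]) (auto simp: iid_std_normal_def disjoint_family_on_def inj_on_def)
  then show ?thesis
    using W bit_rev_less[of K] by (auto simp: iid_std_normal_def dyadic_normal_def[abs_def])
qed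

lemma iid_std_normalD:
  assumes "iid_std_normal V I" "i \<in> I"
  shows "V i \<in> borel_measurable M" "distr M borel (V i) = std_normal_distribution"
    "integrable M (\<lambda>\<omega>. (V i \<omega>)\<^sup>2)" "expectation (\<lambda>\<omega>. (V i \<omega>)\<^sup>2) = 1" "expectation (V i) = 0"
    "integrable M (\<lambda>\<omega>. (V i \<omega>) ^ 4)" "expectation (\<lambda>\<omega>. (V i \<omega>) ^ 4) = 3"
proof -
  show m: "V i \<in> borel_measurable M" and d: "distr M borel (V i) = std_normal_distribution"
    using assms by (auto simp: iid_std_normal_def indep_vars_def)
  have int: "integrable M (\<lambda>\<omega>. (V i \<omega>) ^ k)" "expectation (\<lambda>\<omega>. (V i \<omega>) ^ k) = (\<integral>x. x ^ k \<partial>std_normal_distribution)" for k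
    using integrable_std_normal_distribution_moment[of k] m
    by (simp_all add: d[symmetric] integrable_distr_eq integral_distr)
  show "integrable M (\<lambda>\<omega>. (V i \<omega>)\<^sup>2)" "integrable M (\<lambda>\<omega>. (V i \<omega>) ^ 4)" by (fact int)+
  show "expectation (\<lambda>\<omega>. (V i \<omega>)\<^sup>2) = 1" "expectation (\<lambda>\<omega>. (V i \<omega>) ^ 4) = 3"
    using int(2)[of 2] int(2)[of 4] std_normal_distribution_even_moments(1)[of 1] std_normal_distribution_even_moments(1)[of 2]
    by (simp_all add: fact_numeral)
  show "expectation (V i) = 0"
    using int(2)[of 1] integral_std_normal_distribution_moment_odd[of 1] by simp
qed

end

section \<open>The limiting Gaussian process\<close>

lemma in_linfty_iff: "f \<in> mspace (linfty F) \<longleftrightarrow> f \<in> extensional F \<and> bounded (f ` F)"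
  by (auto simp: Met_TC.fspace_def)

lemma linfty_mdist_le:
  assumes "f \<in> mspace (linfty F)" "g \<in> mspace (linfty F)" "0 \<le> c" "\<And>x. x \<in> F \<Longrightarrow> \<bar>f x - g x\<bar> \<le> c"
  shows "mdist (linfty F) f g \<le> c"
  using assms by (auto simp: Met_TC.fdist_def dist_real_def intro!: cSUP_least)

lemma linfty_abs_diff_le:
  assumes "f \<in> mspace (linfty F)" "g \<in> mspace (linfty F)" "x \<in> F"
  shows "\<bar>f x - g x\<bar> \<le> mdist (linfty F) f g"
proof -
  have "dist (f x) (g x) \<le> (SUP x\<in>F. dist (f x) (g x))"
    using assms by (intro cSUP_upper Met_TC.bdd_above_dist) auto
  then show ?thesis using assms by (auto simp: Met_TC.fdist_def dist_real_def)
qed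

definition sq_integral :: "(real \<Rightarrow> real) \<Rightarrow> real" where
  "sq_integral f = integral {0..1} (\<lambda>x. (f x)\<^sup>2)"

text \<open>The Riemann-Stieltjes sum of f against the increments x, with right end points, over the
  L2 norm of f. It carries both block sums and Brownian increments into \<open>linfty\<close>, so
  that their laws can be compared through finitely many coordinates.\<close>

definition block_map :: "real \<Rightarrow> real \<Rightarrow> nat \<Rightarrow> (nat \<Rightarrow> real) \<Rightarrow> (real \<Rightarrow> real) \<Rightarrow> real" where
  "block_map q \<delta> L x = (\<lambda>f\<in>F_class q \<delta>. (\<Sum>b<L. f (real (Suc b) / L) * x b) / sqrt (sq_integral f))"

context
  fixes q \<delta> :: real
  assumes q: "1 \<le> q" and \<delta>: "0 < \<delta>"
begin

lemma sq_integral_gt: "f \<in> F_class q \<delta> \<Longrightarrow> \<delta> < sq_integral f"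
  by (simp add: F_class_def sq_integral_def)

text \<open>Uniform in f because |f| \<le> 1 and the normaliser exceeds sqrt \<delta>. This makes a
  Lipschitz functional on \<open>linfty\<close> an \<open>l1_lipschitz\<close> function of the
  increments.\<close>

lemma block_map_diff_le:
  assumes f: "f \<in> F_class q \<delta>"
  shows "\<bar>block_map q \<delta> L x f - block_map q \<delta> L y f\<bar> \<le> (\<Sum>b<L. \<bar>x b - y b\<bar>) / sqrt \<delta>"
proof -
  have "\<bar>(\<Sum>b<L. f (real (Suc b) / L) * x b) - (\<Sum>b<L. f (real (Suc b) / L) * y b)\<bar> \<le> (\<Sum>b<L. \<bar>x b - y b\<bar>)"
  proof -
    have "\<bar>f (real (Suc b) / L) * (x b - y b)\<bar> \<le> 1 * \<bar>x b - y b\<bar>" if "b < L" for b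
      unfolding abs_mult using that by (intro mult_right_mono F_class_abs_le_1[OF q f]) auto
    then have "\<bar>\<Sum>b<L. f (real (Suc b) / L) * (x b - y b)\<bar> \<le> (\<Sum>b<L. \<bar>x b - y b\<bar>)"
      by (intro order.trans[OF sum_abs] sum_mono) auto
    then show ?thesis by (simp add: right_diff_distrib sum_subtractf)
  qed
  then have "\<bar>(\<Sum>b<L. f (real (Suc b) / L) * x b) - (\<Sum>b<L. f (real (Suc b) / L) * y b)\<bar> / sqrt (sq_integral f)
      \<le> (\<Sum>b<L. \<bar>x b - y b\<bar>) / sqrt \<delta>"
    using sq_integral_gt[OF f] \<delta> by (intro frac_le sum_nonneg) auto
  moreover have "\<bar>block_map q \<delta> L x f - block_map q \<delta> L y f\<bar>
      = \<bar>(\<Sum>b<L. f (real (Suc b) / L) * x b) - (\<Sum>b<L. f (real (Suc b) / L) * y b)\<bar> / sqrt (sq_integral f)"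
    using f sq_integral_gt[OF f] \<delta> by (simp add: block_map_def flip: diff_divide_distrib)
  ultimately show ?thesis by simp
qed

lemma block_map_in: "block_map q \<delta> L x \<in> mspace (linfty (F_class q \<delta>))"
proof -
  have "\<bar>block_map q \<delta> L x f\<bar> \<le> (\<Sum>b<L. \<bar>x b\<bar>) / sqrt \<delta>" if "f \<in> F_class q \<delta>" for f
    using block_map_diff_le[OF that, of L x "\<lambda>_. 0"] that by (simp add: block_map_def)
  then have "bounded (block_map q \<delta> L x ` F_class q \<delta>)"
    by (auto simp: bounded_iff intro!: exI[of _ "(\<Sum>b<L. \<bar>x b\<bar>) / sqrt \<delta>"])
  then show ?thesis unfolding in_linfty_iff by (auto simp: block_map_def)
qed

lemma block_map_mdist_le: "mdist (linfty (F_class q \<delta>)) (block_map q \<delta> L x) (block_map q \<delta> L y) \<le> (\<Sum>b<L. \<bar>x b - y b\<bar>) / sqrt \<delta>"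
  using \<delta> by (intro linfty_mdist_le block_map_in block_map_diff_le divide_nonneg_nonneg sum_nonneg) auto

lemma l1_lipschitz_block_map:
  assumes "bounded_lipschitz (linfty (F_class q \<delta>)) h"
  shows "l1_lipschitz L (\<lambda>x. h (block_map q \<delta> L x))"
proof -
  obtain j where j: "0 \<le> j" "\<And>x y. x \<in> mspace (linfty (F_class q \<delta>)) \<Longrightarrow> y \<in> mspace (linfty (F_class q \<delta>)) \<Longrightarrow>
      \<bar>h x - h y\<bar> \<le> j * mdist (linfty (F_class q \<delta>)) x y"
    using assms unfolding bounded_lipschitz_def by blast
  have "\<bar>h (block_map q \<delta> L x) - h (block_map q \<delta> L y)\<bar> \<le> (j / sqrt \<delta>) * (\<Sum>b<L. \<bar>x b - y b\<bar>)" for x y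
    using j(2)[OF block_map_in block_map_in, of L x L y] mult_left_mono[OF block_map_mdist_le[of L x y] j(1)] by simp
  then show ?thesis unfolding l1_lipschitz_def by blast
qed

lemma block_map_scale: "f \<in> F_class q \<delta> \<Longrightarrow> block_map q \<delta> L (\<lambda>b. c * x b) f = c * block_map q \<delta> L x f"
  by (simp add: block_map_def sum_distrib_left mult_ac)

end

section \<open>Almost sure uniform convergence along the dyadic levels\<close>

lemma (in prob_space) markov:
  assumes "integrable M U" "\<And>\<omega>. 0 \<le> U \<omega>" "0 < c"
  shows "{\<omega> \<in> space M. c < U \<omega>} \<in> events" "prob {\<omega> \<in> space M. c < U \<omega>} \<le> expectation U / c"
proof -
  show ev: "{\<omega> \<in> space M. c < U \<omega>} \<in> events" using borel_measurable_integrable[OF assms(1)] by measurable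
  have "c * prob {\<omega> \<in> space M. c < U \<omega>} = expectation (\<lambda>\<omega>. c * indicator {\<omega> \<in> space M. c < U \<omega>} \<omega>)"
    using ev by simp
  also have "\<dots> \<le> expectation U"
  proof (rule integral_mono)
    show "integrable M (\<lambda>\<omega>. c * indicator {\<omega> \<in> space M. c < U \<omega>} \<omega>)"
      using ev by (intro integrable_mult_right) (auto simp: emeasure_eq_measure)
  qed (use assms in \<open>auto simp: indicator_def\<close>)
  finally show "prob {\<omega> \<in> space M. c < U \<omega>} \<le> expectation U / c"
    using assms(3) by (simp add: field_simps)
qed

lemma (in prob_space) AE_summable:
  fixes U :: "nat \<Rightarrow> 'a \<Rightarrow> real"
  assumes U: "\<And>K. integrable M (U K)" "\<And>K \<omega>. 0 \<le> U K \<omega>" and sum: "summable (\<lambda>K. expectation (U K))"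
  shows "AE \<omega> in M. summable (\<lambda>K. U K \<omega>)"
proof -
  have "(\<Sum>K. ennreal (expectation (U K))) \<noteq> \<infinity>"
    using U(2) sum by (subst suminf_ennreal2) (auto simp: Bochner_Integration.integral_nonneg)
  moreover have "(\<integral>\<^sup>+ \<omega>. (\<Sum>K. ennreal (U K \<omega>)) \<partial>M) = (\<Sum>K. ennreal (expectation (U K)))"
  proof -
    have "(\<lambda>\<omega>. ennreal (U K \<omega>)) \<in> borel_measurable M" for K
      using borel_measurable_integrable[OF U(1)[of K]] by measurable
    then have "(\<integral>\<^sup>+ \<omega>. (\<Sum>K. ennreal (U K \<omega>)) \<partial>M) = (\<Sum>K. \<integral>\<^sup>+ \<omega>. ennreal (U K \<omega>) \<partial>M)"
      by (rule nn_integral_suminf)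
    moreover have "(\<integral>\<^sup>+ \<omega>. ennreal (U K \<omega>) \<partial>M) = ennreal (expectation (U K))" for K
      by (rule nn_integral_eq_integral[OF U(1) AE_I2]) (rule U(2))
    ultimately show ?thesis by simp
  qed
  ultimately have "(\<integral>\<^sup>+ \<omega>. (\<Sum>K. ennreal (U K \<omega>)) \<partial>M) \<noteq> \<infinity>" by simp
  moreover have "(\<lambda>\<omega>. \<Sum>K. ennreal (U K \<omega>)) \<in> borel_measurable M"
    using borel_measurable_integrable[OF U(1)] by measurable
  ultimately have "AE \<omega> in M. (\<Sum>K. ennreal (U K \<omega>)) \<noteq> \<infinity>" by (intro nn_integral_PInf_AE)
  then show ?thesis
  proof eventually_elim
    case (elim \<omega>)
    then show ?case using U(2) by (intro summable_suminf_not_top) auto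
  qed
qed

text \<open>Comparison with the geometric series of ratio r powr (1 / c). The scale k in
  \<open>dyadic_limit\<close> advances only once in 8 levels, whence the division.\<close>

lemma summable_power_div:
  fixes r :: real
  assumes "0 < r" "r < 1" "0 < c"
  shows "summable (\<lambda>K. r ^ (K div c))"
proof (rule summable_comparison_test)
  define s where "s = r powr (1 / c)"
  have s: "0 < s" "s < 1" using assms powr_less_mono2[of "1 / c" r 1] by (auto simp: s_def)
  have "r ^ (K div c) \<le> (1 / r) * s ^ K" for K
  proof -
    have "real K / c - 1 \<le> real (K div c)"
    proof -
      have "real K = real (K div c) * c + real (K mod c)" by (metis div_mult_mod_eq of_nat_add of_nat_mult)
      moreover have "real (K mod c) < c" using assms(3) by simp
      ultimately show ?thesis using assms(3) by (simp add: field_simps)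
    qed
    then have "r powr real (K div c) \<le> r powr (real K / c - 1)"
      using assms by (intro powr_mono') auto
    also have "\<dots> = (1 / r) * s ^ K"
      using assms s by (simp add: s_def powr_diff powr_powr flip: powr_realpow)
    finally show ?thesis using assms(1) by (simp add: powr_realpow)
  qed
  then show "\<exists>N. \<forall>n\<ge>N. norm (r ^ (n div c)) \<le> (1 / r) * s ^ n"
    using assms by auto
  show "summable (\<lambda>n. (1 / r) * s ^ n)" using s by (intro summable_mult summable_geometric) auto
qed

context prob_space
begin

text \<open>Two neighbouring levels are walks on the same 2^(K+1) points, the coarse step being
  placed at the second half of its interval. They disagree only between the halves, by one fine
  increment. Fourth moments bound the chance that one of these 2^K increments exceeds (1/2)^k by 2^K
  * 3 / 4^(K+1) * 16^k.\<close>

lemma dyadic_level_bound: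
  fixes \<xi> :: "nat \<Rightarrow> 'a \<Rightarrow> real" and K k :: nat
  assumes \<xi>: "iid_std_normal \<xi> UNIV" and q: "1 \<le> q" "q < 2"
  defines "x \<equiv> \<lambda>K b \<omega>. dyadic_normal \<xi> K b \<omega> / sqrt (2 ^ K)"
  shows "\<exists>U B. integrable M U \<and> (\<forall>\<omega>. 0 \<le> U \<omega>) \<and> expectation U \<le> walk_const q 1 * var_rate q ^ k
     \<and> B \<in> events \<and> prob B \<le> 16 ^ k / 2 ^ K
     \<and> (\<forall>\<omega>\<in>space M - B. \<forall>f \<delta>. f \<in> F_class q \<delta> \<longrightarrow>
          \<bar>(\<Sum>b<2 ^ Suc K. f (real (Suc b) / (2 ^ Suc K)) * x (Suc K) b \<omega>) - (\<Sum>b<2 ^ K. f (real (Suc b) / (2 ^ K)) * x K b \<omega>)\<bar> \<le> U \<omega>)"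
proof -
  define L :: nat where "L = 2 ^ K"
  have L: "2 ^ Suc K = 2 * L" "(2::nat) ^ K = L" "(2::real) ^ Suc K = 2 * real L" "(2::real) ^ K = real L" "0 < L" by (auto simp: L_def)
  define u where "u m \<omega> = x (Suc K) m \<omega>" for m \<omega>
  define G where "G m = (if odd m then {m - 1, m} else {})" for m :: nat
  define \<tau> where "\<tau> m = real (Suc m) / (2 * real L)" for m
  have D: "iid_std_normal (dyadic_normal \<xi> (Suc K)) {..<2 * L}"
    using iid_dyadic_normal[OF \<xi>, of "Suc K"] by (simp add: L)
  note DD = iid_std_normalD[OF D]
  have ueq: "u m = (\<lambda>\<omega>. dyadic_normal \<xi> (Suc K) m \<omega> / sqrt (2 * real L))" for m
    by (simp add: u_def[abs_def] x_def L_def)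
  have u: "centred_walk u (2 * L) 1"
    unfolding centred_walk_def
  proof (intro conjI allI impI)
    have "indep_vars (\<lambda>_. borel) (dyadic_normal \<xi> (Suc K)) {..<2 * L}" using D by (simp add: iid_std_normal_def)
    from indep_vars_compose2[OF this, where Y = "\<lambda>_ z. z / sqrt (2 * real L)"]
    show "indep_vars (\<lambda>_. borel) u {..<2 * L}" by (simp add: ueq[abs_def])
    have E: "integrable M (\<lambda>\<omega>. (u i \<omega>)\<^sup>2)" "expectation (u i) = 0" "expectation (\<lambda>\<omega>. (u i \<omega>)\<^sup>2) = 1 / (2 * L)" if "i < 2 * L" for i
      using DD[of i] that unfolding ueq by (simp_all add: power_divide)
    then show "integrable M (\<lambda>\<omega>. (u i \<omega>)\<^sup>2)" "expectation (u i) = 0" if "i < 2 * L" for i using that by auto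
    show "(\<Sum>i<2 * L. expectation (\<lambda>\<omega>. (u i \<omega>)\<^sup>2)) \<le> 1" using E(3) L(5) by simp
  qed
  define y where "y m \<omega> = (\<Sum>i\<in>G m. u i \<omega>)" for m \<omega>
  have y: "centred_walk y (2 * L) 1"
    unfolding y_def[abs_def]
    by (intro centred_walk_group_sums[OF u]) (auto simp: G_def disjoint_family_on_def elim!: oddE split: if_splits)
  have \<tau>: "mono_on {..<2 * L} \<tau>" "\<tau> ` {..<2 * L} \<subseteq> {0..1}"
    by (auto simp: \<tau>_def mono_on_def divide_right_mono)
  obtain U where U: "integrable M U" "expectation U \<le> walk_const q 1 * var_rate q ^ k" "\<And>\<omega>. 0 \<le> U \<omega>"
    and Ub: "\<And>\<omega> f \<delta>. f \<in> F_class q \<delta> \<Longrightarrow> \<forall>i\<le>2 * L. \<bar>(\<Sum>m<i. u m \<omega>) - (\<Sum>m<i. y m \<omega>)\<bar> \<le> (1 / 2) ^ k \<Longrightarrow>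
        \<bar>(\<Sum>m<2 * L. f (\<tau> m) * u m \<omega>) - (\<Sum>m<2 * L. f (\<tau> m) * y m \<omega>)\<bar> \<le> U \<omega>"
    using two_walks_bound[OF u y q \<tau>, of k] by blast
  define B where "B = (\<Union>b<L. {\<omega> \<in> space M. ((1 / 2) ^ k) ^ 4 < (u (2 * b) \<omega>) ^ 4})"
  have Bb: "{\<omega> \<in> space M. ((1 / 2) ^ k) ^ 4 < (u (2 * b) \<omega>) ^ 4} \<in> events"
      "prob {\<omega> \<in> space M. ((1 / 2) ^ k) ^ 4 < (u (2 * b) \<omega>) ^ 4} \<le> (16 ^ k / 2 ^ K) / real L" if "b < L" for b
  proof -
    have int: "integrable M (\<lambda>\<omega>. (u (2 * b) \<omega>) ^ 4)" "expectation (\<lambda>\<omega>. (u (2 * b) \<omega>) ^ 4) = 3 / (4 * (real L * real L))"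
      using DD(6,7)[of "2 * b"] that
      unfolding ueq by (simp_all add: power_divide power4_eq_xxxx mult.assoc flip: real_sqrt_mult)
    have p16: "((1 / 2) ^ k) ^ 4 = 1 / (16 ^ k :: real)"
      by (simp add: power_mult[symmetric] power_divide mult.commute[of k 4]) (simp add: power_mult)
    have "0 < ((1 / 2) ^ k :: real) ^ 4" by simp
    note m = markov[OF int(1) _ this]
    show "{\<omega> \<in> space M. ((1 / 2) ^ k) ^ 4 < (u (2 * b) \<omega>) ^ 4} \<in> events" by (rule m(1)) simp
    have "prob {\<omega> \<in> space M. ((1 / 2) ^ k) ^ 4 < (u (2 * b) \<omega>) ^ 4} \<le> 3 / (4 * (real L * real L)) / ((1 / 2) ^ k) ^ 4"
      unfolding int(2)[symmetric] by (rule m(2)) simp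
    also have "\<dots> \<le> (16 ^ k / 2 ^ K) / real L"
      unfolding p16 L using L(5) by (simp add: field_simps)
    finally show "prob {\<omega> \<in> space M. ((1 / 2) ^ k) ^ 4 < (u (2 * b) \<omega>) ^ 4} \<le> (16 ^ k / 2 ^ K) / real L" .
  qed
  have B: "B \<in> events" unfolding B_def using Bb(1) by (intro sets.finite_UN) auto
  have "prob B \<le> (\<Sum>b<L. prob {\<omega> \<in> space M. ((1 / 2) ^ k) ^ 4 < (u (2 * b) \<omega>) ^ 4})"
    unfolding B_def using Bb(1) by (intro finite_measure_subadditive_finite) auto
  also have "\<dots> \<le> (\<Sum>b<L. (16 ^ k / 2 ^ K) / real L)" using Bb(2) by (intro sum_mono) auto
  also have "\<dots> = 16 ^ k / 2 ^ K" using L(5) by simp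
  finally have PB: "prob B \<le> 16 ^ k / 2 ^ K" .
  have pairs: "(\<Sum>m<2 * c. h m) = (\<Sum>b<c. h (2 * b) + h (Suc (2 * b)))" for h :: "nat \<Rightarrow> real" and c
    by (induction c) auto
  have y_pair: "y (2 * b) \<omega> = 0" "y (Suc (2 * b)) \<omega> = u (2 * b) \<omega> + u (Suc (2 * b)) \<omega>" for b \<omega>
    by (auto simp: y_def G_def)
  have refine: "u (2 * b) \<omega> + u (Suc (2 * b)) \<omega> = x K b \<omega>" for b \<omega>
    using dyadic_normal_refine[of \<xi> K b \<omega>] 
    by (simp add: u_def x_def add_divide_distrib[symmetric] real_sqrt_mult)
  have fine: "(\<Sum>m<2 * L. f (\<tau> m) * u m \<omega>) = (\<Sum>b<2 ^ Suc K. f (real (Suc b) / (2 ^ Suc K)) * x (Suc K) b \<omega>)"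
    and coarse: "(\<Sum>m<2 * L. f (\<tau> m) * y m \<omega>) = (\<Sum>b<2 ^ K. f (real (Suc b) / (2 ^ K)) * x K b \<omega>)" for f :: "real \<Rightarrow> real" and \<omega>
  proof -
    have "\<tau> (Suc (2 * b)) = real (Suc b) / real L" for b using L(5) by (simp add: \<tau>_def field_simps)
    then show "(\<Sum>m<2 * L. f (\<tau> m) * y m \<omega>) = (\<Sum>b<2 ^ K. f (real (Suc b) / (2 ^ K)) * x K b \<omega>)"
      unfolding pairs y_pair refine L(2,4) by simp
  qed (simp add: \<tau>_def u_def L_def)
  have near: "\<bar>(\<Sum>m<i. u m \<omega>) - (\<Sum>m<i. y m \<omega>)\<bar> \<le> (1 / 2) ^ k" if \<omega>: "\<omega> \<in> space M - B" and i: "i \<le> 2 * L" for i \<omega>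
  proof (cases "even i")
    case True
    then show ?thesis by (auto elim!: evenE simp: pairs y_pair)
  next
    case False
    then obtain c where c: "i = Suc (2 * c)" by (auto elim: oddE)
    have "\<bar>(\<Sum>m<i. u m \<omega>) - (\<Sum>m<i. y m \<omega>)\<bar> = \<bar>u (2 * c) \<omega>\<bar>" by (simp add: c pairs y_pair)
    moreover have "\<not> ((1 / 2) ^ k) ^ 4 < (u (2 * c) \<omega>) ^ 4" using \<omega> i c by (auto simp: B_def)
    then have "\<bar>u (2 * c) \<omega>\<bar> ^ 4 \<le> ((1 / 2) ^ k) ^ 4" by simp
    then have "\<bar>u (2 * c) \<omega>\<bar> \<le> (1 / 2) ^ k" by (rule power_le_imp_le_base[where n = 3, simplified]) simp
    ultimately show ?thesis by simp
  qed
  show ?thesis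
    using U B PB near Ub unfolding fine coarse by (intro exI[of _ U] exI[of _ B]) blast
qed

text \<open>The scale k = K div 8 makes both series converge: the exceptional events have
  probability at most 16^(K div 8) / 2^K \<le> (1/2)^(K div 2), and the mean errors are of order
  r^(K div 8). By Borel-Cantelli the levels are then almost surely Cauchy, uniformly over the
  class.\<close>

theorem dyadic_limit:
  fixes \<xi> :: "nat \<Rightarrow> 'a \<Rightarrow> real"
  assumes \<xi>: "iid_std_normal \<xi> UNIV" and q: "1 \<le> q" "q < 2" and \<delta>: "0 < \<delta>"
  shows "\<exists>G\<in>events. (AE \<omega> in M. \<omega> \<in> G) \<and> (\<exists>\<nu>. \<forall>\<omega>. \<nu> \<omega> \<in> mspace (linfty (F_class q \<delta>)) \<and>
     (\<lambda>K. mdist (linfty (F_class q \<delta>)) (block_map q \<delta> (2 ^ K) (\<lambda>b. indicator G \<omega> * (dyadic_normal \<xi> K b \<omega> / sqrt (2 ^ K)))) (\<nu> \<omega>)) \<longlonglongrightarrow> 0)"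
proof -
  define x where "x K b \<omega> = dyadic_normal \<xi> K b \<omega> / sqrt (2 ^ K)" for K b \<omega>
  define I where "I K f \<omega> = (\<Sum>b<2 ^ K. f (real (Suc b) / (2 ^ K)) * x K b \<omega>)" for K :: nat and f :: "real \<Rightarrow> real" and \<omega>
  define r where "r = var_rate q"
  have r: "0 < r" "r < 1" using var_rate_bounds[of q] q by (auto simp: r_def)
  let ?R = "\<lambda>K U B. integrable M U \<and> (\<forall>\<omega>. 0 \<le> U \<omega>) \<and> expectation U \<le> walk_const q 1 * r ^ (K div 8)
     \<and> B \<in> events \<and> prob B \<le> 16 ^ (K div 8) / 2 ^ K
     \<and> (\<forall>\<omega>\<in>space M - B. \<forall>f. f \<in> F_class q \<delta> \<longrightarrow> \<bar>I (Suc K) f \<omega> - I K f \<omega>\<bar> \<le> U \<omega>)"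
  have "\<forall>K. \<exists>U B. ?R K U B"
  proof
    fix K :: nat
    show "\<exists>U B. ?R K U B"
      using dyadic_level_bound[OF \<xi> q, where K = K and k = "K div 8"] unfolding I_def x_def r_def by blast
  qed
  from choice[OF this] obtain U where "\<forall>K. \<exists>B. ?R K (U K) B" by blast
  from choice[OF this] obtain B where U: "\<And>K. integrable M (U K)" "\<And>K \<omega>. 0 \<le> U K \<omega>" "\<And>K. expectation (U K) \<le> walk_const q 1 * r ^ (K div 8)"
    and B: "\<And>K. B K \<in> events" "\<And>K. prob (B K) \<le> 16 ^ (K div 8) / 2 ^ K"
    and UB: "\<And>K \<omega> f. \<omega> \<in> space M - B K \<Longrightarrow> f \<in> F_class q \<delta> \<Longrightarrow> \<bar>I (Suc K) f \<omega> - I K f \<omega>\<bar> \<le> U K \<omega>"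
    by blast
  have AE1: "AE \<omega> in M. summable (\<lambda>K. U K \<omega>)"
  proof (rule AE_summable[OF U(1,2)])
    show "summable (\<lambda>K. expectation (U K))"
      by (rule summable_comparison_test'[OF summable_mult[OF summable_power_div[OF r, of 8], of "walk_const q 1"], of 0])
         (use U in \<open>auto simp: Bochner_Integration.integral_nonneg\<close>)
  qed
  have AE2: "AE \<omega> in M. \<forall>\<^sub>F K in sequentially. \<omega> \<in> space M - B K"
  proof (rule borel_cantelli_AE1[OF B(1)])
    have "prob (B K) \<le> (1 / 2) ^ (K div 2)" for K
    proof -
      have "(16::real) ^ (K div 8) = 2 ^ (4 * (K div 8))" by (simp add: power_mult)
      also have "\<dots> \<le> 2 ^ (K - K div 2)" by (intro power_increasing) auto
      also have "\<dots> = 2 ^ K / 2 ^ (K div 2)" by (simp add: power_diff)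
      finally have "16 ^ (K div 8) / 2 ^ K \<le> (2 ^ K / 2 ^ (K div 2)) / (2::real) ^ K" by (intro divide_right_mono) auto
      then show ?thesis using B(2)[of K] by (simp add: power_divide)
    qed
    then show "summable (\<lambda>K. prob (B K))"
      by (intro summable_comparison_test'[OF summable_power_div[of "1 / 2" 2], of 0]) auto
  qed (simp add: emeasure_eq_measure)
  have "AE \<omega> in M. summable (\<lambda>K. U K \<omega>) \<and> (\<forall>\<^sub>F K in sequentially. \<omega> \<in> space M - B K)"
    using AE1 AE2 by eventually_elim auto
  from this[unfolded eventually_ae_filter] obtain N where N: "{\<omega> \<in> space M. \<not> (summable (\<lambda>K. U K \<omega>) \<and> (\<forall>\<^sub>F K in sequentially. \<omega> \<in> space M - B K))} \<subseteq> N" "N \<in> null_sets M"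
    by blast
  \<comment> \<open>The factor \<open>indicator G\<close> sets all levels to 0 outside G, so that
    the limit exists for every \<omega> and not just almost surely.\<close>
  define G where "G = space M - N"
  have G: "G \<in> events" "AE \<omega> in M. \<omega> \<in> G"
    using N(2) AE_not_in[OF N(2)] unfolding G_def by auto
  define Y where "Y K \<omega> = block_map q \<delta> (2 ^ K) (\<lambda>b. indicator G \<omega> * x K b \<omega>)" for K \<omega>
  have Y: "Y K \<omega> f = indicator G \<omega> * I K f \<omega> / sqrt (sq_integral f)" if "f \<in> F_class q \<delta>" for K \<omega> f
    using that by (simp add: Y_def I_def block_map_def sum_distrib_left mult_ac)
  have Yin: "Y K \<omega> \<in> mspace (linfty (F_class q \<delta>))" for K \<omega>
    unfolding Y_def by (rule block_map_in[OF q(1) \<delta>])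
  have "\<exists>\<nu>. \<nu> \<in> mspace (linfty (F_class q \<delta>)) \<and> (\<lambda>K. mdist (linfty (F_class q \<delta>)) (Y K \<omega>) \<nu>) \<longlonglongrightarrow> 0" for \<omega>
  proof (cases "\<omega> \<in> G")
    case False
    then have "Y K \<omega> = Y 0 \<omega>" for K
      unfolding Y_def by (auto simp: block_map_def)
    then have "mdist (linfty (F_class q \<delta>)) (Y K \<omega>) (Y 0 \<omega>) = 0" for K
      using Yin[of 0 \<omega>] Metric_space.mdist_zero[OF Metric_space_mspace_mdist] by metis
    then show ?thesis using Yin[of 0 \<omega>] by (intro exI[of _ "Y 0 \<omega>"]) auto
  next
    case True
    then have sum: "summable (\<lambda>K. U K \<omega>)" and "\<forall>\<^sub>F K in sequentially. \<omega> \<in> space M - B K"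
      using N(1) by (auto simp: G_def)
    then obtain K0 where K0: "\<And>K. K0 \<le> K \<Longrightarrow> \<omega> \<in> space M - B K" by (auto simp: eventually_sequentially)
    define R where "R K = (\<Sum>j. U (j + K) \<omega>)" for K
    have R0: "R \<longlonglongrightarrow> 0" unfolding R_def[abs_def] using suminf_exist_split2[OF sum] by (simp add: add.commute)
    have Rnn: "0 \<le> R K" for K
      unfolding R_def using U(2) summable_ignore_initial_segment[OF sum] by (intro suminf_nonneg) auto
    have diff: "\<bar>I (K + j) f \<omega> - I K f \<omega>\<bar> \<le> R K" if "K0 \<le> K" "f \<in> F_class q \<delta>" for K j f
    proof -
      have "\<bar>I (K + j) f \<omega> - I K f \<omega>\<bar> \<le> (\<Sum>i<j. U (i + K) \<omega>)"
      proof (induction j)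
        case (Suc j)
        have "\<bar>I (Suc (K + j)) f \<omega> - I (K + j) f \<omega>\<bar> \<le> U (K + j) \<omega>"
          using that K0[of "K + j"] by (intro UB) auto
        with Suc show ?case by (simp add: add.commute)
      qed simp
      also have "\<dots> \<le> R K"
        unfolding R_def using U(2) summable_ignore_initial_segment[OF sum] by (intro sum_le_suminf) auto
      finally show ?thesis .
    qed
    have "convergent (\<lambda>K. I K f \<omega>)" if f: "f \<in> F_class q \<delta>" for f
    proof (rule Cauchy_convergent, rule metric_CauchyI)
      fix e :: real assume "0 < e"
      then have "\<forall>\<^sub>F K in sequentially. R K < e / 2" using R0 by (intro order_tendstoD) auto
      then obtain K1 where K1: "\<And>K. K1 \<le> K \<Longrightarrow> R K < e / 2" by (auto simp: eventually_sequentially)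
      let ?K = "max K0 K1"
      have "dist (I m f \<omega>) (I n f \<omega>) < e" if "?K \<le> m" "?K \<le> n" for m n
        using diff[of ?K f "m - ?K"] diff[of ?K f "n - ?K"] f that K1[of ?K] by (simp add: dist_real_def)
      then show "\<exists>N. \<forall>m\<ge>N. \<forall>n\<ge>N. dist (I m f \<omega>) (I n f \<omega>) < e" by blast
    qed
    then have lim: "(\<lambda>K. I K f \<omega>) \<longlonglongrightarrow> lim (\<lambda>K. I K f \<omega>)" if "f \<in> F_class q \<delta>" for f
      using that convergent_LIMSEQ_iff by blast
    define \<nu> where "\<nu> = (\<lambda>f\<in>F_class q \<delta>. lim (\<lambda>K. I K f \<omega>) / sqrt (sq_integral f))"
    have near: "\<bar>Y K \<omega> f - \<nu> f\<bar> \<le> R K / sqrt \<delta>" if "K0 \<le> K" and f: "f \<in> F_class q \<delta>" for K f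
    proof -
      have "(\<lambda>j. \<bar>I (K + j) f \<omega> - I K f \<omega>\<bar>) \<longlonglongrightarrow> \<bar>lim (\<lambda>K. I K f \<omega>) - I K f \<omega>\<bar>"
        using LIMSEQ_ignore_initial_segment[OF lim[OF f], of K] by (intro tendsto_intros) (simp add: add.commute)
      then have "\<bar>lim (\<lambda>K. I K f \<omega>) - I K f \<omega>\<bar> \<le> R K"
        by (rule LIMSEQ_le_const2) (use diff[OF that] in auto)
      then have "\<bar>lim (\<lambda>K. I K f \<omega>) - I K f \<omega>\<bar> / sqrt (sq_integral f) \<le> R K / sqrt \<delta>"
        using sq_integral_gt[OF q(1) \<delta> f] \<delta> Rnn by (intro frac_le) auto
      then show ?thesis
        using True f sq_integral_gt[OF q(1) \<delta> f] \<delta>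
        by (simp add: Y \<nu>_def abs_minus_commute flip: diff_divide_distrib)
    qed
    have \<nu>in: "\<nu> \<in> mspace (linfty (F_class q \<delta>))"
      unfolding in_linfty_iff
    proof
      show "\<nu> \<in> extensional (F_class q \<delta>)" by (simp add: \<nu>_def)
      obtain c where c: "\<And>f. f \<in> F_class q \<delta> \<Longrightarrow> \<bar>Y K0 \<omega> f\<bar> \<le> c"
        using Yin[of K0 \<omega>] unfolding in_linfty_iff bounded_iff by auto
      have "\<bar>\<nu> f\<bar> \<le> c + R K0 / sqrt \<delta>" if "f \<in> F_class q \<delta>" for f
        using c[OF that] near[OF order.refl that] by linarith
      then show "bounded (\<nu> ` F_class q \<delta>)" unfolding bounded_iff by (auto intro!: exI[of _ "c + R K0 / sqrt \<delta>"])
    qed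
    have "(\<lambda>K. mdist (linfty (F_class q \<delta>)) (Y K \<omega>) \<nu>) \<longlonglongrightarrow> 0"
    proof (rule Lim_null_comparison)
      have "norm (mdist (linfty (F_class q \<delta>)) (Y K \<omega>) \<nu>) \<le> R K / sqrt \<delta>" if "K0 \<le> K" for K
      proof -
        have "mdist (linfty (F_class q \<delta>)) (Y K \<omega>) \<nu> \<le> R K / sqrt \<delta>"
          using Rnn \<delta> by (intro linfty_mdist_le Yin \<nu>in near that) auto
        then show ?thesis using mdist_nonneg[of "linfty (F_class q \<delta>)" "Y K \<omega>" \<nu>] by (simp del: mdist_funspace)
      qed
      then show "\<forall>\<^sub>F K in sequentially. norm (mdist (linfty (F_class q \<delta>)) (Y K \<omega>) \<nu>) \<le> R K / sqrt \<delta>"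
        by (auto simp: eventually_sequentially simp del: mdist_funspace)
      show "(\<lambda>K. R K / sqrt \<delta>) \<longlonglongrightarrow> 0" using tendsto_divide[OF R0 tendsto_const[of "sqrt \<delta>"]] \<delta> by simp
    qed
    with \<nu>in show ?thesis by blast
  qed
  then have "\<exists>\<nu>. \<forall>\<omega>. \<nu> \<omega> \<in> mspace (linfty (F_class q \<delta>)) \<and> (\<lambda>K. mdist (linfty (F_class q \<delta>)) (Y K \<omega>) (\<nu> \<omega>)) \<longlonglongrightarrow> 0"
    by (intro choice) blast
  then show ?thesis using G unfolding Y_def x_def by blast
qed

end

section \<open>Gaussianity, measurability and separability of the limit\<close>

lemma char_std_normal_scaled:
  "char (distr std_normal_distribution borel (\<lambda>x. s * x)) t = complex_of_real (exp (- (s * t)\<^sup>2 / 2))"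
proof -
  have "char (distr std_normal_distribution borel (\<lambda>x. s * x)) t = char std_normal_distribution (t * s)"
    unfolding char_def by (subst integral_distr) (auto simp: mult_ac)
  then show ?thesis by (simp add: char_std_normal_distribution mult.commute)
qed

context prob_space
begin

text \<open>Boundedness of the \<open>s n\<close> yields a subsequence along which they converge;
  the characteristic functions then identify the limit law. A limit l = 0 gives the degenerate case
  that \<open>gaussian_rv\<close> admits.\<close>

lemma gaussian_rv_limit:
  fixes T :: "nat \<Rightarrow> 'a \<Rightarrow> real"
  assumes T[measurable]: "\<And>n. T n \<in> borel_measurable M" and S[measurable]: "S \<in> borel_measurable M"
    and lim: "AE \<omega> in M. (\<lambda>n. T n \<omega>) \<longlonglongrightarrow> S \<omega>"
    and char: "\<And>n t. char (distr M borel (T n)) t = complex_of_real (exp (- (s n * t)\<^sup>2 / 2))"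
    and s: "\<And>n. \<bar>s n\<bar> \<le> C"
  shows "gaussian_rv M S"
proof -
  let ?\<Phi> = "std_normal_distribution"
  interpret \<Phi>: prob_space ?\<Phi> by (rule prob_space_std_normal)
  have "bounded (range s)" using s by (auto simp: bounded_iff)
  then obtain l r where r: "strict_mono (r :: nat \<Rightarrow> nat)" "(s \<circ> r) \<longlonglongrightarrow> l"
    using bounded_imp_convergent_subsequence by blast
  \<comment> \<open>|l| instead of l: the sign is invisible in the characteristic function, and a
    normal density needs a positive scale.\<close>
  have "char (distr M borel S) t = char (distr ?\<Phi> borel (\<lambda>x. \<bar>l\<bar> * x)) t" for t
  proof (rule LIMSEQ_unique)
    have "(\<lambda>n. CLINT \<omega>|M. iexp (t * T n \<omega>)) \<longlonglongrightarrow> (CLINT \<omega>|M. iexp (t * S \<omega>))"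
    proof (rule integral_dominated_convergence[where w = "\<lambda>_. 1"])
      show "AE \<omega> in M. (\<lambda>n. iexp (t * T n \<omega>)) \<longlonglongrightarrow> iexp (t * S \<omega>)"
        using lim by eventually_elim (intro tendsto_intros)
    qed auto
    then have "(\<lambda>n. char (distr M borel (T n)) t) \<longlonglongrightarrow> char (distr M borel S) t"
      by (simp add: char_def integral_distr)
    from LIMSEQ_subseq_LIMSEQ[OF this r(1)]
    show "(\<lambda>n. char (distr M borel (T (r n))) t) \<longlonglongrightarrow> char (distr M borel S) t" by (simp add: comp_def)
    have "(\<lambda>n. complex_of_real (exp (- (s (r n) * t)\<^sup>2 / 2))) \<longlonglongrightarrow> complex_of_real (exp (- (l * t)\<^sup>2 / 2))"
      using r(2) by (intro tendsto_intros) (auto simp: comp_def)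
    then show "(\<lambda>n. char (distr M borel (T (r n))) t) \<longlonglongrightarrow> char (distr ?\<Phi> borel (\<lambda>x. \<bar>l\<bar> * x)) t"
      unfolding char char_std_normal_scaled by (simp add: power_mult_distrib)
  qed
  then have eq: "distr M borel S = distr ?\<Phi> borel (\<lambda>x. \<bar>l\<bar> * x)"
    by (intro Levy_uniqueness real_distribution_distr \<Phi>.real_distribution_distr) auto
  show ?thesis
  proof (cases "l = 0")
    case True
    have "prob (S -` {0} \<inter> space M) = measure (distr ?\<Phi> borel (\<lambda>x. \<bar>l\<bar> * x)) {0}"
      unfolding eq[symmetric] by (subst measure_distr) auto
    also have "\<dots> = 1" using True \<Phi>.prob_space by (simp add: measure_return)
    finally have "AE \<omega> in M. S \<omega> = 0" by (subst (asm) prob_eq_1) auto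
    then show ?thesis unfolding gaussian_rv_def using S by blast
  next
    case False
    have "distributed ?\<Phi> lborel (\<lambda>x. x) std_normal_density"
      by (auto simp: distributed_def distr_id2)
    from \<Phi>.normal_density_affine[OF this, of "\<bar>l\<bar>" 0] False
    have "distributed ?\<Phi> lborel (\<lambda>x. \<bar>l\<bar> * x) (normal_density 0 \<bar>l\<bar>)" by simp
    then have "distr ?\<Phi> lborel (\<lambda>x. \<bar>l\<bar> * x) = density lborel (normal_density 0 \<bar>l\<bar>)"
      by (simp add: distributed_def)
    moreover have "distr ?\<Phi> lborel (\<lambda>x. \<bar>l\<bar> * x) = distr ?\<Phi> borel (\<lambda>x. \<bar>l\<bar> * x)" "distr M lborel S = distr M borel S"
      by (intro distr_cong; simp)+
    ultimately have "distributed M lborel S (normal_density 0 \<bar>l\<bar>)"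
      using eq S by (auto simp: distributed_def)
    then show ?thesis unfolding gaussian_rv_def using S False by (intro conjI exI[of _ 0] disjI2 exI[of _ "\<bar>l\<bar>"]) auto
  qed
qed

lemma char_weighted_normals:
  fixes N :: "nat \<Rightarrow> 'a \<Rightarrow> real" and w :: "nat \<Rightarrow> real"
  assumes N: "iid_std_normal N {..<L}"
  shows "char (distr M borel (\<lambda>\<omega>. \<Sum>b<L. w b * N b \<omega>)) t = complex_of_real (exp (- (sqrt (\<Sum>b<L. (w b)\<^sup>2) * t)\<^sup>2 / 2))"
proof -
  have ind: "indep_vars (\<lambda>_. borel) (\<lambda>b \<omega>. w b * N b \<omega>) {..<L}"
    using indep_vars_compose2[of "\<lambda>_. borel" N "{..<L}" "\<lambda>b z. w b * z" "\<lambda>_. borel"] N by (simp add: iid_std_normal_def)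
  have "char (distr M borel (\<lambda>\<omega>. w b * N b \<omega>)) t = complex_of_real (exp (- (w b * t)\<^sup>2 / 2))" if "b < L" for b
  proof -
    have "distr M borel (\<lambda>\<omega>. w b * N b \<omega>) = distr (distr M borel (N b)) borel (\<lambda>x. w b * x)"
      using iid_std_normalD(1)[OF N, of b] that by (subst distr_distr) (auto simp: comp_def)
    then show ?thesis using iid_std_normalD(2)[OF N, of b] that by (simp add: char_std_normal_scaled)
  qed
  then have "char (distr M borel (\<lambda>\<omega>. \<Sum>b<L. w b * N b \<omega>)) t = (\<Prod>b<L. complex_of_real (exp (- (w b * t)\<^sup>2 / 2)))"
    unfolding char_distr_sum[OF ind] by (intro prod.cong) auto
  also have "\<dots> = complex_of_real (exp (\<Sum>b<L. - (w b * t)\<^sup>2 / 2))"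
    by (simp add: exp_sum)
  also have "(\<Sum>b<L. - (w b * t)\<^sup>2 / 2) = - (sqrt (\<Sum>b<L. (w b)\<^sup>2) * t)\<^sup>2 / 2"
    by (simp add: power_mult_distrib sum_nonneg sum_negf flip: sum_divide_distrib sum_distrib_right)
  finally show ?thesis .
qed

text \<open>A linear combination of the approximations is, almost surely, a weighted sum of the
  independent normals of level K. Each squared weight is at most C^2 / 2^K, so the variances stay
  below C^2 and \<open>gaussian_rv_limit\<close> applies.\<close>

lemma gaussian_process_dyadic:
  fixes \<xi> :: "nat \<Rightarrow> 'a \<Rightarrow> real"
  assumes \<xi>: "iid_std_normal \<xi> UNIV" and q: "1 \<le> q" and \<delta>: "0 < \<delta>"
    and G: "G \<in> events" "AE \<omega> in M. \<omega> \<in> G"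
    and \<nu>: "\<And>\<omega>. \<nu> \<omega> \<in> mspace (linfty (F_class q \<delta>))"
    and lim: "\<And>\<omega>. (\<lambda>K. mdist (linfty (F_class q \<delta>)) (block_map q \<delta> (2 ^ K) (\<lambda>b. indicator G \<omega> * (dyadic_normal \<xi> K b \<omega> / sqrt (2 ^ K)))) (\<nu> \<omega>)) \<longlonglongrightarrow> 0"
  shows "gaussian_process M (F_class q \<delta>) \<nu>"
  unfolding gaussian_process_def
proof (intro allI impI)
  fix J and c :: "(real \<Rightarrow> real) \<Rightarrow> real" assume J: "finite J \<and> J \<subseteq> F_class q \<delta>"
  define Y where "Y K \<omega> = block_map q \<delta> (2 ^ K) (\<lambda>b. indicator G \<omega> * (dyadic_normal \<xi> K b \<omega> / sqrt (2 ^ K)))" for K \<omega>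
  define T where "T K \<omega> = (\<Sum>f\<in>J. c f * Y K \<omega> f)" for K \<omega>
  define w where "w K b = (\<Sum>f\<in>J. c f * f (real (Suc b) / 2 ^ K) / sqrt (sq_integral f)) / sqrt (2 ^ K)" for K b
  note N = iid_dyadic_normal[OF \<xi>]
  have T: "T K \<omega> = indicator G \<omega> * (\<Sum>b<2 ^ K. w K b * dyadic_normal \<xi> K b \<omega>)" for K \<omega>
  proof -
    have "T K \<omega> = (\<Sum>f\<in>J. \<Sum>b<2 ^ K. indicator G \<omega> * (c f * f (real (Suc b) / 2 ^ K) / sqrt (sq_integral f) / sqrt (2 ^ K) * dyadic_normal \<xi> K b \<omega>))"
      unfolding T_def using J
      by (intro sum.cong refl) (auto simp: Y_def block_map_def sum_distrib_left sum_divide_distrib mult_ac intro!: sum.cong)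
    also have "\<dots> = (\<Sum>b<2 ^ K. \<Sum>f\<in>J. indicator G \<omega> * (c f * f (real (Suc b) / 2 ^ K) / sqrt (sq_integral f) / sqrt (2 ^ K) * dyadic_normal \<xi> K b \<omega>))"
      by (rule sum.swap)
    also have "\<dots> = indicator G \<omega> * (\<Sum>b<2 ^ K. w K b * dyadic_normal \<xi> K b \<omega>)"
      by (simp add: w_def sum_distrib_left sum_distrib_right sum_divide_distrib)
    finally show ?thesis .
  qed
  have Nm: "dyadic_normal \<xi> K b \<in> borel_measurable M" if "b < 2 ^ K" for K b
    using iid_std_normalD(1)[OF N] that by auto
  have sm: "(\<lambda>\<omega>. \<Sum>b<2 ^ K. w K b * dyadic_normal \<xi> K b \<omega>) \<in> borel_measurable M" for K
    using Nm by (intro borel_measurable_sum borel_measurable_times) auto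
  have Tm: "T K \<in> borel_measurable M" for K
    unfolding T[abs_def] using sm G(1) by (intro borel_measurable_times borel_measurable_indicator) auto
  have tends: "(\<lambda>K. T K \<omega>) \<longlonglongrightarrow> (\<Sum>f\<in>J. c f * \<nu> \<omega> f)" for \<omega>
    unfolding T_def
  proof (intro tendsto_sum tendsto_mult tendsto_const)
    fix f assume "f \<in> J"
    then have f: "f \<in> F_class q \<delta>" using J by auto
    have "(\<lambda>K. Y K \<omega> f - \<nu> \<omega> f) \<longlonglongrightarrow> 0"
    proof (rule Lim_null_comparison[OF always_eventually lim[of \<omega>]], rule allI)
      fix K show "norm (Y K \<omega> f - \<nu> \<omega> f) \<le> mdist (linfty (F_class q \<delta>)) (block_map q \<delta> (2 ^ K) (\<lambda>b. indicator G \<omega> * (dyadic_normal \<xi> K b \<omega> / sqrt (2 ^ K)))) (\<nu> \<omega>)"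
        unfolding Y_def real_norm_def by (rule linfty_abs_diff_le[OF block_map_in[OF q \<delta>] \<nu> f])
    qed
    then show "(\<lambda>K. Y K \<omega> f) \<longlonglongrightarrow> \<nu> \<omega> f" using LIM_zero_iff by blast
  qed
  define C where "C = (\<Sum>f\<in>J. \<bar>c f\<bar> / sqrt \<delta>)"
  have C: "0 \<le> C" unfolding C_def using \<delta> by (intro sum_nonneg) auto
  have w: "(w K b)\<^sup>2 \<le> C\<^sup>2 / 2 ^ K" if "b < 2 ^ K" for K b
  proof -
    have "\<bar>\<Sum>f\<in>J. c f * f (real (Suc b) / 2 ^ K) / sqrt (sq_integral f)\<bar> \<le> C"
      unfolding C_def
    proof (intro order.trans[OF sum_abs] sum_mono)
      fix f assume "f \<in> J"
      then have f: "f \<in> F_class q \<delta>" using J by auto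
      have "real (Suc b) \<le> 2 ^ K" using that by (metis Suc_leI of_nat_le_iff of_nat_numeral of_nat_power)
      then have "\<bar>f (real (Suc b) / 2 ^ K)\<bar> \<le> 1" by (intro F_class_abs_le_1[OF q f]) auto
      then have "\<bar>c f\<bar> * \<bar>f (real (Suc b) / 2 ^ K)\<bar> / sqrt (sq_integral f) \<le> \<bar>c f\<bar> / sqrt \<delta>"
        using sq_integral_gt[OF q \<delta> f] \<delta> by (intro frac_le) (auto simp: mult_left_le)
      then show "\<bar>c f * f (real (Suc b) / 2 ^ K) / sqrt (sq_integral f)\<bar> \<le> \<bar>c f\<bar> / sqrt \<delta>"
        using sq_integral_gt[OF q \<delta> f] \<delta> by (simp add: abs_mult)
    qed
    then have "(\<Sum>f\<in>J. c f * f (real (Suc b) / 2 ^ K) / sqrt (sq_integral f))\<^sup>2 \<le> C\<^sup>2"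
      using C by (intro abs_le_square_iff[THEN iffD1]) simp
    then show ?thesis by (simp add: w_def power_divide divide_right_mono)
  qed
  show "gaussian_rv M (\<lambda>\<omega>. \<Sum>f\<in>J. c f * \<nu> \<omega> f)"
  proof (rule gaussian_rv_limit[OF Tm])
    show "(\<lambda>\<omega>. \<Sum>f\<in>J. c f * \<nu> \<omega> f) \<in> borel_measurable M"
      by (rule borel_measurable_LIMSEQ_real[OF tends Tm])
    show "AE \<omega> in M. (\<lambda>K. T K \<omega>) \<longlonglongrightarrow> (\<Sum>f\<in>J. c f * \<nu> \<omega> f)" using tends by simp
    show "char (distr M borel (T K)) t = complex_of_real (exp (- (sqrt (\<Sum>b<2 ^ K. (w K b)\<^sup>2) * t)\<^sup>2 / 2))" for K t
    proof -
      have "AE \<omega> in M. T K \<omega> = (\<Sum>b<2 ^ K. w K b * dyadic_normal \<xi> K b \<omega>)"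
        using G(2) by eventually_elim (simp add: T)
      then have "distr M borel (T K) = distr M borel (\<lambda>\<omega>. \<Sum>b<2 ^ K. w K b * dyadic_normal \<xi> K b \<omega>)"
        using Tm sm by (intro distr_cong_AE) auto
      then show ?thesis using char_weighted_normals[OF N] by simp
    qed
    show "\<bar>sqrt (\<Sum>b<2 ^ K. (w K b)\<^sup>2)\<bar> \<le> C" for K
    proof -
      have "(\<Sum>b<2 ^ K. (w K b)\<^sup>2) \<le> (\<Sum>b<(2::nat) ^ K. C\<^sup>2 / 2 ^ K)" using w by (intro sum_mono) auto
      also have "\<dots> = C\<^sup>2" by simp
      finally have "sqrt (\<Sum>b<2 ^ K. (w K b)\<^sup>2) \<le> sqrt (C\<^sup>2)" by (rule real_sqrt_le_mono)
      then show ?thesis using C by (simp add: sum_nonneg)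
    qed
  qed
qed

text \<open>The factor \<open>c\<close> serves two uses: 1 for the process \<nu> itself and \<sigma>
  A for the limit of the estimators.\<close>

lemma pointwise_limit_dyadic:
  fixes \<xi> :: "nat \<Rightarrow> 'a \<Rightarrow> real"
  assumes \<xi>: "iid_std_normal \<xi> UNIV" and q: "1 \<le> q" and \<delta>: "0 < \<delta>"
    and G: "G \<in> events"
    and \<nu>: "\<And>\<omega>. \<nu> \<omega> \<in> mspace (linfty (F_class q \<delta>))"
    and lim: "\<And>\<omega>. (\<lambda>K. mdist (linfty (F_class q \<delta>)) (block_map q \<delta> (2 ^ K) (\<lambda>b. indicator G \<omega> * (dyadic_normal \<xi> K b \<omega> / sqrt (2 ^ K)))) (\<nu> \<omega>)) \<longlonglongrightarrow> 0"
  shows "pointwise_limit M (linfty (F_class q \<delta>))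
     (\<lambda>K \<omega>. block_map q \<delta> (2 ^ K) (\<lambda>b. c * (indicator G \<omega> * (dyadic_normal \<xi> K b \<omega> / sqrt (2 ^ K))))) (\<lambda>\<omega>. \<lambda>f\<in>F_class q \<delta>. c * \<nu> \<omega> f)"
proof unfold_locales
  let ?E = "linfty (F_class q \<delta>)"
  let ?x = "\<lambda>K \<omega> b. indicator G \<omega> * (dyadic_normal \<xi> K b \<omega> / sqrt (2 ^ K))"
  note bin = block_map_in[OF q \<delta>]
  show "(\<lambda>\<omega>. block_map q \<delta> (2 ^ K) (\<lambda>b. c * ?x K \<omega> b)) \<in> space M \<rightarrow> mspace ?E" for K
    using bin by auto
  have cin: "(\<lambda>f\<in>F_class q \<delta>. c * \<nu> \<omega> f) \<in> mspace ?E" for \<omega>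
  proof -
    obtain C where C: "\<And>f. f \<in> F_class q \<delta> \<Longrightarrow> \<bar>\<nu> \<omega> f\<bar> \<le> C"
      using \<nu>[of \<omega>] unfolding in_linfty_iff bounded_iff by auto
    then have "\<bar>c * \<nu> \<omega> f\<bar> \<le> \<bar>c\<bar> * C" if "f \<in> F_class q \<delta>" for f
      using that by (simp add: abs_mult mult_left_mono)
    then show ?thesis unfolding in_linfty_iff bounded_iff by (auto intro!: exI[of _ "\<bar>c\<bar> * C"])
  qed
  then show "(\<lambda>\<omega>. \<lambda>f\<in>F_class q \<delta>. c * \<nu> \<omega> f) \<in> space M \<rightarrow> mspace ?E" by auto
  show "(\<lambda>K. mdist ?E (block_map q \<delta> (2 ^ K) (\<lambda>b. c * ?x K \<omega> b)) (\<lambda>f\<in>F_class q \<delta>. c * \<nu> \<omega> f)) \<longlonglongrightarrow> 0" for \<omega>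
  proof (rule Lim_null_comparison[OF always_eventually], rule allI)
    fix K
    have "mdist ?E (block_map q \<delta> (2 ^ K) (\<lambda>b. c * ?x K \<omega> b)) (\<lambda>f\<in>F_class q \<delta>. c * \<nu> \<omega> f)
       \<le> \<bar>c\<bar> * mdist ?E (block_map q \<delta> (2 ^ K) (?x K \<omega>)) (\<nu> \<omega>)"
    proof (rule linfty_mdist_le[OF bin cin])
      show "0 \<le> \<bar>c\<bar> * mdist ?E (block_map q \<delta> (2 ^ K) (?x K \<omega>)) (\<nu> \<omega>)"
        by (intro mult_nonneg_nonneg mdist_nonneg) simp
      fix f assume f: "f \<in> F_class q \<delta>"
      show "\<bar>block_map q \<delta> (2 ^ K) (\<lambda>b. c * ?x K \<omega> b) f - (\<lambda>f\<in>F_class q \<delta>. c * \<nu> \<omega> f) f\<bar>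
          \<le> \<bar>c\<bar> * mdist ?E (block_map q \<delta> (2 ^ K) (?x K \<omega>)) (\<nu> \<omega>)"
        unfolding block_map_scale[OF q \<delta> f, of "2 ^ K" c "?x K \<omega>"] restrict_apply'[OF f] right_diff_distrib[symmetric] abs_mult
        by (intro mult_left_mono linfty_abs_diff_le[OF bin \<nu> f]) simp
    qed
    then show "norm (mdist ?E (block_map q \<delta> (2 ^ K) (\<lambda>b. c * ?x K \<omega> b)) (\<lambda>f\<in>F_class q \<delta>. c * \<nu> \<omega> f))
       \<le> \<bar>c\<bar> * mdist ?E (block_map q \<delta> (2 ^ K) (?x K \<omega>)) (\<nu> \<omega>)"
      by (simp del: mdist_funspace)
  next
    show "(\<lambda>K. \<bar>c\<bar> * mdist ?E (block_map q \<delta> (2 ^ K) (?x K \<omega>)) (\<nu> \<omega>)) \<longlonglongrightarrow> 0"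
      using tendsto_mult_right_zero[OF lim[of \<omega>], of "\<bar>c\<bar>"] by simp
  qed
  fix K h assume h: "bounded_lipschitz ?E h"
  \<comment> \<open>\<open>iid_dyadic_normal\<close> gives measurability for b < 2^K; the truncation
    there leaves \<open>block_map\<close> unchanged.\<close>
  let ?V = "\<lambda>b \<omega>. if b < 2 ^ K then c * ?x K \<omega> b else 0"
  have "(\<lambda>\<omega>. h (block_map q \<delta> (2 ^ K) (\<lambda>b. ?V b \<omega>))) \<in> borel_measurable M"
  proof (rule l1_lipschitz_compose_measurable[OF l1_lipschitz_block_map[OF q \<delta> h]])
    fix b
    show "?V b \<in> borel_measurable M"
    proof (cases "b < 2 ^ K")
      case True
      then have [measurable]: "dyadic_normal \<xi> K b \<in> borel_measurable M"
        using iid_std_normalD(1)[OF iid_dyadic_normal[OF \<xi>]] by auto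
      show ?thesis using True G by simp
    qed simp
  qed
  moreover have "block_map q \<delta> (2 ^ K) (\<lambda>b. ?V b \<omega>) = block_map q \<delta> (2 ^ K) (\<lambda>b. c * ?x K \<omega> b)" for \<omega>
    unfolding block_map_def by (intro restrict_ext arg_cong2[where f = "(/)"] sum.cong) auto
  ultimately show "(\<lambda>\<omega>. h (block_map q \<delta> (2 ^ K) (\<lambda>b. c * ?x K \<omega> b))) \<in> borel_measurable M" by simp
qed

end

text \<open>The images under \<open>block_map\<close> of finite rational vectors form a countable
  set; by \<open>block_map_mdist_le\<close> they come arbitrarily close to every approximation,
  hence to the limit.\<close>

lemma block_map_limit_separable:
  assumes q: "1 \<le> q" and \<delta>: "0 < \<delta>" and lim: "pointwise_limit P (linfty (F_class q \<delta>)) (\<lambda>K \<omega>. block_map q \<delta> (L K) (x K \<omega>)) Y"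
  shows "separably_valued P (linfty (F_class q \<delta>)) Y"
proof -
  interpret pointwise_limit P "linfty (F_class q \<delta>)" "\<lambda>K \<omega>. block_map q \<delta> (L K) (x K \<omega>)" Y by fact
  let ?E = "linfty (F_class q \<delta>)"
  define B where "B = (\<lambda>(l, xs :: rat list). block_map q \<delta> l (\<lambda>b. if b < length xs then real_of_rat (xs ! b) else 0))"
  note bin = block_map_in[OF q \<delta>]
  show ?thesis
  proof (rule Y_separably_valued[of "range B"])
    show "countable (range B)" by simp
    show "range B \<subseteq> mspace ?E" using bin by (auto simp: B_def)
    fix \<omega> and e :: real assume \<omega>: "\<omega> \<in> space P" and e: "0 < e"
    have "\<forall>\<^sub>F K in sequentially. mdist ?E (block_map q \<delta> (L K) (x K \<omega>)) (Y \<omega>) < e / 2"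
      using e by (intro order_tendstoD(2)[OF Ys_lim[OF \<omega>]]) auto
    then obtain K where K: "mdist ?E (block_map q \<delta> (L K) (x K \<omega>)) (Y \<omega>) < e / 2"
      by (auto simp: eventually_sequentially simp del: mdist_funspace)
    \<comment> \<open>Room for \<open>L K\<close> coordinates, each off by d; the \<open>+ 1\<close>
      covers \<open>L K = 0\<close>.\<close>
    define d where "d = e / 2 * sqrt \<delta> / (real (L K) + 1)"
    have "real (L K) * d / sqrt \<delta> = real (L K) / (real (L K) + 1) * (e / 2)"
      using \<delta> by (simp add: d_def)
    also have "\<dots> < 1 * (e / 2)" using e by (intro mult_strict_right_mono) auto
    finally have d: "0 < d" "real (L K) * d / sqrt \<delta> < e / 2"
      using e \<delta> by (auto simp: d_def)
    have "\<exists>r. \<bar>x K \<omega> b - real_of_rat r\<bar> < d" for b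
    proof -
      obtain r where r: "x K \<omega> b - d < real_of_rat r" "real_of_rat r < x K \<omega> b"
        using of_rat_dense[of "x K \<omega> b - d" "x K \<omega> b"] d(1) by auto
      then show ?thesis by (intro exI[of _ r]) auto
    qed
    then obtain \<rho> where \<rho>: "\<And>b. \<bar>x K \<omega> b - real_of_rat (\<rho> b)\<bar> < d" by metis
    define xs where "xs = map \<rho> [0..<L K]"
    let ?r = "\<lambda>b. if b < length xs then real_of_rat (xs ! b) else 0"
    have "mdist ?E (block_map q \<delta> (L K) (x K \<omega>)) (block_map q \<delta> (L K) ?r) \<le> (\<Sum>b<L K. \<bar>x K \<omega> b - ?r b\<bar>) / sqrt \<delta>"
      by (rule block_map_mdist_le[OF q \<delta>])
    also have "\<dots> \<le> (\<Sum>b<L K. d) / sqrt \<delta>"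
      using \<rho> \<delta> by (intro divide_right_mono sum_mono) (auto simp: xs_def less_imp_le)
    also have "\<dots> < e / 2" using d by simp
    finally have "mdist ?E (block_map q \<delta> (L K) (x K \<omega>)) (block_map q \<delta> (L K) ?r) < e / 2" .
    moreover have "mdist ?E (Y \<omega>) (block_map q \<delta> (L K) ?r) \<le> mdist ?E (Y \<omega>) (block_map q \<delta> (L K) (x K \<omega>))
        + mdist ?E (block_map q \<delta> (L K) (x K \<omega>)) (block_map q \<delta> (L K) ?r)"
      using Y_in \<omega> by (intro mdist_triangle bin) auto
    ultimately have "mdist ?E (Y \<omega>) (B (L K, xs)) < e"
      using K by (simp add: B_def mdist_commute[of ?E "Y \<omega>"] del: mdist_funspace)
    then show "\<exists>c\<in>range B. mdist ?E (Y \<omega>) c < e" by blast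
  qed
qed

section \<open>Weighted sums of a linear process\<close>

context prob_space
begin

text \<open>Let D be a normalised block sum. Its variance tends to \<sigma>^2 / L, and min (D^2)
  (\<epsilon>^2) is a bounded Lipschitz function of it, so \<open>block_clt\<close> turns the bound
  of \<open>maximal_inequality\<close> into its Gaussian counterpart. The Gaussian fourth moment
  bounds this by 3 \<sigma>^4 / (L^2 \<epsilon>^2) per block; summing over L blocks and dividing by
  \<epsilon>^2 leaves a factor 1 / L.\<close>

lemma osc_event_eventually_small:
  fixes X :: "nat \<Rightarrow> 'a \<Rightarrow> real" and N :: "nat \<Rightarrow> 'b \<Rightarrow> real"
  assumes X: "indep_vars (\<lambda>_. borel) X UNIV" and eq: "\<And>i j. distr M borel (X i) = distr M borel (X j)"
    and mean: "\<And>i. expectation (X i) = 0" and sq: "\<And>i. integrable M (\<lambda>\<omega>. (X i \<omega>)\<^sup>2)" "\<And>i. expectation (\<lambda>\<omega>. (X i \<omega>)\<^sup>2) = \<sigma>\<^sup>2"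
    and \<sigma>: "0 < \<sigma>" and L: "0 < L"
    and P: "prob_space P" "prob_space.iid_std_normal P N {..<L}"
    and \<epsilon>: "0 < \<epsilon>" and e: "3 * \<sigma> ^ 4 / (L * \<epsilon> ^ 4) < e"
  shows "\<forall>\<^sub>F n in sequentially. prob (osc_event M (\<lambda>i \<omega>. X i \<omega> / sqrt n) n L \<epsilon>) \<le> e"
proof -
  interpret P: prob_space P by fact
  define D where "D n b \<omega> = (\<Sum>i=block_start n L b..<block_start n L (Suc b). X i \<omega>) / sqrt n" for n b \<omega>
  define \<phi> where "\<phi> y = min (y\<^sup>2) (\<epsilon>\<^sup>2)" for y :: real
  have \<phi>_lip: "\<bar>\<phi> y - \<phi> z\<bar> \<le> 2 * \<epsilon> * \<bar>y - z\<bar>" for y z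
  proof -
    have \<phi>: "\<phi> y = (min \<bar>y\<bar> \<epsilon>)\<^sup>2" for y
      using \<epsilon> abs_le_square_iff[of y \<epsilon>] by (auto simp: \<phi>_def min_def)
    have "\<bar>(min \<bar>y\<bar> \<epsilon>)\<^sup>2 - (min \<bar>z\<bar> \<epsilon>)\<^sup>2\<bar> = \<bar>min \<bar>y\<bar> \<epsilon> + min \<bar>z\<bar> \<epsilon>\<bar> * \<bar>min \<bar>y\<bar> \<epsilon> - min \<bar>z\<bar> \<epsilon>\<bar>"
      by (simp add: abs_mult[symmetric] power2_eq_square algebra_simps)
    also have "\<dots> \<le> (2 * \<epsilon>) * \<bar>y - z\<bar>" using \<epsilon> by (intro mult_mono) auto
    finally show ?thesis by (simp add: \<phi>)
  qed
  have Nn: "P.indep_vars (\<lambda>_. borel) N {..<L}" "\<And>b. b < L \<Longrightarrow> distr P borel (N b) = std_normal_distribution"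
    using P(2) by (auto simp: P.iid_std_normal_def)
  have limb: "(\<lambda>n. expectation (\<lambda>\<omega>. (D n b \<omega>)\<^sup>2) - expectation (\<lambda>\<omega>. \<phi> (D n b \<omega>)))
     \<longlonglongrightarrow> \<sigma>\<^sup>2 / L - P.expectation (\<lambda>\<omega>. \<phi> (\<sigma> / sqrt L * N b \<omega>))" if b: "b < L" for b
  proof (rule tendsto_diff)
    have l1: "l1_lipschitz L (\<lambda>x. \<phi> (x b))"
      unfolding l1_lipschitz_def
    proof (intro exI[of _ "2 * \<epsilon>"] allI)
      fix x y :: "nat \<Rightarrow> real"
      have "\<bar>x b - y b\<bar> \<le> (\<Sum>b<L. \<bar>x b - y b\<bar>)" using b by (intro member_le_sum) auto
      then have "2 * \<epsilon> * \<bar>x b - y b\<bar> \<le> 2 * \<epsilon> * (\<Sum>b<L. \<bar>x b - y b\<bar>)" using \<epsilon> by (intro mult_left_mono) auto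
      with \<phi>_lip[of "x b" "y b"] show "\<bar>\<phi> (x b) - \<phi> (y b)\<bar> \<le> 2 * \<epsilon> * (\<Sum>b<L. \<bar>x b - y b\<bar>)" by linarith
    qed
    have "\<bar>\<phi> y\<bar> \<le> \<epsilon>\<^sup>2" for y by (auto simp: \<phi>_def abs_le_iff)
    from block_clt[OF X eq mean sq \<sigma> L P(1) Nn l1 this]
    show "(\<lambda>n. expectation (\<lambda>\<omega>. \<phi> (D n b \<omega>))) \<longlonglongrightarrow> P.expectation (\<lambda>\<omega>. \<phi> (\<sigma> / sqrt L * N b \<omega>))"
      by (simp add: D_def)
    have "expectation (\<lambda>\<omega>. (D n b \<omega>)\<^sup>2) = real (block_start n L (Suc b) - block_start n L b) / n * \<sigma>\<^sup>2" for n
    proof -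
      have "expectation (\<lambda>\<omega>. (\<Sum>i=block_start n L b..<block_start n L (Suc b). X i \<omega>)\<^sup>2) = (\<Sum>i=block_start n L b..<block_start n L (Suc b). \<sigma>\<^sup>2)"
        using sum_square_integral[OF indep_vars_subset[OF X], of "{block_start n L b..<block_start n L (Suc b)}"] sq mean by simp
      then show ?thesis unfolding D_def by (simp add: power_divide)
    qed
    then show "(\<lambda>n. expectation (\<lambda>\<omega>. (D n b \<omega>)\<^sup>2)) \<longlonglongrightarrow> \<sigma>\<^sup>2 / L"
      using tendsto_mult[OF block_length_limits(2)[OF L, of b] tendsto_const[of "\<sigma>\<^sup>2"]] by simp
  qed
  have tail: "\<sigma>\<^sup>2 / L - P.expectation (\<lambda>\<omega>. \<phi> (\<sigma> / sqrt L * N b \<omega>)) \<le> 3 * \<sigma> ^ 4 / (L\<^sup>2 * \<epsilon>\<^sup>2)" if b: "b < L" for b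
  proof -
    note ND = P.iid_std_normalD[OF P(2), of b, simplified, OF b]
    define T where "T \<omega> = \<sigma> / sqrt L * N b \<omega>" for \<omega>
    have T2: "(T \<omega>)\<^sup>2 = \<sigma>\<^sup>2 / L * (N b \<omega>)\<^sup>2" and T4: "(T \<omega>) ^ 4 = \<sigma> ^ 4 / L\<^sup>2 * (N b \<omega>) ^ 4" for \<omega>
      by (simp_all add: T_def power_mult_distrib power_divide power4_eq_xxxx power2_eq_square mult_ac)
    have T[measurable]: "T \<in> borel_measurable P" unfolding T_def[abs_def] using ND(1) by measurable
    have i2: "integrable P (\<lambda>\<omega>. (T \<omega>)\<^sup>2)" "P.expectation (\<lambda>\<omega>. (T \<omega>)\<^sup>2) = \<sigma>\<^sup>2 / L"
      unfolding T2 using ND by simp_all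
    have i4: "integrable P (\<lambda>\<omega>. (T \<omega>) ^ 4)" "P.expectation (\<lambda>\<omega>. (T \<omega>) ^ 4) = 3 * \<sigma> ^ 4 / L\<^sup>2"
      unfolding T4 using ND by simp_all
    have i\<phi>: "integrable P (\<lambda>\<omega>. \<phi> (T \<omega>))"
      unfolding \<phi>_def by (intro P.integrable_const_bound[where B = "\<epsilon>\<^sup>2"]) auto
    have "\<sigma>\<^sup>2 / L - P.expectation (\<lambda>\<omega>. \<phi> (T \<omega>)) = P.expectation (\<lambda>\<omega>. (T \<omega>)\<^sup>2 - \<phi> (T \<omega>))"
      using i2 i\<phi> by simp
    also have "\<dots> \<le> P.expectation (\<lambda>\<omega>. (T \<omega>) ^ 4 / \<epsilon>\<^sup>2)"
    proof (intro integral_mono)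
      fix \<omega>
      show "(T \<omega>)\<^sup>2 - \<phi> (T \<omega>) \<le> (T \<omega>) ^ 4 / \<epsilon>\<^sup>2"
      proof (cases "(T \<omega>)\<^sup>2 \<le> \<epsilon>\<^sup>2")
        case False
        then have "(T \<omega>)\<^sup>2 * \<epsilon>\<^sup>2 \<le> (T \<omega>)\<^sup>2 * (T \<omega>)\<^sup>2" by (intro mult_left_mono) auto
        then have "(T \<omega>)\<^sup>2 \<le> (T \<omega>) ^ 4 / \<epsilon>\<^sup>2"
          using \<epsilon> by (simp add: pos_le_divide_eq flip: power_add)
        moreover have "0 \<le> \<phi> (T \<omega>)" by (simp add: \<phi>_def)
        ultimately show ?thesis by linarith
      qed (simp add: \<phi>_def)
    qed (use i2 i4 i\<phi> in auto)
    also have "\<dots> = 3 * \<sigma> ^ 4 / (L\<^sup>2 * \<epsilon>\<^sup>2)" using i4 by simp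
    finally show ?thesis by (simp add: T_def)
  qed
  define \<Sigma> where "\<Sigma> n = (\<Sum>b<L. expectation (\<lambda>\<omega>. (D n b \<omega>)\<^sup>2) - expectation (\<lambda>\<omega>. \<phi> (D n b \<omega>)))" for n
  have "\<Sigma> \<longlonglongrightarrow> (\<Sum>b<L. \<sigma>\<^sup>2 / L - P.expectation (\<lambda>\<omega>. \<phi> (\<sigma> / sqrt L * N b \<omega>)))"
    unfolding \<Sigma>_def[abs_def] using limb by (intro tendsto_sum) auto
  moreover have "(\<Sum>b<L. \<sigma>\<^sup>2 / L - P.expectation (\<lambda>\<omega>. \<phi> (\<sigma> / sqrt L * N b \<omega>))) < e * \<epsilon>\<^sup>2"
  proof -
    have "(\<Sum>b<L. \<sigma>\<^sup>2 / L - P.expectation (\<lambda>\<omega>. \<phi> (\<sigma> / sqrt L * N b \<omega>))) \<le> (\<Sum>b<L. 3 * \<sigma> ^ 4 / (L\<^sup>2 * \<epsilon>\<^sup>2))"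
      using tail by (intro sum_mono) auto
    also have "\<dots> = 3 * \<sigma> ^ 4 / (L * \<epsilon> ^ 4) * \<epsilon>\<^sup>2"
      using L \<epsilon> by (simp add: power2_eq_square power4_eq_xxxx)
    also have "\<dots> < e * \<epsilon>\<^sup>2" using e \<epsilon> by (intro mult_strict_right_mono) auto
    finally show ?thesis .
  qed
  ultimately have "\<forall>\<^sub>F n in sequentially. \<Sigma> n < e * \<epsilon>\<^sup>2" by (rule order_tendstoD)
  then show ?thesis
    using eventually_ge_at_top[of L]
  proof eventually_elim
    case (elim n)
    have n: "0 < n" using elim L by simp
    have W: "centred_walk (\<lambda>i \<omega>. X i \<omega> / sqrt n) n (\<sigma>\<^sup>2)"
      unfolding centred_walk_def
    proof (intro conjI allI impI)
      show "indep_vars (\<lambda>_. borel) (\<lambda>i \<omega>. X i \<omega> / sqrt n) {..<n}"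
        by (rule indep_vars_compose2[OF indep_vars_subset[OF X subset_UNIV], where Y = "\<lambda>_ z. z / sqrt n"]) simp
      show "integrable M (\<lambda>\<omega>. (X i \<omega> / sqrt n)\<^sup>2)" "expectation (\<lambda>\<omega>. X i \<omega> / sqrt n) = 0" for i
        using sq mean by (simp_all add: power_divide)
      show "(\<Sum>i<n. expectation (\<lambda>\<omega>. (X i \<omega> / sqrt n)\<^sup>2)) \<le> \<sigma>\<^sup>2"
        using sq n by (simp add: power_divide)
    qed
    have "prob (osc_event M (\<lambda>i \<omega>. X i \<omega> / sqrt n) n L \<epsilon>) * \<epsilon>\<^sup>2 \<le> \<Sigma> n"
      using osc_event(2)[OF W L elim(2) \<epsilon>] by (simp add: \<Sigma>_def D_def \<phi>_def sum_divide_distrib)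
    then have "prob (osc_event M (\<lambda>i \<omega>. X i \<omega> / sqrt n) n L \<epsilon>) * \<epsilon>\<^sup>2 \<le> e * \<epsilon>\<^sup>2" using elim(1) by simp
    then show ?case using \<epsilon> by simp
  qed
qed

end

text \<open>Step \<open>i\<close> stands for time i + 1, so the linear process at time i + 1 is the
  sum over s of \<psi>(s) times step \<open>i\<close> of the copy shifted by s.\<close>

definition shifted :: "(int \<Rightarrow> 'a \<Rightarrow> real) \<Rightarrow> nat \<Rightarrow> nat \<Rightarrow> 'a \<Rightarrow> real" where
  "shifted \<eta> s i = \<eta> (int (Suc i) - int s)"

definition shifted_block :: "(int \<Rightarrow> 'a \<Rightarrow> real) \<Rightarrow> nat \<Rightarrow> nat \<Rightarrow> nat \<Rightarrow> nat \<Rightarrow> 'a \<Rightarrow> real" where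
  "shifted_block \<eta> s n L b \<omega> = (\<Sum>i=block_start n L b..<block_start n L (Suc b). shifted \<eta> s i \<omega>)"

text \<open>One further shift adds a single innovation at the left end of the block and drops one at
  the right end. The bound involves 2 s innovations, whatever the length of the block, and so
  vanishes after division by sqrt n.\<close>

lemma shifted_block_diff_le:
  "\<bar>shifted_block \<eta> s n L b \<omega> - shifted_block \<eta> 0 n L b \<omega>\<bar>
    \<le> (\<Sum>s'<s. \<bar>\<eta> (int (block_start n L b) - int s') \<omega>\<bar> + \<bar>\<eta> (int (block_start n L (Suc b)) - int s') \<omega>\<bar>)"
proof (induction s)
  case (Suc s)
  let ?a = "block_start n L b" and ?c = "block_start n L (Suc b)"
  have le: "?a \<le> ?c" by (simp add: block_start_def div_le_mono)
  have "(\<Sum>i=?a..<c. shifted \<eta> (Suc s) i \<omega> - shifted \<eta> s i \<omega>) = \<eta> (int ?a - int s) \<omega> - \<eta> (int c - int s) \<omega>" if "?a \<le> c" for c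
    using that
  proof (induction rule: dec_induct)
    case (step c)
    have "int (Suc c) - int (Suc s) = int c - int s" by simp
    then show ?case using step by (simp only: sum.atLeastLessThan_Suc shifted_def)
  qed simp
  from this[OF le] have "shifted_block \<eta> (Suc s) n L b \<omega> - shifted_block \<eta> s n L b \<omega> = \<eta> (int ?a - int s) \<omega> - \<eta> (int ?c - int s) \<omega>"
    by (simp add: shifted_block_def sum_subtractf)
  with Suc show ?case by simp
qed simp

lemma sum_lessThan_split: "(\<Sum>s<a + m. g s) = (\<Sum>s<a. g s) + (\<Sum>s<m. g (s + a))" for g :: "nat \<Rightarrow> real"
  by (induction m) (auto simp: add_ac)

lemma walk_const_pos: "0 < q \<Longrightarrow> q < 2 \<Longrightarrow> 0 \<le> v \<Longrightarrow> 0 < walk_const q v"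
  using var_rate_bounds[of q] by (auto simp: walk_const_def intro!: add_nonneg_pos divide_nonneg_pos)

context prob_space
begin

text \<open>One event serves all partial sums: the terms are nonnegative, so the events that a
  partial sum exceeds c increase, and continuity from below keeps Markov's bound.\<close>

lemma markov_series:
  fixes W :: "nat \<Rightarrow> 'a \<Rightarrow> real"
  assumes W: "\<And>s. integrable M (W s)" "\<And>s \<omega>. 0 \<le> W s \<omega>" "\<And>s. expectation (W s) \<le> w s"
    and w: "summable w" and c: "0 < c"
  shows "\<exists>B\<in>events. prob B \<le> (\<Sum>s. w s) / c \<and> (\<forall>\<omega>\<in>space M - B. \<forall>m. (\<Sum>s<m. W s \<omega>) \<le> c)"
proof -
  define B where "B m = {\<omega> \<in> space M. c < (\<Sum>s<m. W s \<omega>)}" for m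
  have int: "integrable M (\<lambda>\<omega>. \<Sum>s<m. W s \<omega>)" for m using W(1) by (intro Bochner_Integration.integrable_sum)
  have w0: "0 \<le> w s" for s using order.trans[OF Bochner_Integration.integral_nonneg[OF W(2)] W(3)] .
  have B: "B m \<in> events" "prob (B m) \<le> (\<Sum>s. w s) / c" for m
  proof -
    note mk = markov[OF int[of m] sum_nonneg[OF W(2)] c]
    show "B m \<in> events" unfolding B_def by (rule mk(1))
    have "prob (B m) \<le> expectation (\<lambda>\<omega>. \<Sum>s<m. W s \<omega>) / c" unfolding B_def by (rule mk(2))
    also have "expectation (\<lambda>\<omega>. \<Sum>s<m. W s \<omega>) = (\<Sum>s<m. expectation (W s))" using W(1) by (intro Bochner_Integration.integral_sum)
    also have "\<dots> \<le> (\<Sum>s<m. w s)" using W(3) by (intro sum_mono)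
    also have "\<dots> \<le> (\<Sum>s. w s)" using w w0 by (intro sum_le_suminf) auto
    finally show "prob (B m) \<le> (\<Sum>s. w s) / c" using c by (simp add: divide_right_mono)
  qed
  have "incseq B"
    unfolding B_def using W(2) by (intro incseq_SucI) (auto intro: less_le_trans)
  then have "(\<lambda>m. prob (B m)) \<longlonglongrightarrow> prob (\<Union>m. B m)"
    using B(1) by (intro finite_Lim_measure_incseq) auto
  then have "prob (\<Union>m. B m) \<le> (\<Sum>s. w s) / c"
    using B(2) by (intro LIMSEQ_le_const2) auto
  moreover have "\<forall>\<omega>\<in>space M - (\<Union>m. B m). \<forall>m. (\<Sum>s<m. W s \<omega>) \<le> c"
    by (auto simp: B_def not_less)
  ultimately show ?thesis using B(1) by (intro bexI[of _ "\<Union>m. B m"]) auto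
qed

text \<open>The order of the choices matters: the cut S0 in the series, the scale k of uniform
  closeness, the number 2^K of blocks, which makes large oscillations within blocks rare for all S0
  shifts, and only then n. Shifts below S0 are compared with their block sums and these with the
  block sums of shift 0; the remaining shifts enter through the first moment bound V.\<close>

theorem linear_process_approximation:
  fixes \<eta> :: "int \<Rightarrow> 'a \<Rightarrow> real" and N :: "nat \<Rightarrow> nat \<Rightarrow> 'b \<Rightarrow> real"
  assumes \<eta>: "indep_vars (\<lambda>_. borel) \<eta> UNIV" and ident: "\<And>i j. distr M borel (\<eta> i) = distr M borel (\<eta> j)"
    and mean: "\<And>i. expectation (\<eta> i) = 0" and sq: "\<And>i. integrable M (\<lambda>\<omega>. (\<eta> i \<omega>)\<^sup>2)" "\<And>i. expectation (\<lambda>\<omega>. (\<eta> i \<omega>)\<^sup>2) = \<sigma>\<^sup>2"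
    and \<sigma>: "0 < \<sigma>" and \<psi>: "summable (\<lambda>j. \<bar>\<psi> j\<bar>)" and q: "1 \<le> q" "q < 2"
    and P: "prob_space P" "\<And>K. prob_space.iid_std_normal P (N K) {..<2 ^ K}"
    and e: "0 < e"
  shows "\<forall>\<^sub>F K in sequentially. \<forall>\<^sub>F n in sequentially. \<exists>B\<in>events. prob B \<le> e \<and>
    (\<forall>\<omega>\<in>space M - B. \<forall>f\<in>F_class q \<delta>.
      \<bar>(\<Sum>i<n. f (real (Suc i) / n) * linear_process \<psi> \<eta> (int (Suc i)) \<omega>) / sqrt n
        - (\<Sum>j. \<psi> j) * ((\<Sum>b<2 ^ K. f (real (Suc b) / 2 ^ K) * shifted_block \<eta> 0 n (2 ^ K) b \<omega>) / sqrt n)\<bar> \<le> e)"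
proof -
  define C where "C = walk_const q (\<sigma>\<^sup>2)"
  define r where "r = var_rate q"
  define \<Psi> where "\<Psi> = (\<Sum>j. \<bar>\<psi> j\<bar>)"
  define m1 where "m1 = expectation (\<lambda>\<omega>. \<bar>\<eta> 0 \<omega>\<bar>)"
  have C: "0 < C" unfolding C_def using q by (intro walk_const_pos) auto
  have r: "0 < r" "r < 1" using var_rate_bounds[of q] q by (auto simp: r_def)
  have \<Psi>: "0 \<le> \<Psi>" "(\<Sum>s<m. \<bar>\<psi> s\<bar>) \<le> \<Psi>" for m
    unfolding \<Psi>_def using \<psi> by (auto intro: suminf_nonneg sum_le_suminf)
  have \<eta>m: "\<eta> i \<in> borel_measurable M" for i using \<eta> by (auto simp: indep_vars_def)
  have \<eta>i: "integrable M (\<eta> i)" for i using square_integrable_imp_integrable[OF \<eta>m sq(1)] .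
  have abs_\<eta>: "expectation (\<lambda>\<omega>. \<bar>\<eta> i \<omega>\<bar>) = m1" for i
  proof -
    have "(\<integral>x. \<bar>x\<bar> \<partial>distr M borel (\<eta> i)) = (\<integral>x. \<bar>x\<bar> \<partial>distr M borel (\<eta> 0))" using ident[of i 0] by simp
    then show ?thesis using \<eta>m by (simp add: integral_distr m1_def)
  qed
  have m1: "0 \<le> m1" by (simp add: m1_def)
  have sh: "indep_vars (\<lambda>_. borel) (shifted \<eta> s) UNIV" for s
  proof -
    have "indep_vars (\<lambda>_. borel) (\<lambda>i \<omega>. \<Sum>j\<in>{int (Suc i) - int s}. \<eta> j \<omega>) UNIV"
      by (intro indep_vars_group_sums[OF \<eta>]) (auto simp: disjoint_family_on_def)
    then show ?thesis by (simp add: shifted_def[abs_def])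
  qed
  have walk: "centred_walk (\<lambda>i \<omega>. shifted \<eta> s i \<omega> / sqrt n) n (\<sigma>\<^sup>2)" if "0 < n" for s n
    unfolding centred_walk_def
  proof (intro conjI allI impI)
    show "indep_vars (\<lambda>_. borel) (\<lambda>i \<omega>. shifted \<eta> s i \<omega> / sqrt n) {..<n}"
      by (rule indep_vars_compose2[OF indep_vars_subset[OF sh subset_UNIV], where Y = "\<lambda>_ z. z / sqrt n"]) simp
    show "integrable M (\<lambda>\<omega>. (shifted \<eta> s i \<omega> / sqrt n)\<^sup>2)" "expectation (\<lambda>\<omega>. shifted \<eta> s i \<omega> / sqrt n) = 0" for i
      using sq mean by (simp_all add: power_divide shifted_def)
    show "(\<Sum>i<n. expectation (\<lambda>\<omega>. (shifted \<eta> s i \<omega> / sqrt n)\<^sup>2)) \<le> \<sigma>\<^sup>2"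
      using sq that by (simp add: power_divide shifted_def)
  qed
  \<comment> \<open>The tail costs 2 C per unit of |\<psi>|, in total e^2 / 8; Markov's inequality
    at level e / 2 then leaves probability e / 4.\<close>
  obtain S0 where S0: "(\<Sum>s. \<bar>\<psi> (s + S0)\<bar>) < e\<^sup>2 / (16 * C)"
  proof -
    have "\<forall>\<^sub>F S in sequentially. (\<Sum>s. \<bar>\<psi> (s + S)\<bar>) < e\<^sup>2 / (16 * C)"
      using suminf_exist_split2[OF \<psi>] e C by (intro order_tendstoD(2)) (auto simp: add.commute)
    then show ?thesis using that by (auto simp: eventually_sequentially)
  qed
  obtain k where k: "\<Psi> * (C * r ^ k) < e\<^sup>2 / 16"
  proof -
    have "(\<lambda>k. \<Psi> * (C * r ^ k)) \<longlonglongrightarrow> \<Psi> * (C * 0)" using r by (intro tendsto_intros LIMSEQ_realpow_zero) auto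
    then have "\<forall>\<^sub>F k in sequentially. \<Psi> * (C * r ^ k) < e\<^sup>2 / 16" using e by (intro order_tendstoD(2)) auto
    then show ?thesis using that by (auto simp: eventually_sequentially)
  qed
  define \<epsilon> :: real where "\<epsilon> = (1 / 2) ^ k / sqrt 2"
  have \<epsilon>: "0 < \<epsilon>" "2 * \<epsilon>\<^sup>2 = ((1 / 2) ^ k)\<^sup>2" by (auto simp: \<epsilon>_def power_divide power_mult_distrib)
  \<comment> \<open>S0 events of probability p give at most e / 4; the \<open>+ 1\<close> covers S0
    = 0.\<close>
  define p where "p = e / (4 * (real S0 + 1))"
  have p: "0 < p" using e by (simp add: p_def)
  have "(\<lambda>K. 3 * \<sigma> ^ 4 / \<epsilon> ^ 4 * (1 / 2) ^ K) \<longlonglongrightarrow> 3 * \<sigma> ^ 4 / \<epsilon> ^ 4 * 0"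
    by (intro tendsto_intros LIMSEQ_realpow_zero) auto
  then have "\<forall>\<^sub>F K in sequentially. 3 * \<sigma> ^ 4 / \<epsilon> ^ 4 * (1 / 2) ^ K < p" using p by (intro order_tendstoD(2)) auto
  then show ?thesis
  proof eventually_elim
    case (elim K)
    define L :: nat where "L = 2 ^ K"
    have L: "0 < L" "real L = 2 ^ K" by (auto simp: L_def)
    have small: "3 * \<sigma> ^ 4 / (L * \<epsilon> ^ 4) < p" using elim by (simp add: L field_simps)
    have osc: "\<forall>\<^sub>F n in sequentially. \<forall>s\<in>{..<S0}. prob (osc_event M (\<lambda>i \<omega>. shifted \<eta> s i \<omega> / sqrt n) n L \<epsilon>) \<le> p"
    proof (rule eventually_ball_finite[OF finite_lessThan], rule ballI)
      fix s
      show "\<forall>\<^sub>F n in sequentially. prob (osc_event M (\<lambda>i \<omega>. shifted \<eta> s i \<omega> / sqrt n) n L \<epsilon>) \<le> p"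
        using P(2)[of K] mean sq ident
        by (intro osc_event_eventually_small[OF sh _ _ _ _ \<sigma> L(1) P(1) _ \<epsilon>(1) small]) (auto simp: shifted_def L_def)
    qed
    have "(\<lambda>n. \<Psi> * (real L * (2 * real S0 * m1) / sqrt n)) \<longlonglongrightarrow> 0" by real_asymp
    then have far: "\<forall>\<^sub>F n in sequentially. \<Psi> * (real L * (2 * real S0 * m1) / sqrt n) < e\<^sup>2 / 16"
      using e by (intro order_tendstoD(2)) auto
    show ?case
      using osc far eventually_ge_at_top[of L]
    proof eventually_elim
      case (elim n)
      have n: "0 < n" using elim(3) L(1) by simp
      define S where "S s f \<omega> = (\<Sum>i<n. f (real (Suc i) / n) * (shifted \<eta> s i \<omega> / sqrt n))" for s and f :: "real \<Rightarrow> real" and \<omega>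
      define \<Phi> where "\<Phi> s f \<omega> = (\<Sum>b<L. f (real (Suc b) / L) * (\<Sum>i=block_start n L b..<block_start n L (Suc b). shifted \<eta> s i \<omega> / sqrt n))"
        for s and f :: "real \<Rightarrow> real" and \<omega>
      have \<Phi>_eq: "\<Phi> s f \<omega> = (\<Sum>b<L. f (real (Suc b) / L) * shifted_block \<eta> s n L b \<omega>) / sqrt n" for s f \<omega>
        by (simp add: \<Phi>_def shifted_block_def flip: sum_divide_distrib)
      let ?osc = "\<lambda>s. osc_event M (\<lambda>i \<omega>. shifted \<eta> s i \<omega> / sqrt n) n L \<epsilon>"
      let ?R = "\<lambda>s U V. integrable M U \<and> expectation U \<le> C * r ^ k \<and> integrable M V \<and> expectation V \<le> C
         \<and> (\<forall>\<omega>. 0 \<le> U \<omega>) \<and> (\<forall>\<omega>. 0 \<le> V \<omega>)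
         \<and> (\<forall>\<omega>\<in>space M. \<forall>f. f \<in> F_class q \<delta> \<longrightarrow>
           (\<omega> \<notin> ?osc s \<longrightarrow> \<bar>S s f \<omega> - \<Phi> s f \<omega>\<bar> \<le> U \<omega>) \<and> \<bar>S s f \<omega>\<bar> \<le> V \<omega> \<and> \<bar>\<Phi> s f \<omega>\<bar> \<le> V \<omega>)"
      have "\<forall>s. \<exists>U V. ?R s U V"
      proof
        fix s
        show "\<exists>U V. ?R s U V"
          using block_approximation[OF walk[OF n, of s] L(1) elim(3) q \<epsilon>(2)] unfolding S_def \<Phi>_def C_def r_def by blast
      qed
      from choice[OF this] obtain U where "\<forall>s. \<exists>V. ?R s (U s) V" by blast
      from choice[OF this] obtain V where U: "\<And>s. integrable M (U s)" "\<And>s. expectation (U s) \<le> C * r ^ k" "\<And>s \<omega>. 0 \<le> U s \<omega>"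
        and V: "\<And>s. integrable M (V s)" "\<And>s. expectation (V s) \<le> C" "\<And>s \<omega>. 0 \<le> V s \<omega>"
        and SU: "\<And>s \<omega> f. \<omega> \<in> space M \<Longrightarrow> f \<in> F_class q \<delta> \<Longrightarrow> \<omega> \<notin> ?osc s \<Longrightarrow> \<bar>S s f \<omega> - \<Phi> s f \<omega>\<bar> \<le> U s \<omega>"
        and SV: "\<And>s \<omega> f. \<omega> \<in> space M \<Longrightarrow> f \<in> F_class q \<delta> \<Longrightarrow> \<bar>S s f \<omega>\<bar> \<le> V s \<omega>"
        and \<Phi>V: "\<And>s \<omega> f. \<omega> \<in> space M \<Longrightarrow> f \<in> F_class q \<delta> \<Longrightarrow> \<bar>\<Phi> s f \<omega>\<bar> \<le> V s \<omega>"
        by blast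
      define \<Delta> where "\<Delta> s \<omega> = (\<Sum>b<L. \<bar>shifted_block \<eta> s n L b \<omega> - shifted_block \<eta> 0 n L b \<omega>\<bar>)" for s \<omega>
      have sbi: "integrable M (shifted_block \<eta> s n L b)" for s b
        unfolding shifted_block_def[abs_def] shifted_def using \<eta>i by (intro Bochner_Integration.integrable_sum)
      have \<Delta>: "integrable M (\<Delta> s)" "expectation (\<Delta> s) \<le> real L * (2 * real s * m1)" for s
      proof -
        show "integrable M (\<Delta> s)" unfolding \<Delta>_def[abs_def] using sbi
          by (intro Bochner_Integration.integrable_sum integrable_abs Bochner_Integration.integrable_diff)
        have "expectation (\<Delta> s) = (\<Sum>b<L. expectation (\<lambda>\<omega>. \<bar>shifted_block \<eta> s n L b \<omega> - shifted_block \<eta> 0 n L b \<omega>\<bar>))"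
          unfolding \<Delta>_def[abs_def] using sbi
          by (intro Bochner_Integration.integral_sum integrable_abs Bochner_Integration.integrable_diff)
        also have "\<dots> \<le> (\<Sum>b<L. 2 * real s * m1)"
        proof (intro sum_mono)
          fix b
          let ?g = "\<lambda>s' \<omega>. \<bar>\<eta> (int (block_start n L b) - int s') \<omega>\<bar> + \<bar>\<eta> (int (block_start n L (Suc b)) - int s') \<omega>\<bar>"
          have g: "integrable M (?g s')" "expectation (?g s') = 2 * m1" for s'
            using \<eta>i abs_\<eta> by simp_all
          have "expectation (\<lambda>\<omega>. \<bar>shifted_block \<eta> s n L b \<omega> - shifted_block \<eta> 0 n L b \<omega>\<bar>) \<le> expectation (\<lambda>\<omega>. \<Sum>s'<s. ?g s' \<omega>)"
            using sbi g(1) shifted_block_diff_le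
            by (intro integral_mono integrable_abs Bochner_Integration.integrable_diff Bochner_Integration.integrable_sum) auto
          also have "\<dots> = (\<Sum>s'<s. expectation (?g s'))" using g(1) by (intro Bochner_Integration.integral_sum)
          also have "\<dots> = 2 * real s * m1" by (simp only: g(2)) simp
          finally show "expectation (\<lambda>\<omega>. \<bar>shifted_block \<eta> s n L b \<omega> - shifted_block \<eta> 0 n L b \<omega>\<bar>) \<le> 2 * real s * m1" .
        qed
        finally show "expectation (\<Delta> s) \<le> real L * (2 * real s * m1)" by simp
      qed
      have \<Delta>0: "0 \<le> \<Delta> s \<omega>" for s \<omega> by (simp add: \<Delta>_def sum_nonneg)
      have \<Phi>\<Delta>: "\<bar>\<Phi> s f \<omega> - \<Phi> 0 f \<omega>\<bar> \<le> \<Delta> s \<omega> / sqrt n" if f: "f \<in> F_class q \<delta>" for s f \<omega>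
      proof -
        have "\<Phi> s f \<omega> - \<Phi> 0 f \<omega> = (\<Sum>b<L. f (real (Suc b) / L) * (shifted_block \<eta> s n L b \<omega> - shifted_block \<eta> 0 n L b \<omega>)) / sqrt n"
          by (simp add: \<Phi>_eq sum_subtractf right_diff_distrib diff_divide_distrib)
        moreover have "\<bar>\<Sum>b<L. f (real (Suc b) / L) * (shifted_block \<eta> s n L b \<omega> - shifted_block \<eta> 0 n L b \<omega>)\<bar> \<le> \<Delta> s \<omega>"
          unfolding \<Delta>_def
        proof (intro order.trans[OF sum_abs] sum_mono)
          fix b assume "b \<in> {..<L}"
          then have "\<bar>f (real (Suc b) / L)\<bar> \<le> 1" by (intro F_class_abs_le_1[OF q(1) f]) auto
          then show "\<bar>f (real (Suc b) / L) * (shifted_block \<eta> s n L b \<omega> - shifted_block \<eta> 0 n L b \<omega>)\<bar> \<le> \<bar>shifted_block \<eta> s n L b \<omega> - shifted_block \<eta> 0 n L b \<omega>\<bar>"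
            by (simp add: abs_mult mult_left_le_one_le)
        qed
        ultimately show ?thesis by (simp add: divide_right_mono)
      qed
      \<comment> \<open>The shifts below S0: the block approximation error of each, plus the cost of
        moving its block sums to shift 0.\<close>
      define F where "F \<omega> = (\<Sum>s<S0. \<bar>\<psi> s\<bar> * (U s \<omega> + \<Delta> s \<omega> / sqrt n))" for \<omega>
      have F: "integrable M F" "\<And>\<omega>. 0 \<le> F \<omega>"
        unfolding F_def[abs_def] using U(1,3) \<Delta>(1) \<Delta>0 by (auto intro!: sum_nonneg mult_nonneg_nonneg add_nonneg_nonneg)
      have EF: "expectation F \<le> e\<^sup>2 / 8"
      proof -
        have "expectation F = (\<Sum>s<S0. expectation (\<lambda>\<omega>. \<bar>\<psi> s\<bar> * (U s \<omega> + \<Delta> s \<omega> / sqrt n)))"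
          unfolding F_def[abs_def] using U(1) \<Delta>(1) by (intro Bochner_Integration.integral_sum) auto
        also have "\<dots> = (\<Sum>s<S0. \<bar>\<psi> s\<bar> * (expectation (U s) + expectation (\<Delta> s) / sqrt n))"
          using U(1) \<Delta>(1) by simp
        also have "\<dots> \<le> (\<Sum>s<S0. \<bar>\<psi> s\<bar> * (C * r ^ k + real L * (2 * real S0 * m1) / sqrt n))"
        proof (intro sum_mono mult_left_mono add_mono divide_right_mono U(2))
          fix s assume "s \<in> {..<S0}"
          then have "real L * (2 * real s * m1) \<le> real L * (2 * real S0 * m1)" using m1 by (intro mult_left_mono mult_right_mono) auto
          with \<Delta>(2)[of s] show "expectation (\<Delta> s) \<le> real L * (2 * real S0 * m1)" by linarith
        qed auto
        also have "\<dots> = (\<Sum>s<S0. \<bar>\<psi> s\<bar>) * (C * r ^ k + real L * (2 * real S0 * m1) / sqrt n)"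
          by (rule sum_distrib_right[symmetric])
        also have "\<dots> \<le> \<Psi> * (C * r ^ k + real L * (2 * real S0 * m1) / sqrt n)"
          using C r m1 by (intro mult_right_mono \<Psi> add_nonneg_nonneg) auto
        also have "\<dots> \<le> e\<^sup>2 / 8" using k elim(2) by (simp add: distrib_left)
        finally show ?thesis .
      qed
      have "0 < e / 2" using e by simp
      note mF = markov[OF F this]
      have PF: "prob {\<omega> \<in> space M. e / 2 < F \<omega>} \<le> e / 4"
      proof -
        have "expectation F / (e / 2) \<le> (e\<^sup>2 / 8) / (e / 2)" using EF e by (intro divide_right_mono) auto
        also have "\<dots> = e / 4" using e by (simp add: power2_eq_square)
        finally show ?thesis using mF(2) by linarith
      qed
      \<comment> \<open>From shift S0 on, the shifted sum and the block sum of shift 0 are bounded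
        separately, by V at the two shifts.\<close>
      define W where "W s \<omega> = \<bar>\<psi> (s + S0)\<bar> * (V (s + S0) \<omega> + V 0 \<omega>)" for s \<omega>
      have "\<exists>B\<in>events. prob B \<le> (\<Sum>s. \<bar>\<psi> (s + S0)\<bar> * (2 * C)) / (e / 2) \<and> (\<forall>\<omega>\<in>space M - B. \<forall>m. (\<Sum>s<m. W s \<omega>) \<le> e / 2)"
      proof (rule markov_series)
        show "integrable M (W s)" "0 \<le> W s \<omega>" for s \<omega> unfolding W_def[abs_def] using V by simp_all
        have "expectation (W s) = \<bar>\<psi> (s + S0)\<bar> * (expectation (V (s + S0)) + expectation (V 0))" for s
          unfolding W_def[abs_def] using V(1) by simp
        then show "expectation (W s) \<le> \<bar>\<psi> (s + S0)\<bar> * (2 * C)" for s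
          using V(2)[of "s + S0"] V(2)[of 0] by (simp add: mult_left_mono)
        show "summable (\<lambda>s. \<bar>\<psi> (s + S0)\<bar> * (2 * C))"
          by (intro summable_mult2 summable_ignore_initial_segment[OF \<psi>])
      qed (use e in simp)
      then obtain BW where BW: "BW \<in> events" "prob BW \<le> (\<Sum>s. \<bar>\<psi> (s + S0)\<bar> * (2 * C)) / (e / 2)"
        "\<And>\<omega> m. \<omega> \<in> space M - BW \<Longrightarrow> (\<Sum>s<m. W s \<omega>) \<le> e / 2" by blast
      have PW: "prob BW \<le> e / 4"
      proof -
        have "(\<Sum>s. \<bar>\<psi> (s + S0)\<bar> * (2 * C)) = (\<Sum>s. \<bar>\<psi> (s + S0)\<bar>) * (2 * C)"
          by (rule suminf_mult2[symmetric]) (rule summable_ignore_initial_segment[OF \<psi>])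
        also have "\<dots> \<le> e\<^sup>2 / (16 * C) * (2 * C)" using S0 C by (intro mult_right_mono) auto
        also have "\<dots> = e\<^sup>2 / 8" using C by simp
        finally have "(\<Sum>s. \<bar>\<psi> (s + S0)\<bar> * (2 * C)) / (e / 2) \<le> (e\<^sup>2 / 8) / (e / 2)" using e by (intro divide_right_mono) auto
        also have "\<dots> = e / 4" using e by (simp add: power2_eq_square)
        finally show ?thesis using BW(2) by linarith
      qed
      \<comment> \<open>Off one null set all the series converge absolutely, so
        \<open>linear_process\<close>, a \<open>suminf\<close>, is the sum it is meant to
        be.\<close>
      have "AE \<omega> in M. summable (\<lambda>s. \<bar>\<psi> s * \<eta> (i - int s) \<omega>\<bar>)" for i
      proof (rule AE_summable)
        have "summable (\<lambda>s. \<bar>\<psi> s\<bar> * m1)" by (intro summable_mult2 \<psi>)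
        then show "summable (\<lambda>s. expectation (\<lambda>\<omega>. \<bar>\<psi> s * \<eta> (i - int s) \<omega>\<bar>))"
          by (simp add: abs_mult abs_\<eta>)
      qed (use \<eta>i in auto)
      then have "AE \<omega> in M. \<forall>i. summable (\<lambda>s. \<bar>\<psi> s * \<eta> (i - int s) \<omega>\<bar>)"
        by (simp add: AE_all_countable)
      from this[unfolded eventually_ae_filter] obtain B0 where B0: "{\<omega> \<in> space M. \<not> (\<forall>i. summable (\<lambda>s. \<bar>\<psi> s * \<eta> (i - int s) \<omega>\<bar>))} \<subseteq> B0" "B0 \<in> null_sets M"
        by blast
      define Bo where "Bo = (\<Union>s<S0. ?osc s)"
      have oe: "?osc s \<in> events" for s
        by (rule osc_event(1)[OF walk[OF n] L(1) elim(3) \<epsilon>(1)])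
      have Bo: "Bo \<in> events" unfolding Bo_def using oe by (intro sets.finite_UN) auto
      have PBo: "prob Bo \<le> e / 4"
      proof -
        have "prob Bo \<le> (\<Sum>s<S0. prob (?osc s))"
          unfolding Bo_def using oe by (intro finite_measure_subadditive_finite) auto
        also have "\<dots> \<le> (\<Sum>s<S0. p)" using elim(1) by (intro sum_mono) auto
        also have "\<dots> = real S0 / (real S0 + 1) * (e / 4)" by (simp add: p_def)
        also have "\<dots> \<le> 1 * (e / 4)" using e by (intro mult_right_mono) auto
        finally show ?thesis by simp
      qed
      define B where "B = Bo \<union> ({\<omega> \<in> space M. e / 2 < F \<omega>} \<union> (BW \<union> B0))"
      have BWB0: "BW \<union> B0 \<in> events" using BW(1) null_setsD2[OF B0(2)] by (rule sets.Un)
      have BF0: "{\<omega> \<in> space M. e / 2 < F \<omega>} \<union> (BW \<union> B0) \<in> events" using mF(1) BWB0 by (rule sets.Un)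
      have B: "B \<in> events" unfolding B_def using Bo BF0 by (rule sets.Un)
      have PB: "prob B \<le> e"
      proof -
        have "prob B \<le> prob Bo + prob ({\<omega> \<in> space M. e / 2 < F \<omega>} \<union> (BW \<union> B0))"
          unfolding B_def by (rule measure_Un_le[OF Bo BF0])
        moreover have "prob ({\<omega> \<in> space M. e / 2 < F \<omega>} \<union> (BW \<union> B0)) \<le> prob {\<omega> \<in> space M. e / 2 < F \<omega>} + prob (BW \<union> B0)"
          by (rule measure_Un_le[OF mF(1) BWB0])
        moreover have "prob (BW \<union> B0) \<le> prob BW + prob B0"
          by (rule measure_Un_le[OF BW(1) null_setsD2[OF B0(2)]])
        moreover have "prob B0 = 0" using B0(2) by (rule measure_eq_0_null_sets)
        ultimately show ?thesis using PBo PF PW e by linarith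
      qed
      have "\<bar>(\<Sum>i<n. f (real (Suc i) / n) * linear_process \<psi> \<eta> (int (Suc i)) \<omega>) / sqrt n
        - (\<Sum>j. \<psi> j) * ((\<Sum>b<2 ^ K. f (real (Suc b) / 2 ^ K) * shifted_block \<eta> 0 n (2 ^ K) b \<omega>) / sqrt n)\<bar> \<le> e"
        if \<omega>: "\<omega> \<in> space M - B" and f: "f \<in> F_class q \<delta>" for \<omega> f
      proof -
        have "(\<lambda>s. \<psi> s * shifted \<eta> s i \<omega>) sums linear_process \<psi> \<eta> (int (Suc i)) \<omega>" for i
        proof -
          have "summable (\<lambda>s. \<bar>\<psi> s * \<eta> (int (Suc i) - int s) \<omega>\<bar>)" using \<omega> B0(1) by (auto simp: B_def)
          then show ?thesis
            unfolding linear_process_def shifted_def by (rule summable_sums[OF summable_rabs_cancel])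
        qed
        then have "(\<lambda>s. \<Sum>i<n. f (real (Suc i) / n) * (\<psi> s * shifted \<eta> s i \<omega>) / sqrt n)
           sums (\<Sum>i<n. f (real (Suc i) / n) * linear_process \<psi> \<eta> (int (Suc i)) \<omega> / sqrt n)"
          by (intro sums_sum sums_divide sums_mult)
        then have s1: "(\<lambda>s. \<psi> s * S s f \<omega>) sums ((\<Sum>i<n. f (real (Suc i) / n) * linear_process \<psi> \<eta> (int (Suc i)) \<omega>) / sqrt n)"
          unfolding S_def by (simp add: sum_distrib_left sum_divide_distrib mult_ac)
        have "(\<lambda>s. \<psi> s * \<Phi> 0 f \<omega>) sums ((\<Sum>j. \<psi> j) * \<Phi> 0 f \<omega>)"
          by (intro sums_mult2 summable_sums summable_rabs_cancel[OF \<psi>])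
        from sums_diff[OF s1 this]
        have lim: "(\<lambda>s. \<psi> s * (S s f \<omega> - \<Phi> 0 f \<omega>)) sums ((\<Sum>i<n. f (real (Suc i) / n) * linear_process \<psi> \<eta> (int (Suc i)) \<omega>) / sqrt n - (\<Sum>j. \<psi> j) * \<Phi> 0 f \<omega>)"
          by (simp add: right_diff_distrib)
        have "\<bar>\<Sum>s<m. \<psi> s * (S s f \<omega> - \<Phi> 0 f \<omega>)\<bar> \<le> e" for m
        proof -
          have "\<bar>\<Sum>s<m. \<psi> s * (S s f \<omega> - \<Phi> 0 f \<omega>)\<bar> \<le> (\<Sum>s<m. \<bar>\<psi> s * (S s f \<omega> - \<Phi> 0 f \<omega>)\<bar>)" by (rule sum_abs)
          \<comment> \<open>Extending the range to S0 + m allows the cut at S0 for every m.\<close>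
          also have "\<dots> \<le> (\<Sum>s<S0 + m. \<bar>\<psi> s * (S s f \<omega> - \<Phi> 0 f \<omega>)\<bar>)" by (intro sum_mono2) auto
          also have "\<dots> = (\<Sum>s<S0. \<bar>\<psi> s * (S s f \<omega> - \<Phi> 0 f \<omega>)\<bar>) + (\<Sum>s<m. \<bar>\<psi> (s + S0) * (S (s + S0) f \<omega> - \<Phi> 0 f \<omega>)\<bar>)"
            by (rule sum_lessThan_split)
          also have "\<dots> \<le> F \<omega> + (\<Sum>s<m. W s \<omega>)"
            unfolding F_def W_def abs_mult
          proof (intro add_mono sum_mono mult_left_mono)
            fix s assume "s \<in> {..<S0}"
            then have "\<bar>S s f \<omega> - \<Phi> s f \<omega>\<bar> \<le> U s \<omega>" using \<omega> f by (intro SU) (auto simp: B_def Bo_def)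
            then show "\<bar>S s f \<omega> - \<Phi> 0 f \<omega>\<bar> \<le> U s \<omega> + \<Delta> s \<omega> / sqrt n" using \<Phi>\<Delta>[OF f, of s \<omega>] by linarith
          next
            fix s
            show "\<bar>S (s + S0) f \<omega> - \<Phi> 0 f \<omega>\<bar> \<le> V (s + S0) \<omega> + V 0 \<omega>"
              using SV[of \<omega> f "s + S0"] \<Phi>V[of \<omega> f 0] \<omega> f by auto
          qed auto
          also have "\<dots> \<le> e / 2 + e / 2"
            using \<omega> BW(3)[of \<omega> m] by (intro add_mono) (auto simp: B_def)
          finally show ?thesis by simp
        qed
        then have "\<bar>(\<Sum>i<n. f (real (Suc i) / n) * linear_process \<psi> \<eta> (int (Suc i)) \<omega>) / sqrt n - (\<Sum>j. \<psi> j) * \<Phi> 0 f \<omega>\<bar> \<le> e"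
          using lim unfolding sums_def by (intro LIMSEQ_le_const2[OF tendsto_rabs]) auto
        moreover have "\<Phi> 0 f \<omega> = (\<Sum>b<2 ^ K. f (real (Suc b) / 2 ^ K) * shifted_block \<eta> 0 n (2 ^ K) b \<omega>) / sqrt n"
          by (simp add: \<Phi>_eq L_def)
        ultimately show ?thesis by simp
      qed
      then show ?case using B PB by blast
    qed
  qed
qed

end

section \<open>The least squares estimator\<close>

text \<open>The product runs over a whole type, which fixes the type of the probability space; the
  injection picks a sequence of coordinates in it.\<close>

lemma iid_std_normal_coordinates:
  fixes \<iota> :: "nat \<Rightarrow> 'i"
  assumes "inj \<iota>"
  defines "M \<equiv> PiM UNIV (\<lambda>_ :: 'i. std_normal_distribution)"
  shows "prob_space M" "prob_space.iid_std_normal M (\<lambda>k \<omega>. \<omega> (\<iota> k)) UNIV"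
proof -
  note M = M_def
  show "prob_space M" unfolding M by (intro prob_space_PiM prob_space_std_normal)
  then interpret prob_space M .
  have m: "(\<lambda>\<omega>. \<omega> (\<iota> k)) \<in> borel_measurable M" for k
    using measurable_component_singleton[of "\<iota> k" UNIV "\<lambda>_. std_normal_distribution"] by (simp add: M)
  have law: "distr M borel (\<lambda>\<omega>. \<omega> (\<iota> k)) = std_normal_distribution" for k
  proof -
    have "distr M std_normal_distribution (\<lambda>\<omega>. \<omega> (\<iota> k)) = std_normal_distribution"
      unfolding M by (rule distr_PiM_component) (auto intro: prob_space_std_normal)
    moreover have "distr M std_normal_distribution (\<lambda>\<omega>. \<omega> (\<iota> k)) = distr M borel (\<lambda>\<omega>. \<omega> (\<iota> k))"
      by (rule distr_cong) auto
    ultimately show ?thesis by simp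
  qed
  have "distr M (PiM UNIV (\<lambda>_. std_normal_distribution)) (\<lambda>\<omega>. \<lambda>k\<in>UNIV. \<omega> (\<iota> k)) = PiM UNIV (\<lambda>_ :: nat. std_normal_distribution)"
    unfolding M by (rule distr_PiM_reindex) (use assms in \<open>auto intro: prob_space_std_normal\<close>)
  moreover have "distr M (PiM UNIV (\<lambda>_. std_normal_distribution)) (\<lambda>\<omega>. \<lambda>k\<in>UNIV. \<omega> (\<iota> k)) = distr M (PiM UNIV (\<lambda>_. borel)) (\<lambda>\<omega>. \<lambda>k\<in>UNIV. \<omega> (\<iota> k))"
    by (rule distr_cong) (auto intro!: sets_PiM_cong)
  ultimately have "indep_vars (\<lambda>_. borel) (\<lambda>k \<omega>. \<omega> (\<iota> k)) UNIV"
    using m law by (subst indep_vars_iff_distr_eq_PiM') auto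
  then show "iid_std_normal (\<lambda>k \<omega>. \<omega> (\<iota> k)) UNIV" using law by (simp add: iid_std_normal_def)
qed

text \<open>\<open>a\<close> is the weighted sum and \<phi> the normalised block sum, R the Riemann
  sum and J the integral of f^2. The change of normaliser is explicit in 1 / sqrt R - 1 / sqrt J =
  (J - R) / (sqrt R sqrt J (sqrt J + sqrt R)), whose denominator is at least d sqrt d.\<close>

lemma normalised_diff_le:
  fixes a \<phi> A R J d u c v :: real
  assumes d: "0 < d" "d \<le> R" "d \<le> J" and u: "\<bar>a - A * \<phi>\<bar> \<le> u" and c: "\<bar>\<phi>\<bar> \<le> c" and v: "\<bar>J - R\<bar> \<le> v"
  shows "\<bar>a / sqrt R - A * \<phi> / sqrt J\<bar> \<le> u / sqrt d + \<bar>A\<bar> * c * (v / (d * sqrt d))"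
proof -
  have pos: "0 < R" "0 < J" using d by auto
  have "1 / sqrt R - 1 / sqrt J = (J - R) / ((sqrt R * sqrt J) * (sqrt J + sqrt R))"
  proof -
    have "(sqrt J - sqrt R) * (sqrt J + sqrt R) = J - R" using pos by (simp add: algebra_simps)
    moreover have "0 < sqrt J + sqrt R" using pos by (intro add_pos_pos) auto
    ultimately have "sqrt J - sqrt R = (J - R) / (sqrt J + sqrt R)" by (simp add: field_simps)
    then show ?thesis using pos by (simp add: diff_divide_eq_iff divide_diff_eq_iff mult.commute)
  qed
  then have "\<bar>1 / sqrt R - 1 / sqrt J\<bar> = \<bar>J - R\<bar> / ((sqrt R * sqrt J) * (sqrt J + sqrt R))"
    using pos by simp
  also have "\<dots> \<le> v / (d * sqrt d)"
  proof (rule frac_le)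
    have "d = sqrt d * sqrt d" using d by simp
    also have "\<dots> \<le> sqrt R * sqrt J" using d by (intro mult_mono) auto
    finally have "d \<le> sqrt R * sqrt J" .
    moreover have "sqrt d \<le> sqrt J + sqrt R" using d pos by (intro add_increasing2) auto
    ultimately show "d * sqrt d \<le> sqrt R * sqrt J * (sqrt J + sqrt R)" using d pos by (intro mult_mono) auto
  qed (use v d in auto)
  finally have inv: "\<bar>1 / sqrt R - 1 / sqrt J\<bar> \<le> v / (d * sqrt d)" .
  have "a / sqrt R - A * \<phi> / sqrt J = (a - A * \<phi>) / sqrt R + A * \<phi> * (1 / sqrt R - 1 / sqrt J)"
    by (simp add: algebra_simps diff_divide_distrib)
  then have "\<bar>a / sqrt R - A * \<phi> / sqrt J\<bar> \<le> \<bar>a - A * \<phi>\<bar> / sqrt R + \<bar>A\<bar> * \<bar>\<phi>\<bar> * \<bar>1 / sqrt R - 1 / sqrt J\<bar>"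
    using pos abs_triangle_ineq[of "(a - A * \<phi>) / sqrt R" "A * \<phi> * (1 / sqrt R - 1 / sqrt J)"] by (simp add: abs_mult)
  also have "\<dots> \<le> u / sqrt d + \<bar>A\<bar> * c * (v / (d * sqrt d))"
    using u c inv d by (intro add_mono frac_le mult_mono) auto
  finally show ?thesis .
qed

text \<open>\<beta> cancels because the estimator is linear in the observations; the factors of n
  are arranged so as to exhibit the Riemann sum of f^2.\<close>

lemma Q_process_eq:
  assumes f: "f \<in> F" and n: "0 < n" and R: "0 < (\<Sum>i<n. (f (real (Suc i) / n))\<^sup>2) / n"
  shows "Q_process F \<beta> X n \<omega> f
    = ((\<Sum>i<n. f (real (Suc i) / n) * X (int (Suc i)) \<omega>) / sqrt n) / sqrt ((\<Sum>i<n. (f (real (Suc i) / n))\<^sup>2) / n)"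
proof -
  define s where "s = (\<Sum>i<n. (f (real (Suc i) / n))\<^sup>2)"
  define T where "T = (\<Sum>i<n. f (real (Suc i) / n) * X (int (Suc i)) \<omega>)"
  have s: "0 < s" using R n by (simp add: s_def zero_less_divide_iff)
  have s': "(\<Sum>j = 1..n. (f (real j / real n))\<^sup>2) = s" by (simp add: s_def sum.atLeast1_atMost_eq)
  have "(\<Sum>j = 1..n. (\<beta> * f (real j / real n) + X (int j) \<omega>) * f (real j / real n)) = \<beta> * s + T"
    by (simp add: s_def T_def sum.atLeast1_atMost_eq sum.distrib[symmetric] sum_distrib_left power2_eq_square algebra_simps)
  then have "lse n f (\<lambda>j. \<beta> * f (real j / real n) + X (int j) \<omega>) - \<beta> = T / s"
    using s unfolding lse_def s' by (simp add: field_simps)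
  then have "Q_process F \<beta> X n \<omega> f = sqrt s * (T / s)"
    using f s' by (simp add: Q_process_def)
  also have "\<dots> = T / sqrt s" using s by (simp add: field_simps)
  finally show ?thesis using n by (simp add: s_def T_def real_sqrt_divide)
qed

context prob_space
begin

text \<open>Tightness of the block sums, uniformly in n: t \<le> (1 + t^2) / 2 reduces the first
  moment to the variance, and a block has at most n steps.\<close>

lemma shifted_block_moments:
  fixes \<eta> :: "int \<Rightarrow> 'a \<Rightarrow> real"
  assumes \<eta>: "indep_vars (\<lambda>_. borel) \<eta> UNIV" and mean: "\<And>i. expectation (\<eta> i) = 0"
    and sq: "\<And>i. integrable M (\<lambda>\<omega>. (\<eta> i \<omega>)\<^sup>2)" "\<And>i. expectation (\<lambda>\<omega>. (\<eta> i \<omega>)\<^sup>2) = \<sigma>\<^sup>2"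
    and L: "0 < L" and b: "b < L" and n: "0 < n"
  defines "T \<equiv> \<lambda>\<omega>. \<bar>shifted_block \<eta> 0 n L b \<omega> / sqrt n\<bar>"
  shows "integrable M T" "expectation T \<le> (1 + \<sigma>\<^sup>2) / 2"
proof -
  let ?I = "{block_start n L b..<block_start n L (Suc b)}"
  have "indep_vars (\<lambda>_. borel) (\<lambda>i \<omega>. \<Sum>j\<in>{int (Suc i)}. \<eta> j \<omega>) ?I"
    by (intro indep_vars_group_sums[OF \<eta>]) (auto simp: disjoint_family_on_def)
  then have "indep_vars (\<lambda>_. borel) (shifted \<eta> 0) ?I" by (simp add: shifted_def[abs_def])
  from sum_square_integral[OF this] sq mean
  have s: "integrable M (\<lambda>\<omega>. (shifted_block \<eta> 0 n L b \<omega>)\<^sup>2)" "integrable M (shifted_block \<eta> 0 n L b)"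
    "expectation (\<lambda>\<omega>. (shifted_block \<eta> 0 n L b \<omega>)\<^sup>2) = real (card ?I) * \<sigma>\<^sup>2"
    by (simp_all add: shifted_def shifted_block_def[abs_def])
  have "block_start n L (Suc b) \<le> n"
  proof -
    have "Suc b * n \<le> L * n" using b by (intro mult_right_mono) auto
    then show ?thesis using L unfolding block_start_def by (metis div_le_mono nonzero_mult_div_cancel_left neq0_conv)
  qed
  then have "real (card ?I) / n \<le> 1" using n by simp
  from mult_right_mono[OF this, of "\<sigma>\<^sup>2"] have c: "real (card ?I) * \<sigma>\<^sup>2 / n \<le> \<sigma>\<^sup>2" by simp
  show T: "integrable M T" unfolding T_def using s(2) by simp
  have "expectation T \<le> expectation (\<lambda>\<omega>. (1 + (shifted_block \<eta> 0 n L b \<omega>)\<^sup>2 / n) / 2)"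
  proof (rule integral_mono[OF T])
    fix \<omega>
    have "0 \<le> (1 - T \<omega>)\<^sup>2" by simp
    then have "T \<omega> \<le> (1 + (T \<omega>)\<^sup>2) / 2" by (simp add: power2_eq_square algebra_simps)
    then show "T \<omega> \<le> (1 + (shifted_block \<eta> 0 n L b \<omega>)\<^sup>2 / n) / 2" by (simp add: T_def power_divide)
  qed (use s(1) in simp)
  also have "\<dots> = (1 + real (card ?I) * \<sigma>\<^sup>2 / n) / 2" using s(1,3) by (simp add: prob_space)
  also have "\<dots> \<le> (1 + \<sigma>\<^sup>2) / 2" by (intro divide_right_mono add_left_mono c) simp
  finally show "expectation T \<le> (1 + \<sigma>\<^sup>2) / 2" .
qed

text \<open>Once 4 / sqrt n < \<delta> / 2, the uniform Riemann sum estimate keeps all denominators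
  at least \<delta> / 2. This makes precise from which n on the estimator is considered on the whole
  class.\<close>

lemma Q_process_in_linfty:
  assumes q: "1 \<le> q" "q < 2" and \<delta>: "0 < \<delta>"
  shows "\<forall>\<^sub>F n in sequentially. 0 < n \<and> (\<forall>f\<in>F_class q \<delta>. \<delta> / 2 \<le> (\<Sum>i<n. (f (real (Suc i) / n))\<^sup>2) / n) \<and>
     (\<forall>\<omega>. Q_process (F_class q \<delta>) \<beta> X n \<omega> \<in> mspace (linfty (F_class q \<delta>)))"
proof -
  have "(\<lambda>n. 4 / sqrt (real n)) \<longlonglongrightarrow> 0" by real_asymp
  then have "\<forall>\<^sub>F n in sequentially. 4 / sqrt (real n) < \<delta> / 2" using \<delta> by (intro order_tendstoD(2)) auto
  then show ?thesis
    using eventually_gt_at_top[of 0]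
  proof eventually_elim
    case (elim n)
    have R: "\<delta> / 2 \<le> (\<Sum>i<n. (f (real (Suc i) / n))\<^sup>2) / n" if f: "f \<in> F_class q \<delta>" for f
      using F_class_riemann_sum[OF q(1) f \<delta> _ elim(2)] q(2) elim(1) sq_integral_gt[OF q(1) \<delta> f]
      unfolding sq_integral_def by linarith
    have "\<bar>Q_process (F_class q \<delta>) \<beta> X n \<omega> f\<bar> \<le> (\<Sum>i<n. \<bar>X (int (Suc i)) \<omega>\<bar>) / sqrt n / sqrt (\<delta> / 2)"
      if f: "f \<in> F_class q \<delta>" for f \<omega>
    proof -
      have "\<bar>\<Sum>i<n. f (real (Suc i) / n) * X (int (Suc i)) \<omega>\<bar> \<le> (\<Sum>i<n. \<bar>X (int (Suc i)) \<omega>\<bar>)"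
      proof (intro order.trans[OF sum_abs] sum_mono)
        fix i assume "i \<in> {..<n}"
        then have "\<bar>f (real (Suc i) / n)\<bar> \<le> 1" by (intro F_class_abs_le_1[OF q(1) f]) auto
        then show "\<bar>f (real (Suc i) / n) * X (int (Suc i)) \<omega>\<bar> \<le> \<bar>X (int (Suc i)) \<omega>\<bar>"
          by (simp add: abs_mult mult_left_le_one_le)
      qed
      then have "\<bar>\<Sum>i<n. f (real (Suc i) / n) * X (int (Suc i)) \<omega>\<bar> / sqrt n / sqrt ((\<Sum>i<n. (f (real (Suc i) / n))\<^sup>2) / n)
        \<le> (\<Sum>i<n. \<bar>X (int (Suc i)) \<omega>\<bar>) / sqrt n / sqrt (\<delta> / 2)"
      proof (intro frac_le)
        show "sqrt (\<delta> / 2) \<le> sqrt ((\<Sum>i<n. (f (real (Suc i) / n))\<^sup>2) / n)" using R[OF f] by (rule real_sqrt_le_mono)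
      qed (use \<delta> elim(2) in \<open>auto intro!: divide_nonneg_nonneg sum_nonneg\<close>)
      moreover have pos: "0 < (\<Sum>i<n. (f (real (Suc i) / n))\<^sup>2) / n" using R[OF f] \<delta> by linarith
      ultimately show ?thesis unfolding Q_process_eq[OF f elim(2) pos] by simp
    qed
    then have "Q_process (F_class q \<delta>) \<beta> X n \<omega> \<in> mspace (linfty (F_class q \<delta>))" for \<omega>
      unfolding in_linfty_iff bounded_iff
      by (auto simp: Q_process_def intro!: exI[of _ "(\<Sum>i<n. \<bar>X (int (Suc i)) \<omega>\<bar>) / sqrt n / sqrt (\<delta> / 2)"])
    then show ?case using R elim(2) by blast
  qed
qed

end

theorem theorem14:
  fixes q \<delta> \<beta> \<sigma> A :: real
    and M :: "'a measure"
    and \<eta> :: "int \<Rightarrow> 'a \<Rightarrow> real"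
    and \<psi> :: "nat \<Rightarrow> real"
  assumes q: "1 \<le> q" "q < 2"
    and \<delta>: "0 < \<delta>" "\<delta> < 1"
    and M: "prob_space M"
    and \<eta>_indep: "prob_space.indep_vars M (\<lambda>_. borel) \<eta> UNIV"
    and \<eta>_ident: "\<And>i j. distr M borel (\<eta> i) = distr M borel (\<eta> j)"
    and \<eta>_mean: "integrable M (\<eta> 1)" "(\<integral>\<omega>. \<eta> 1 \<omega> \<partial>M) = 0"
    and \<eta>_var: "integrable M (\<lambda>\<omega>. (\<eta> 1 \<omega>)\<^sup>2)" "(\<integral>\<omega>. (\<eta> 1 \<omega>)\<^sup>2 \<partial>M) = \<sigma>\<^sup>2" "\<sigma> > 0"
    and \<psi>: "summable (\<lambda>j. \<bar>\<psi> j\<bar>)" "A = (\<Sum>j. \<psi> j)" "A \<noteq> 0"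
  shows "\<exists>(P :: ((real \<Rightarrow> real) \<Rightarrow> real) measure) \<nu>.
      prob_space P \<and>
      gaussian_process P (F_class q \<delta>) \<nu> \<and>
      separably_valued P (linfty (F_class q \<delta>)) \<nu> \<and>
      borel_measurable_on_range P (linfty (F_class q \<delta>)) \<nu> \<and>
      converges_outer_distribution (linfty (F_class q \<delta>))
        (\<lambda>_. M) (Q_process (F_class q \<delta>) \<beta> (linear_process \<psi> \<eta>))
        P (\<lambda>\<omega>. \<lambda>f\<in>F_class q \<delta>. \<sigma> * A * \<nu> \<omega> f)"
proof -
  interpret M: prob_space M by (fact M)
  let ?F = "F_class q \<delta>" and ?E = "linfty (F_class q \<delta>)"
  have \<eta>m: "\<eta> i \<in> borel_measurable M" for i using \<eta>_indep by (auto simp: M.indep_vars_def)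
  have transfer: "integrable M (\<lambda>\<omega>. g (\<eta> i \<omega>)) \<longleftrightarrow> integrable M (\<lambda>\<omega>. g (\<eta> 1 \<omega>))" "M.expectation (\<lambda>\<omega>. g (\<eta> i \<omega>)) = M.expectation (\<lambda>\<omega>. g (\<eta> 1 \<omega>))"
    if "g \<in> borel_measurable borel" for g :: "real \<Rightarrow> real" and i
    using that \<eta>m integrable_distr_eq[of "\<eta> i" M borel g] integrable_distr_eq[of "\<eta> 1" M borel g]
      integral_distr[of "\<eta> i" M borel g] integral_distr[of "\<eta> 1" M borel g] \<eta>_ident[of i 1] by simp_all
  have mean: "M.expectation (\<eta> i) = 0" for i using transfer(2)[of "\<lambda>x. x" i] \<eta>_mean by simp
  have sq: "integrable M (\<lambda>\<omega>. (\<eta> i \<omega>)\<^sup>2)" "M.expectation (\<lambda>\<omega>. (\<eta> i \<omega>)\<^sup>2) = \<sigma>\<^sup>2" for i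
    using transfer[of "\<lambda>x. x\<^sup>2" i] \<eta>_var by simp_all
  define P :: "((real \<Rightarrow> real) \<Rightarrow> real) measure" where "P = PiM UNIV (\<lambda>_. std_normal_distribution)"
  \<comment> \<open>Only countably many coordinates of \<open>P\<close> are used, those at the constant functions.\<close>
  define \<iota> :: "nat \<Rightarrow> real \<Rightarrow> real" where "\<iota> k = (\<lambda>_. real k)" for k
  define \<xi> where "\<xi> k \<omega> = \<omega> (\<iota> k)" for k and \<omega> :: "(real \<Rightarrow> real) \<Rightarrow> real"
  have "inj \<iota>" by (auto simp: inj_def \<iota>_def fun_eq_iff)
  from iid_std_normal_coordinates[OF this]
  have P: "prob_space P" and \<xi>: "prob_space.iid_std_normal P \<xi> UNIV" by (simp_all add: P_def \<xi>_def[abs_def])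
  interpret P: prob_space P by (fact P)
  let ?N = "\<lambda>K. dyadic_normal \<xi> K"
  have N: "P.iid_std_normal (?N K) {..<2 ^ K}" for K by (rule P.iid_dyadic_normal[OF \<xi>])
  obtain G \<nu> where G: "G \<in> P.events" "AE \<omega> in P. \<omega> \<in> G" and \<nu>: "\<And>\<omega>. \<nu> \<omega> \<in> mspace ?E"
    and lim: "\<And>\<omega>. (\<lambda>K. mdist ?E (block_map q \<delta> (2 ^ K) (\<lambda>b. indicator G \<omega> * (?N K b \<omega> / sqrt (2 ^ K)))) (\<nu> \<omega>)) \<longlonglongrightarrow> 0"
    using P.dyadic_limit[OF \<xi> q \<delta>(1)] by blast
  have gauss: "gaussian_process P ?F \<nu>" by (rule P.gaussian_process_dyadic[OF \<xi> q(1) \<delta>(1) G \<nu> lim])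
  note pl = P.pointwise_limit_dyadic[OF \<xi> q(1) \<delta>(1) G(1) \<nu> lim]
  have "\<nu> \<omega> \<in> extensional ?F" for \<omega> using \<nu>[of \<omega>] unfolding in_linfty_iff by simp
  \<comment> \<open>Each path of \<nu> is extensional, so the factor 1 in
    \<open>pointwise_limit_dyadic\<close> gives back \<nu> itself.\<close>
  then have one: "(\<lambda>\<omega>. \<lambda>f\<in>?F. 1 * \<nu> \<omega> f) = \<nu>"
    by (simp add: extensional_restrict)
  have pl1: "pointwise_limit P ?E (\<lambda>K \<omega>. block_map q \<delta> (2 ^ K) (\<lambda>b. 1 * (indicator G \<omega> * (?N K b \<omega> / sqrt (2 ^ K))))) \<nu>"
    using pl[of 1] unfolding one .
  have sep: "separably_valued P ?E \<nu>" by (rule block_map_limit_separable[OF q(1) \<delta>(1) pl1])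
  have meas: "borel_measurable_on_range P ?E \<nu>" by (rule pointwise_limit.Y_borel_measurable_on_range[OF pl1])
  \<comment> \<open>The approximation on the side of the data; \<open>Ys K\<close> is its Gaussian
    limit for fixed K, with the almost surely trivial factor \<open>indicator G\<close> kept for
    pointwise convergence in K.\<close>
  define X where "X K n \<omega> = block_map q \<delta> (2 ^ K) (\<lambda>b. A * (shifted_block \<eta> 0 n (2 ^ K) b \<omega> / sqrt n))" for K n \<omega>
  define Ys where "Ys K \<omega> = block_map q \<delta> (2 ^ K) (\<lambda>b. \<sigma> * A * (indicator G \<omega> * (?N K b \<omega> / sqrt (2 ^ K))))" for K \<omega>
  define Y where "Y \<omega> = (\<lambda>f\<in>?F. \<sigma> * A * \<nu> \<omega> f)" for \<omega>
  let ?Z = "Q_process ?F \<beta> (linear_process \<psi> \<eta>)"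
  have plY: "pointwise_limit P ?E Ys Y" unfolding Ys_def[abs_def] Y_def[abs_def] by (rule pl)
  have sbm: "shifted_block \<eta> 0 n L b \<in> borel_measurable M" for n L b
    unfolding shifted_block_def[abs_def] shifted_def using \<eta>m by (intro borel_measurable_sum)
  have sh: "M.indep_vars (\<lambda>_. borel) (shifted \<eta> 0) UNIV"
  proof -
    have "M.indep_vars (\<lambda>_. borel) (\<lambda>i \<omega>. \<Sum>j\<in>{int (Suc i)}. \<eta> j \<omega>) UNIV"
      by (intro M.indep_vars_group_sums[OF \<eta>_indep]) (auto simp: disjoint_family_on_def)
    then show ?thesis by (simp add: shifted_def[abs_def])
  qed
  note qc = M.Q_process_in_linfty[OF q \<delta>(1), of \<beta> "linear_process \<psi> \<eta>"]
  have "outer_approximation M P ?E Ys Y ?Z X"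
  proof (rule outer_approximation.intro[OF M plY], unfold_locales)
    show "\<forall>\<^sub>F n in sequentially. ?Z n \<in> space M \<rightarrow> mspace ?E" using qc by eventually_elim auto
    show "X K n \<in> space M \<rightarrow> mspace ?E" for K n
      unfolding X_def using block_map_in[OF q(1) \<delta>(1)] by auto
    fix K and h :: "((real \<Rightarrow> real) \<Rightarrow> real) \<Rightarrow> real" assume h: "bounded_lipschitz ?E h"
    have l1: "l1_lipschitz (2 ^ K) (\<lambda>x. h (block_map q \<delta> (2 ^ K) (\<lambda>b. A * x b)))"
      by (rule l1_lipschitz_scale[OF l1_lipschitz_block_map[OF q(1) \<delta>(1) h]])
    show Xm: "(\<lambda>\<omega>. h (X K n \<omega>)) \<in> borel_measurable M" for n
      unfolding X_def using sbm by (intro l1_lipschitz_compose_measurable[OF l1]) auto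
    obtain c where "\<And>x. x \<in> mspace ?E \<Longrightarrow> \<bar>h x\<bar> \<le> c" using h unfolding bounded_lipschitz_def by blast
    then have c: "\<bar>h (block_map q \<delta> (2 ^ K) (\<lambda>b. A * x b))\<bar> \<le> c" for x using block_map_in[OF q(1) \<delta>(1)] by blast
    have "(\<lambda>n. M.expectation (\<lambda>\<omega>. h (block_map q \<delta> (2 ^ K) (\<lambda>b. A * ((\<Sum>i=block_start n (2 ^ K) b..<block_start n (2 ^ K) (Suc b). shifted \<eta> 0 i \<omega>) / sqrt n)))))
      \<longlonglongrightarrow> P.expectation (\<lambda>\<omega>. h (block_map q \<delta> (2 ^ K) (\<lambda>b. A * (\<sigma> / sqrt (2 ^ K) * ?N K b \<omega>))))"
      using M.block_clt[OF sh _ _ _ _ \<eta>_var(3) _ P _ _ l1 c, of "?N K"] N[of K] mean sq \<eta>_ident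
      by (simp add: P.iid_std_normal_def shifted_def)
    also have "P.expectation (\<lambda>\<omega>. h (block_map q \<delta> (2 ^ K) (\<lambda>b. A * (\<sigma> / sqrt (2 ^ K) * ?N K b \<omega>)))) = P.expectation (\<lambda>\<omega>. h (Ys K \<omega>))"
    proof (rule integral_cong_AE)
      show "(\<lambda>\<omega>. h (Ys K \<omega>)) \<in> borel_measurable P" by (rule pointwise_limit.Ys_meas[OF plY h])
      \<comment> \<open>Truncated for measurability; \<open>l1_lipschitz_cong\<close> shows that the
        functional does not change.\<close>
      let ?V = "\<lambda>b \<omega>. if b < 2 ^ K then \<sigma> / sqrt (2 ^ K) * ?N K b \<omega> else 0"
      have "(\<lambda>\<omega>. h (block_map q \<delta> (2 ^ K) (\<lambda>b. A * ?V b \<omega>))) \<in> borel_measurable P"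
      proof (rule l1_lipschitz_compose_measurable[OF l1])
        show "?V b \<in> borel_measurable P" for b
          using P.iid_std_normalD(1)[OF N, of b K] by (cases "b < 2 ^ K") auto
      qed
      moreover have "h (block_map q \<delta> (2 ^ K) (\<lambda>b. A * ?V b \<omega>)) = h (block_map q \<delta> (2 ^ K) (\<lambda>b. A * (\<sigma> / sqrt (2 ^ K) * ?N K b \<omega>)))" for \<omega>
        by (intro l1_lipschitz_cong[OF l1]) auto
      ultimately show "(\<lambda>\<omega>. h (block_map q \<delta> (2 ^ K) (\<lambda>b. A * (\<sigma> / sqrt (2 ^ K) * ?N K b \<omega>)))) \<in> borel_measurable P" by simp
      show "AE \<omega> in P. h (block_map q \<delta> (2 ^ K) (\<lambda>b. A * (\<sigma> / sqrt (2 ^ K) * ?N K b \<omega>))) = h (Ys K \<omega>)"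
        using G(2) by eventually_elim (simp add: Ys_def mult_ac)
    qed
    finally show "(\<lambda>n. M.expectation (\<lambda>\<omega>. h (X K n \<omega>))) \<longlonglongrightarrow> P.expectation (\<lambda>\<omega>. h (Ys K \<omega>))"
      by (simp add: X_def shifted_block_def)
  next
    fix e :: real assume e: "0 < e"
    define d where "d = \<delta> / 2"
    have d: "0 < d" using \<delta> by (simp add: d_def)
    \<comment> \<open>e' has to serve as a probability, at most e / 2, and as an error of the
      numerator, at most e / 2 after division by sqrt d.\<close>
    define e' where "e' = min (e / 2) (e / 2 * sqrt d)"
    have e': "0 < e'" using e d by (simp add: e'_def)
    have e'2: "e' / sqrt d \<le> e / 2"
    proof -
      have "e' / sqrt d \<le> (e / 2 * sqrt d) / sqrt d" using d by (intro divide_right_mono) (auto simp: e'_def)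
      then show ?thesis using d by simp
    qed
    show "\<forall>\<^sub>F K in sequentially. \<forall>\<^sub>F n in sequentially. \<exists>B\<in>sets M. M.prob B \<le> e \<and> (\<forall>\<omega>\<in>space M - B. mdist ?E (?Z n \<omega>) (X K n \<omega>) \<le> e)"
      using M.linear_process_approximation[OF \<eta>_indep \<eta>_ident mean sq \<eta>_var(3) \<psi>(1) q P N e', of \<delta>]
    proof eventually_elim
      case (elim K)
      \<comment> \<open>Markov's level for the total \<open>T\<close> of the absolute block sums:
        its mean is at most 2^K (1 + \<sigma>^2) / 2, so \<open>T\<close> exceeds c with probability
        at most e / 2. Otherwise |\<phi>| \<le> c, which the change of normaliser needs.\<close>
      define c where "c = 2 * (2 ^ K * ((1 + \<sigma>\<^sup>2) / 2)) / e"
      have c: "0 < c" using e by (simp add: c_def add_pos_nonneg)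
      have "(\<lambda>n. \<bar>A\<bar> * c * (4 / sqrt (real n) / (d * sqrt d))) \<longlonglongrightarrow> 0"
        using d by real_asymp
      then have "\<forall>\<^sub>F n in sequentially. \<bar>A\<bar> * c * (4 / sqrt (real n) / (d * sqrt d)) < e / 2"
        using e by (intro order_tendstoD(2)) auto
      then show ?case
        using elim qc
      proof eventually_elim
        case (elim n)
        have n: "0 < n" and R: "\<And>f. f \<in> ?F \<Longrightarrow> d \<le> (\<Sum>i<n. (f (real (Suc i) / n))\<^sup>2) / n"
          and Zin: "\<And>\<omega>. ?Z n \<omega> \<in> mspace ?E" using elim(3) by (auto simp: d_def)
        obtain B where B: "B \<in> M.events" "M.prob B \<le> e'"
          and near: "\<And>\<omega> f. \<omega> \<in> space M - B \<Longrightarrow> f \<in> ?F \<Longrightarrow>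
            \<bar>(\<Sum>i<n. f (real (Suc i) / n) * linear_process \<psi> \<eta> (int (Suc i)) \<omega>) / sqrt n
              - A * ((\<Sum>b<2 ^ K. f (real (Suc b) / 2 ^ K) * shifted_block \<eta> 0 n (2 ^ K) b \<omega>) / sqrt n)\<bar> \<le> e'"
          using elim(2) unfolding \<psi>(2) by blast
        define T where "T \<omega> = (\<Sum>b<2 ^ K. \<bar>shifted_block \<eta> 0 n (2 ^ K) b \<omega> / sqrt n\<bar>)" for \<omega>
        have sb: "integrable M (\<lambda>\<omega>. \<bar>shifted_block \<eta> 0 n (2 ^ K) b \<omega> / sqrt n\<bar>)"
            "M.expectation (\<lambda>\<omega>. \<bar>shifted_block \<eta> 0 n (2 ^ K) b \<omega> / sqrt n\<bar>) \<le> (1 + \<sigma>\<^sup>2) / 2" if "b < 2 ^ K" for b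
          by (rule M.shifted_block_moments[OF \<eta>_indep mean sq _ that n]; simp)+
        have T: "integrable M T" "\<And>\<omega>. 0 \<le> T \<omega>"
          unfolding T_def[abs_def] using sb(1) by (auto intro!: Bochner_Integration.integrable_sum sum_nonneg)
        have "M.expectation T = (\<Sum>b<2 ^ K. M.expectation (\<lambda>\<omega>. \<bar>shifted_block \<eta> 0 n (2 ^ K) b \<omega> / sqrt n\<bar>))"
          unfolding T_def[abs_def] using sb(1) by (intro Bochner_Integration.integral_sum) auto
        also have "\<dots> \<le> (\<Sum>b<(2::nat) ^ K. (1 + \<sigma>\<^sup>2) / 2)" using sb(2) by (intro sum_mono) auto
        finally have ET: "M.expectation T \<le> 2 ^ K * ((1 + \<sigma>\<^sup>2) / 2)" by simp
        note mk = M.markov[OF T c]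
        have "M.expectation T / c \<le> 2 ^ K * ((1 + \<sigma>\<^sup>2) / 2) / c" using ET c by (intro divide_right_mono) auto
        also have "\<dots> = e / 2"
        proof -
          have cancel: "w / (2 * w / e) = e / 2" if "0 < w" for w :: real using that e by simp
          show ?thesis unfolding c_def by (rule cancel) (simp add: add_pos_nonneg)
        qed
        finally have PT: "M.prob {\<omega> \<in> space M. c < T \<omega>} \<le> e / 2" using mk(2) by linarith
        have "M.prob (B \<union> {\<omega> \<in> space M. c < T \<omega>}) \<le> M.prob B + M.prob {\<omega> \<in> space M. c < T \<omega>}"
          by (rule measure_Un_le[OF B(1) mk(1)])
        also have "\<dots> \<le> e" using B(2) PT by (simp add: e'_def)
        finally have PB: "M.prob (B \<union> {\<omega> \<in> space M. c < T \<omega>}) \<le> e" .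
        have "mdist ?E (?Z n \<omega>) (X K n \<omega>) \<le> e" if \<omega>: "\<omega> \<in> space M - (B \<union> {\<omega> \<in> space M. c < T \<omega>})" for \<omega>
        proof (rule linfty_mdist_le[OF Zin])
          show "X K n \<omega> \<in> mspace ?E" unfolding X_def by (rule block_map_in[OF q(1) \<delta>(1)])
          fix f assume f: "f \<in> ?F"
          define \<phi> where "\<phi> = (\<Sum>b<2 ^ K. f (real (Suc b) / 2 ^ K) * shifted_block \<eta> 0 n (2 ^ K) b \<omega>) / sqrt n"
          have \<phi>: "\<bar>\<phi>\<bar> \<le> c"
          proof -
            have "\<phi> = (\<Sum>b<2 ^ K. f (real (Suc b) / 2 ^ K) * (shifted_block \<eta> 0 n (2 ^ K) b \<omega> / sqrt n))"
              by (simp add: \<phi>_def sum_divide_distrib)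
            also have "\<bar>\<dots>\<bar> \<le> T \<omega>"
              unfolding T_def
            proof (intro order.trans[OF sum_abs] sum_mono)
              fix b :: nat assume "b \<in> {..<2 ^ K}"
              then have "real (Suc b) \<le> 2 ^ K" by (metis Suc_leI lessThan_iff of_nat_le_iff of_nat_numeral of_nat_power)
              then have "\<bar>f (real (Suc b) / 2 ^ K)\<bar> \<le> 1" by (intro F_class_abs_le_1[OF q(1) f]) auto
              then show "\<bar>f (real (Suc b) / 2 ^ K) * (shifted_block \<eta> 0 n (2 ^ K) b \<omega> / sqrt n)\<bar> \<le> \<bar>shifted_block \<eta> 0 n (2 ^ K) b \<omega> / sqrt n\<bar>"
                unfolding abs_mult by (intro mult_left_le_one_le) auto
            qed
            also have "T \<omega> \<le> c" using \<omega> by auto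
            finally show ?thesis .
          qed
          have X: "X K n \<omega> f = A * \<phi> / sqrt (sq_integral f)"
            using f by (simp add: X_def block_map_def \<phi>_def sum_distrib_left sum_divide_distrib mult_ac)
          have "0 < (\<Sum>i<n. (f (real (Suc i) / n))\<^sup>2) / n" using R[OF f] d by linarith
          note Q = Q_process_eq[OF f n this]
          have "\<bar>?Z n \<omega> f - X K n \<omega> f\<bar> \<le> e' / sqrt d + \<bar>A\<bar> * c * (4 / sqrt n / (d * sqrt d))"
            unfolding Q X
          proof (rule normalised_diff_le[OF d R[OF f] _ _ \<phi>])
            show "d \<le> sq_integral f" using sq_integral_gt[OF q(1) \<delta>(1) f] \<delta> by (simp add: d_def)
            show "\<bar>sq_integral f - (\<Sum>i<n. (f (real (Suc i) / n))\<^sup>2) / n\<bar> \<le> 4 / sqrt n"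
              unfolding sq_integral_def by (rule F_class_riemann_sum[OF q(1) f \<delta>(1) less_imp_le[OF q(2)] n])
            show "\<bar>(\<Sum>i<n. f (real (Suc i) / n) * linear_process \<psi> \<eta> (int (Suc i)) \<omega>) / sqrt n - A * \<phi>\<bar> \<le> e'"
              unfolding \<phi>_def using \<omega> f by (intro near) auto
          qed
          then show "\<bar>?Z n \<omega> f - X K n \<omega> f\<bar> \<le> e" using e'2 elim(1) by linarith
        qed (use e in simp)
        then show ?case using B(1) mk(1) PB by (intro bexI[of _ "B \<union> {\<omega> \<in> space M. c < T \<omega>}"]) auto
      qed
    qed
  qed
  then interpret outer_approximation M P ?E Ys Y ?Z X .
  have "separably_valued P ?E Y"
    by (rule block_map_limit_separable[OF q(1) \<delta>(1) plY[unfolded Ys_def]])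
  then have "converges_outer_distribution ?E (\<lambda>_. M) ?Z P Y" by (rule converges)
  then show ?thesis using P gauss sep meas unfolding Y_def by blast
qed

end
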